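(* Let $A$ be a $C^*$-algebra. If $\mathcal B$ is the monotone sequentially closed $C^*$-algebra generated by $((A_{\mathrm{sa}})^m)^-$ in $A^{**}$, then $\mathcal B\subset\mathcal U_{\mathbb C}(A)$.
   Context: $A^{**}$ is the enveloping von Neumann algebra (bidual) of the $C^*$-algebra $A$. $A_{\mathrm{sa}}$ is the self-adjoint part of $A$; $(A_{\mathrm{sa}})^m$ is the set of limits in $A^{**}$ ($\sigma$-weak, equivalently strong) of bounded increasing nets from $A_{\mathrm{sa}}$; the superscript ${}^-$ denotes norm closure. An element $h\in A^{**}_{\mathrm{sa}}$ is strongly lower semicontinuous if $h\in((A_{\mathrm{sa}})^m)^-$, and $k$ is strongly upper semicontinuous if $-k$ is strongly lower semicontinuous. $\mathcal U(A)$ (the universally measurable elements) is the set of $x\in A^{**}_{\mathrm{sa}}$ such that for every $\epsilon>0$ and every state $\varphi$ of $A$ (extended normally to $A^{**}$) there are a strongly lower semicontinuous $h$ and a strongly upper semicontinuous $k$ with $k\le x\le h$ and $\varphi(h-k)<\epsilon$. $\mathcal U_{\mathbb C}(A)=\mathcal U(A)+i\,\mathcal U(A)$. A $C^*$-subalgebra $C$ of $A^{**}$ is monotone sequentially closed if $C_{\mathrm{sa}}$ contains the limit of every bounded monotone sequence from $C_{\mathrm{sa}}$; $\mathcal B$ is the smallest monotone sequentially closed $C^*$-subalgebra of $A^{**}$ containing $((A_{\mathrm{sa}})^m)^-$. *)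

theory Defs
  imports "HOL-Analysis.Analysis"
begin

section \<open>C*-algebras\<close>

class complex_normed_vector = real_normed_vector +
  fixes scaleC :: "complex \<Rightarrow> 'a \<Rightarrow> 'a"  (infixr \<open>*\<^sub>C\<close> 75)
  assumes scaleC_add_right: "c *\<^sub>C (x + y) = c *\<^sub>C x + c *\<^sub>C y"
    and scaleC_add_left: "(c + d) *\<^sub>C x = c *\<^sub>C x + d *\<^sub>C x"
    and scaleC_scaleC: "c *\<^sub>C d *\<^sub>C x = (c * d) *\<^sub>C x"
    and scaleC_of_real: "complex_of_real r *\<^sub>C x = r *\<^sub>R x"
    and norm_scaleC: "norm (c *\<^sub>C x) = cmod c * norm x"

(* No unit is assumed. *)
class cstar_algebra = complex_normed_vector + real_normed_algebra + complete_space +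
  fixes star :: "'a \<Rightarrow> 'a"
  assumes scaleC_mult_left: "(c *\<^sub>C x) * y = c *\<^sub>C (x * y)"
    and scaleC_mult_right: "x * (c *\<^sub>C y) = c *\<^sub>C (x * y)"
    and star_star: "star (star x) = x"
    and star_add: "star (x + y) = star x + star y"
    and star_scaleC: "star (c *\<^sub>C x) = cnj c *\<^sub>C star x"
    and star_mult: "star (x * y) = star y * star x"
    and norm_star_mult_self: "norm (star x * x) = (norm x)\<^sup>2"
begin

definition selfadjoint :: "'a \<Rightarrow> bool"
  where "selfadjoint a \<longleftrightarrow> star a = a"

definition cstar_le :: "'a \<Rightarrow> 'a \<Rightarrow> bool"
  where "cstar_le a b \<longleftrightarrow> (\<exists>c. b - a = star c * c)"

end

lemma norm_star: "norm (star x) = norm (x :: 'a :: cstar_algebra)"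
proof -
  have le: "norm y \<le> norm (star y)" for y :: 'a
  proof (cases "norm y = 0")
    case False
    have "norm y * norm y \<le> norm (star y) * norm y"
      using norm_mult_ineq[of "star y" y] norm_star_mult_self[of y]
      by (simp add: power2_eq_square)
    with False show ?thesis
      by (simp add: mult_le_cancel_right)
  qed simp
  show ?thesis
    using le[of x] le[of "star x"] by (simp add: star_star)
qed


section \<open>The Banach dual of a complex normed space\<close>

definition bounded_clinear :: "('a :: complex_normed_vector \<Rightarrow> complex) \<Rightarrow> bool"
  where "bounded_clinear f \<longleftrightarrow> bounded_linear f \<and> (\<forall>c x. f (c *\<^sub>C x) = c * f x)"

lemma bounded_clinearI:
  assumes "\<And>x y. f (x + y) = f x + f y"
    and "\<And>c x. f (c *\<^sub>C x) = c * f x"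
    and "\<And>x. cmod (f x) \<le> K * norm x"
  shows "bounded_clinear f"
  unfolding bounded_clinear_def
proof (intro conjI allI)
  show "bounded_linear f"
  proof (rule bounded_linear_intro[where K = K])
    fix r x
    show "f (r *\<^sub>R x) = r *\<^sub>R f x"
      using assms(2)[of "complex_of_real r" x] by (simp add: scaleC_of_real scaleR_conv_of_real)
  qed (use assms in \<open>auto simp: mult.commute\<close>)
qed (use assms in auto)

typedef (overloaded) 'a cdual = "{f :: 'a :: complex_normed_vector \<Rightarrow> complex. bounded_clinear f}"
  morphisms cdual_apply CDual
  by (rule exI[where x = "\<lambda>_. 0"]) (auto intro: bounded_clinearI[where K = 0])

setup_lifting type_definition_cdual

lemma cdual_eqI: "(\<And>x. cdual_apply f x = cdual_apply g x) \<Longrightarrow> f = g"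
  by transfer auto

lemma cdual_bounded_linear: "bounded_linear (cdual_apply f)"
  by transfer (auto simp: bounded_clinear_def)

lemma cdual_add: "cdual_apply f (x + y) = cdual_apply f x + cdual_apply f y"
  by (rule linear_add[OF bounded_linear.linear[OF cdual_bounded_linear]])

lemma cdual_scaleC: "cdual_apply f (c *\<^sub>C x) = c * cdual_apply f x"
  by transfer (auto simp: bounded_clinear_def)

instantiation cdual :: (complex_normed_vector) real_normed_vector
begin

lift_definition zero_cdual :: "'a cdual" is "\<lambda>_. 0"
  by (rule bounded_clinearI[where K = 0]) auto

lift_definition plus_cdual :: "'a cdual \<Rightarrow> 'a cdual \<Rightarrow> 'a cdual" is "\<lambda>f g x. f x + g x"
  by (auto simp: bounded_clinear_def bounded_linear_add algebra_simps)

lift_definition minus_cdual :: "'a cdual \<Rightarrow> 'a cdual \<Rightarrow> 'a cdual" is "\<lambda>f g x. f x - g x"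
  by (auto simp: bounded_clinear_def bounded_linear_sub algebra_simps)

lift_definition uminus_cdual :: "'a cdual \<Rightarrow> 'a cdual" is "\<lambda>f x. - f x"
  by (auto simp: bounded_clinear_def bounded_linear_minus)

lift_definition scaleR_cdual :: "real \<Rightarrow> 'a cdual \<Rightarrow> 'a cdual" is "\<lambda>r f x. r *\<^sub>R f x"
  by (auto simp: bounded_clinear_def intro: bounded_linear_compose[OF bounded_linear_scaleR_right])

lift_definition norm_cdual :: "'a cdual \<Rightarrow> real" is onorm .

definition sgn_cdual :: "'a cdual \<Rightarrow> 'a cdual"
  where "sgn_cdual f = scaleR (inverse (norm f)) f"

definition dist_cdual :: "'a cdual \<Rightarrow> 'a cdual \<Rightarrow> real"
  where "dist_cdual f g = norm (f - g)"

definition uniformity_cdual :: "('a cdual \<times> 'a cdual) filter"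
  where "uniformity_cdual = (INF e\<in>{0 <..}. principal {(f, g). dist f g < e})"

definition open_cdual :: "'a cdual set \<Rightarrow> bool"
  where "open_cdual S = (\<forall>f\<in>S. \<forall>\<^sub>F (f', g) in uniformity. f' = f \<longrightarrow> g \<in> S)"

instance
proof
  fix f g h :: "'a cdual" and r s :: real
  show "f + g + h = f + (g + h)" "0 + f = f" "f + g = g + f" "- f + f = 0" "f - g = f + - g"
    by (transfer; simp add: fun_eq_iff)+
  show "r *\<^sub>R (f + g) = r *\<^sub>R f + r *\<^sub>R g" "(r + s) *\<^sub>R f = r *\<^sub>R f + s *\<^sub>R f"
    "r *\<^sub>R s *\<^sub>R f = (r * s) *\<^sub>R f" "1 *\<^sub>R f = f"
    by (transfer; simp add: fun_eq_iff algebra_simps)+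
  show "dist f g = norm (f - g)" "sgn f = inverse (norm f) *\<^sub>R f"
    by (simp_all add: dist_cdual_def sgn_cdual_def)
  show "uniformity = (INF e\<in>{0 <..}. principal {(f :: 'a cdual, g). dist f g < e})"
    by (rule uniformity_cdual_def)
  show "open U = (\<forall>f\<in>U. \<forall>\<^sub>F (f', g) in uniformity. f' = f \<longrightarrow> g \<in> U)" for U :: "'a cdual set"
    by (rule open_cdual_def)
  show "(norm f = 0) = (f = 0)"
    by transfer (auto simp: bounded_clinear_def onorm_eq_0)
  show "norm (f + g) \<le> norm f + norm g"
    by transfer (auto simp: bounded_clinear_def onorm_triangle)
  show "norm (r *\<^sub>R f) = \<bar>r\<bar> * norm f"
    by transfer (auto simp: bounded_clinear_def onorm_scaleR)
qed

end

instantiation cdual :: (complex_normed_vector) complex_normed_vector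
begin

lift_definition scaleC_cdual :: "complex \<Rightarrow> 'a cdual \<Rightarrow> 'a cdual" is "\<lambda>c f x. c * f x"
  by (auto simp: bounded_clinear_def intro: bounded_linear_compose[OF bounded_linear_mult_right])

instance
proof
  fix f g :: "'a cdual" and r :: real and c d :: complex
  show "c *\<^sub>C (f + g) = c *\<^sub>C f + c *\<^sub>C g" "(c + d) *\<^sub>C f = c *\<^sub>C f + d *\<^sub>C f"
    "c *\<^sub>C d *\<^sub>C f = (c * d) *\<^sub>C f" "complex_of_real r *\<^sub>C f = r *\<^sub>R f"
    by (transfer; simp add: fun_eq_iff algebra_simps scaleR_conv_of_real)+
  show "norm (c *\<^sub>C f) = cmod c * norm f"
  proof transfer
    fix c :: complex and f :: "'a \<Rightarrow> complex"
    assume "bounded_clinear f"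
    then have bl: "bounded_linear f" by (simp add: bounded_clinear_def)
    have le: "onorm (\<lambda>x. d * g x) \<le> cmod d * onorm g" if "bounded_linear g" for d and g :: "'a \<Rightarrow> complex"
    proof (rule onorm_bound)
      show "0 \<le> cmod d * onorm g" by (simp add: onorm_pos_le[OF that])
      show "cmod (d * g x) \<le> cmod d * onorm g * norm x" for x
        using onorm[OF that, of x] by (simp add: norm_mult mult.assoc mult_left_mono)
    qed
    show "onorm (\<lambda>x. c * f x) = cmod c * onorm f"
    proof (cases "c = 0")
      case True
      then show ?thesis by (simp add: onorm_zero)
    next
      case False
      have "bounded_linear (\<lambda>x. c * f x)"
        by (rule bounded_linear_compose[OF bounded_linear_mult_right bl])
      from le[OF this, of "inverse c"] False
      have "onorm f \<le> inverse (cmod c) * onorm (\<lambda>x. c * f x)"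
        by (simp add: norm_inverse flip: mult.assoc)
      with False have "cmod c * onorm f \<le> onorm (\<lambda>x. c * f x)"
        by (simp add: field_simps)
      with le[OF bl, of c] show ?thesis by simp
    qed
  qed
qed

end

lemma cdual_plus_apply [simp]: "cdual_apply (f + g) x = cdual_apply f x + cdual_apply g x"
  by transfer simp

lemma cdual_scaleC_apply [simp]: "cdual_apply (c *\<^sub>C f) x = c * cdual_apply f x"
  by transfer simp

lemma norm_cdual_apply: "cmod (cdual_apply f x) \<le> norm f * norm x"
  by transfer (auto simp: bounded_clinear_def intro: onorm)

lemma norm_cdual_bound:
  "0 \<le> K \<Longrightarrow> (\<And>x. cmod (cdual_apply f x) \<le> K * norm x) \<Longrightarrow> norm f \<le> K"
  by transfer (rule onorm_bound)


section \<open>The enveloping von Neumann algebra\<close>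

text \<open>
  \<open>A\<^sup>*\<^sup>*\<close> is the Banach space bidual of \<open>A\<close> with the (first) Arens product
  \<open>(x y)(f) = x (y \<cdot> f)\<close>, where \<open>(y \<cdot> f)(a) = y (f \<cdot> a)\<close> and \<open>(f \<cdot> a)(b) = f (a b)\<close>,
  and the involution \<open>x\<^sup>*(f) = cnj (x (f\<^sup>*))\<close>, where \<open>f\<^sup>*(a) = cnj (f (a\<^sup>*))\<close>.
  Its \<open>\<sigma>\<close>-weak topology is the weak-* topology \<open>\<sigma>(A\<^sup>*\<^sup>*, A\<^sup>*)\<close>, and the normal extension of
  a functional \<open>f\<close> on \<open>A\<close> is evaluation at \<open>f\<close>.
\<close>

type_synonym 'a bidual = "'a cdual cdual"

lift_definition bidual_emb :: "'a :: complex_normed_vector \<Rightarrow> 'a bidual" is "\<lambda>a f. cdual_apply f a"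
proof -
  fix a :: 'a
  show "bounded_clinear (\<lambda>f. cdual_apply f a)"
    by (rule bounded_clinearI[where K = "norm a"])
      (auto simp: norm_cdual_apply mult.commute[of "norm a"])
qed

lift_definition dual_rmult :: "'a :: cstar_algebra cdual \<Rightarrow> 'a \<Rightarrow> 'a cdual"
  is "\<lambda>f a b. f (a * b)"
proof -
  fix f :: "'a \<Rightarrow> complex" and a
  assume f: "bounded_clinear f"
  then have "bounded_linear (\<lambda>b. f (a * b))"
    unfolding bounded_clinear_def by (auto intro: bounded_linear_compose[OF _ bounded_linear_mult_right])
  with f show "bounded_clinear (\<lambda>b. f (a * b))"
    by (simp add: bounded_clinear_def scaleC_mult_right)
qed

lemma norm_dual_rmult: "norm (dual_rmult f a) \<le> norm f * norm a"
proof (rule norm_cdual_bound)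
  fix b
  have "cmod (cdual_apply f (a * b)) \<le> norm f * norm (a * b)" by (rule norm_cdual_apply)
  also have "\<dots> \<le> norm f * (norm a * norm b)" by (intro mult_left_mono norm_mult_ineq) auto
  finally show "cmod (cdual_apply (dual_rmult f a) b) \<le> norm f * norm a * norm b"
    by (simp add: dual_rmult.rep_eq mult.assoc)
qed simp

lift_definition bidual_lmult :: "'a :: cstar_algebra bidual \<Rightarrow> 'a cdual \<Rightarrow> 'a cdual"
  is "\<lambda>y f a. y (dual_rmult f a)"
proof -
  fix y :: "'a cdual \<Rightarrow> complex" and f :: "'a cdual"
  assume y: "bounded_clinear y"
  define Y where "Y = CDual y"
  have [simp]: "cdual_apply Y = y" using y by (simp add: Y_def CDual_inverse)
  show "bounded_clinear (\<lambda>a. y (dual_rmult f a))"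
  proof (rule bounded_clinearI[where K = "norm Y * norm f"])
    fix a b c
    have "dual_rmult f (a + b) = dual_rmult f a + dual_rmult f b"
      by (rule cdual_eqI) (simp add: dual_rmult.rep_eq cdual_add distrib_right)
    then show "y (dual_rmult f (a + b)) = y (dual_rmult f a) + y (dual_rmult f b)"
      using cdual_add[of Y] by simp
    have "dual_rmult f (c *\<^sub>C a) = c *\<^sub>C dual_rmult f a"
      by (rule cdual_eqI) (simp add: dual_rmult.rep_eq cdual_scaleC scaleC_mult_left)
    then show "y (dual_rmult f (c *\<^sub>C a)) = c * y (dual_rmult f a)"
      using cdual_scaleC[of Y] by simp
    have "cmod (y (dual_rmult f a)) \<le> norm Y * norm (dual_rmult f a)"
      using norm_cdual_apply[of Y] by simp
    also have "\<dots> \<le> norm Y * (norm f * norm a)"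
      by (intro mult_left_mono norm_dual_rmult) auto
    finally show "cmod (y (dual_rmult f a)) \<le> norm Y * norm f * norm a"
      by (simp add: mult.assoc)
  qed
qed

lemma norm_bidual_lmult: "norm (bidual_lmult y f) \<le> norm y * norm f"
proof (rule norm_cdual_bound)
  fix a
  have "cmod (cdual_apply y (dual_rmult f a)) \<le> norm y * norm (dual_rmult f a)"
    by (rule norm_cdual_apply)
  also have "\<dots> \<le> norm y * (norm f * norm a)"
    by (intro mult_left_mono norm_dual_rmult) auto
  finally show "cmod (cdual_apply (bidual_lmult y f) a) \<le> norm y * norm f * norm a"
    by (simp add: bidual_lmult.rep_eq mult.assoc)
qed simp

lift_definition arens :: "'a :: cstar_algebra bidual \<Rightarrow> 'a bidual \<Rightarrow> 'a bidual"  (infixl \<open>\<odot>\<close> 70)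
  is "\<lambda>x y f. x (bidual_lmult y f)"
proof -
  fix x :: "'a cdual \<Rightarrow> complex" and y :: "'a bidual"
  assume x: "bounded_clinear x"
  define X where "X = CDual x"
  have [simp]: "cdual_apply X = x" using x by (simp add: X_def CDual_inverse)
  show "bounded_clinear (\<lambda>f. x (bidual_lmult y f))"
  proof (rule bounded_clinearI[where K = "norm X * norm y"])
    fix f g :: "'a cdual" and c
    have "dual_rmult (f + g) a = dual_rmult f a + dual_rmult g a" for a
      by (rule cdual_eqI) (simp add: dual_rmult.rep_eq)
    then have "bidual_lmult y (f + g) = bidual_lmult y f + bidual_lmult y g"
      by (intro cdual_eqI) (simp add: bidual_lmult.rep_eq cdual_add)
    then show "x (bidual_lmult y (f + g)) = x (bidual_lmult y f) + x (bidual_lmult y g)"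
      using cdual_add[of X] by simp
    have "dual_rmult (c *\<^sub>C f) a = c *\<^sub>C dual_rmult f a" for a
      by (rule cdual_eqI) (simp add: dual_rmult.rep_eq)
    then have "bidual_lmult y (c *\<^sub>C f) = c *\<^sub>C bidual_lmult y f"
      by (intro cdual_eqI) (simp add: bidual_lmult.rep_eq cdual_scaleC)
    then show "x (bidual_lmult y (c *\<^sub>C f)) = c * x (bidual_lmult y f)"
      using cdual_scaleC[of X] by simp
    have "cmod (x (bidual_lmult y f)) \<le> norm X * norm (bidual_lmult y f)"
      using norm_cdual_apply[of X] by simp
    also have "\<dots> \<le> norm X * (norm y * norm f)"
      by (intro mult_left_mono norm_bidual_lmult) auto
    finally show "cmod (x (bidual_lmult y f)) \<le> norm X * norm y * norm f"
      by (simp add: mult.assoc)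
  qed
qed

lift_definition dual_star :: "'a :: cstar_algebra cdual \<Rightarrow> 'a cdual"
  is "\<lambda>f a. cnj (f (star a))"
proof -
  fix f :: "'a \<Rightarrow> complex"
  assume f: "bounded_clinear f"
  define F where "F = CDual f"
  have [simp]: "cdual_apply F = f" using f by (simp add: F_def CDual_inverse)
  show "bounded_clinear (\<lambda>a. cnj (f (star a)))"
  proof (rule bounded_clinearI[where K = "norm F"])
    fix a b c
    show "cnj (f (star (a + b))) = cnj (f (star a)) + cnj (f (star b))"
      using cdual_add[of F] by (simp add: star_add)
    show "cnj (f (star (c *\<^sub>C a))) = c * cnj (f (star a))"
      using cdual_scaleC[of F] by (simp add: star_scaleC)
    show "cmod (cnj (f (star a))) \<le> norm F * norm a"
      using norm_cdual_apply[of F "star a"] by (simp add: norm_star)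
  qed
qed

lemma norm_dual_star: "norm (dual_star f) \<le> norm f"
proof (rule norm_cdual_bound)
  fix a
  show "cmod (cdual_apply (dual_star f) a) \<le> norm f * norm a"
    using norm_cdual_apply[of f "star a"] by (simp add: dual_star.rep_eq norm_star)
qed simp

lift_definition bidual_star :: "'a :: cstar_algebra bidual \<Rightarrow> 'a bidual"
  is "\<lambda>x f. cnj (x (dual_star f))"
proof -
  fix x :: "'a cdual \<Rightarrow> complex"
  assume x: "bounded_clinear x"
  define X where "X = CDual x"
  have [simp]: "cdual_apply X = x" using x by (simp add: X_def CDual_inverse)
  show "bounded_clinear (\<lambda>f. cnj (x (dual_star f)))"
  proof (rule bounded_clinearI[where K = "norm X"])
    fix f g :: "'a cdual" and c
    have "dual_star (f + g) = dual_star f + dual_star g"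
      by (rule cdual_eqI) (simp add: dual_star.rep_eq)
    then show "cnj (x (dual_star (f + g))) = cnj (x (dual_star f)) + cnj (x (dual_star g))"
      using cdual_add[of X] by simp
    have "dual_star (c *\<^sub>C f) = cnj c *\<^sub>C dual_star f"
      by (rule cdual_eqI) (simp add: dual_star.rep_eq)
    then show "cnj (x (dual_star (c *\<^sub>C f))) = c * cnj (x (dual_star f))"
      using cdual_scaleC[of X] by simp
    have "cmod (x (dual_star f)) \<le> norm X * norm (dual_star f)"
      using norm_cdual_apply[of X] by simp
    also have "\<dots> \<le> norm X * norm f"
      by (intro mult_left_mono norm_dual_star) auto
    finally show "cmod (cnj (x (dual_star f))) \<le> norm X * norm f" by simp
  qed
qed

lemma bidual_emb_mult: "bidual_emb (a * b) = bidual_emb a \<odot> bidual_emb b"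
  by (rule cdual_eqI)
    (simp add: bidual_emb.rep_eq arens.rep_eq bidual_lmult.rep_eq dual_rmult.rep_eq)

lemma bidual_emb_star: "bidual_emb (star a) = bidual_star (bidual_emb a)"
  by (rule cdual_eqI) (simp add: bidual_emb.rep_eq bidual_star.rep_eq dual_star.rep_eq)

definition bidual_sa :: "'a :: cstar_algebra bidual \<Rightarrow> bool"
  where "bidual_sa x \<longleftrightarrow> bidual_star x = x"

definition bidual_le :: "'a :: cstar_algebra bidual \<Rightarrow> 'a bidual \<Rightarrow> bool"  (infix \<open>\<sqsubseteq>\<close> 50)
  where "x \<sqsubseteq> y \<longleftrightarrow> (\<exists>z. y - x = bidual_star z \<odot> z)"

definition sigma_weak_tendsto ::
    "('i \<Rightarrow> 'a :: complex_normed_vector bidual) \<Rightarrow> 'a bidual \<Rightarrow> 'i filter \<Rightarrow> bool"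
  where "sigma_weak_tendsto u x F \<longleftrightarrow>
    (\<forall>f. ((\<lambda>i. cdual_apply (u i) f) \<longlongrightarrow> cdual_apply x f) F)"

definition state :: "'a :: cstar_algebra cdual \<Rightarrow> bool"
  where "state \<phi> \<longleftrightarrow> (\<forall>a. cdual_apply \<phi> (star a * a) \<in> \<real>\<^sub>\<ge>\<^sub>0) \<and> norm \<phi> = 1"


section \<open>Semicontinuity and universal measurability\<close>

definition directed_index :: "'i set \<Rightarrow> ('i \<times> 'i) set \<Rightarrow> bool"
  where "directed_index I r \<longleftrightarrow>
    I \<noteq> {} \<and> preorder_on I r \<and> (\<forall>i\<in>I. \<forall>j\<in>I. \<exists>k\<in>I. (i, k) \<in> r \<and> (j, k) \<in> r)"

definition tail_filter :: "'i set \<Rightarrow> ('i \<times> 'i) set \<Rightarrow> 'i filter"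
  where "tail_filter I r = (INF i\<in>I. principal {j. (i, j) \<in> r})"

definition bounded_increasing_sa_net ::
    "'i set \<Rightarrow> ('i \<times> 'i) set \<Rightarrow> ('i \<Rightarrow> 'a :: cstar_algebra) \<Rightarrow> bool"
  where "bounded_increasing_sa_net I r u \<longleftrightarrow>
    directed_index I r \<and> (\<forall>i\<in>I. selfadjoint (u i)) \<and> bounded (u ` I) \<and>
    (\<forall>i j. (i, j) \<in> r \<longrightarrow> cstar_le (u i) (u j))"

text \<open>
  \<open>(A\<^sub>s\<^sub>a)\<^sup>m\<close>. An increasing net has the same limit as its range, indexed by itself; so index
  sets within the type of \<open>A\<close> suffice.
\<close>

definition sa_monotone_limits :: "'a :: cstar_algebra bidual set"
  where "sa_monotone_limits = {x. \<exists>(I :: 'a set) r u. bounded_increasing_sa_net I r u \<and>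
    sigma_weak_tendsto (\<lambda>i. bidual_emb (u i)) x (tail_filter I r)}"

definition strongly_lsc :: "'a :: cstar_algebra bidual set"
  where "strongly_lsc = closure sa_monotone_limits"

definition strongly_usc :: "'a :: cstar_algebra bidual set"
  where "strongly_usc = {k. - k \<in> strongly_lsc}"

text \<open>\<open>\<phi> (h - k)\<close> below is real, because \<open>h\<close> and \<open>k\<close> are self-adjoint.\<close>

definition universally_measurable :: "'a :: cstar_algebra bidual set"
  where "universally_measurable = {x. bidual_sa x \<and>
    (\<forall>\<epsilon>>0. \<forall>\<phi>. state \<phi> \<longrightarrow>
      (\<exists>h\<in>strongly_lsc. \<exists>k\<in>strongly_usc. k \<sqsubseteq> x \<and> x \<sqsubseteq> h \<and> Re (cdual_apply (h - k) \<phi>) < \<epsilon>))}"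

definition universally_measurable_C :: "'a :: cstar_algebra bidual set"
  where "universally_measurable_C =
    {x + \<i> *\<^sub>C y | x y. x \<in> universally_measurable \<and> y \<in> universally_measurable}"


section \<open>Monotone sequentially closed C*-subalgebras\<close>

definition cstar_subalgebra :: "'a :: cstar_algebra bidual set \<Rightarrow> bool"
  where "cstar_subalgebra C \<longleftrightarrow>
    0 \<in> C \<and> (\<forall>x\<in>C. \<forall>y\<in>C. x + y \<in> C) \<and> (\<forall>c. \<forall>x\<in>C. c *\<^sub>C x \<in> C) \<and>
    (\<forall>x\<in>C. \<forall>y\<in>C. x \<odot> y \<in> C) \<and> (\<forall>x\<in>C. bidual_star x \<in> C) \<and> closed C"

definition monotone_seq_closed :: "'a :: cstar_algebra bidual set \<Rightarrow> bool"
  where "monotone_seq_closed C \<longleftrightarrow>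
    (\<forall>s x. (\<forall>n. s n \<in> C \<and> bidual_sa (s n)) \<and> bounded (range s) \<and>
      ((\<forall>n. s n \<sqsubseteq> s (Suc n)) \<or> (\<forall>n. s (Suc n) \<sqsubseteq> s n)) \<and>
      sigma_weak_tendsto s x sequentially \<longrightarrow> x \<in> C \<and> bidual_sa x)"

definition borel_envelope :: "'a :: cstar_algebra bidual set"
  where "borel_envelope =
    \<Inter>{C. cstar_subalgebra C \<and> monotone_seq_closed C \<and> strongly_lsc \<subseteq> C}"

lemma borel_envelope_least:
  "cstar_subalgebra C \<Longrightarrow> monotone_seq_closed C \<Longrightarrow> strongly_lsc \<subseteq> C \<Longrightarrow> borel_envelope \<subseteq> C"
  by (auto simp: borel_envelope_def)

lemma bidual_sa_limit:
  assumes "\<And>n. bidual_sa (s n)" and "sigma_weak_tendsto s x sequentially"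
  shows "bidual_sa x"
  unfolding bidual_sa_def
proof (rule cdual_eqI)
  fix f
  have "(\<lambda>n. cnj (cdual_apply (s n) (dual_star f))) \<longlonglongrightarrow> cnj (cdual_apply x (dual_star f))"
    using assms(2) by (intro tendsto_cnj) (simp add: sigma_weak_tendsto_def)
  moreover have "(\<lambda>n. cnj (cdual_apply (s n) (dual_star f))) = (\<lambda>n. cdual_apply (s n) f)"
    using assms(1) by (metis bidual_sa_def bidual_star.rep_eq)
  moreover have "(\<lambda>n. cdual_apply (s n) f) \<longlonglongrightarrow> cdual_apply x f"
    using assms(2) by (simp add: sigma_weak_tendsto_def)
  ultimately have "cnj (cdual_apply x (dual_star f)) = cdual_apply x f"
    by (metis LIMSEQ_unique)
  then show "cdual_apply (bidual_star x) f = cdual_apply x f"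
    by (simp add: bidual_star.rep_eq)
qed

lemma borel_envelope_closed:
  "cstar_subalgebra (borel_envelope :: 'a :: cstar_algebra bidual set)"
  "monotone_seq_closed (borel_envelope :: 'a bidual set)"
  "strongly_lsc \<subseteq> (borel_envelope :: 'a bidual set)"
proof -
  show "cstar_subalgebra (borel_envelope :: 'a bidual set)"
    unfolding cstar_subalgebra_def borel_envelope_def by (auto intro!: closed_Inter)
  show "monotone_seq_closed (borel_envelope :: 'a bidual set)"
    unfolding monotone_seq_closed_def
  proof (intro allI impI conjI)
    fix s :: "nat \<Rightarrow> 'a bidual" and x :: "'a bidual"
    assume *: "(\<forall>n. s n \<in> borel_envelope \<and> bidual_sa (s n)) \<and> bounded (range s) \<and>
      ((\<forall>n. s n \<sqsubseteq> s (Suc n)) \<or> (\<forall>n. s (Suc n) \<sqsubseteq> s n)) \<and> sigma_weak_tendsto s x sequentially"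
    then show "bidual_sa x" by (auto intro: bidual_sa_limit)
    show "x \<in> borel_envelope"
      unfolding borel_envelope_def
    proof (rule InterI)
      fix C :: "'a bidual set"
      assume C: "C \<in> {C. cstar_subalgebra C \<and> monotone_seq_closed C \<and> strongly_lsc \<subseteq> C}"
      then have "borel_envelope \<subseteq> C" by (simp add: borel_envelope_least)
      with * have "\<forall>n. s n \<in> C \<and> bidual_sa (s n)" by blast
      with C * show "x \<in> C" unfolding monotone_seq_closed_def by blast
    qed
  qed
  show "strongly_lsc \<subseteq> (borel_envelope :: 'a bidual set)"
    by (auto simp: borel_envelope_def)
qed

end

theory Submission
  imports Defs
begin

text \<open>
  Call \<open>x \<in> A\<^sup>*\<^sup>*\<close> Lusin if for every positive functional \<open>\<phi>\<close> and \<open>\<epsilon> > 0\<close> there are \<open>a \<in> A\<close> and a limit \<open>h\<close> of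
  an increasing net in \<open>A\<^sub>+\<close> with \<open>(x - a)\<^sup>* (x - a) \<le> h\<close> and \<open>\<phi> h < \<epsilon>\<close>. The Lusin elements form a
  norm closed algebra, by \<open>x y - a b = (x - a) b + x (y - b)\<close>. They contain every strongly lower
  semicontinuous element, because \<open>(h - a)\<^sup>2 \<le> \<parallel>h - a\<parallel> (h - a)\<close> if \<open>a \<le> h\<close>. A self-adjoint Lusin element is
  universally measurable, because \<open>y + y\<^sup>* \<le> t y\<^sup>* y + 1/t\<close>.

  Let \<open>x\<close> be the limit of an increasing sequence of Lusin elements with increments \<open>d\<^sub>k\<close>. Since \<open>\<surd>d\<^sub>k\<close> is
  again Lusin, \<open>d\<^sub>k\<close> is dominated by the limit \<open>h\<^sub>k\<close> of an increasing net in \<open>A\<^sub>+\<close> with \<open>\<phi> h\<^sub>k\<close> at most \<open>4 \<phi> d\<^sub>k\<close> up to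
  a small error. The possibly unbounded sum of the \<open>h\<^sub>k\<close> is cut off by the operator monotone function
  \<open>t \<mapsto> t / (1 + t)\<close>. Hence the Lusin elements with Lusin adjoint form a monotone sequentially closed
  C*-algebra.
\<close>

text \<open>Universal measurability is an order condition and says nothing about products, whereas
  the Lusin condition is quadratic: a bound on (x - a)^* (x - a) survives left multiplication by
  bounded elements and conjugation by elements of A. The price is one-sidedness, so in the end x and
  its adjoint are treated together. Square roots enter because approximating d_k itself only gives
  an upper bound c + g with c self-adjoint, and such bounds cannot be summed and cut off.
  Approximating the root gives the bound 2 b^* b + 2 h, a limit of positive elements whose
  \<phi>-value is controlled by that of d_k. The sums of the h_k are bounded only under the single
  functional \<phi>, not in norm; operator monotonicity is what keeps the net increasing after the
  cut-off. The bidual is given concretely by the Arens product. That its involution reverses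
  products, that it has a unit, and that its order by z^* z is positivity on positive functionals
  all have to be established. The bridges are a norm-sharp Jordan decomposition of functionals and
  approximation in GNS seminorms.\<close>

section \<open>Square roots in Banach algebras\<close>

text \<open>
  The equation reads \<open>(1 - w)\<^sup>2 = 1 - x\<close>, stated without a unit. The iterates are dominated in
  norm, together with their increments, by the scalar iterates for \<open>x = 1\<close>.
\<close>

lemma sqrt_iteration:
  fixes m :: "'b \<Rightarrow> 'b \<Rightarrow> 'b :: {real_normed_vector, complete_space}"
  assumes bil: "bounded_bilinear m" and sub: "\<And>a b. norm (m a b) \<le> norm a * norm b"
    and x: "norm x \<le> 1"
  shows "\<exists>w. 2 *\<^sub>R w = x + m w w \<and> norm w \<le> 1 \<and>
    (\<forall>S. closed S \<longrightarrow> 0 \<in> S \<longrightarrow> (\<forall>v\<in>S. (1/2) *\<^sub>R (x + m v v) \<in> S) \<longrightarrow> w \<in> S)"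
proof -
  interpret m: bounded_bilinear m by (rule bil)
  define w where "w n = ((\<lambda>v. (1/2) *\<^sub>R (x + m v v)) ^^ n) 0" for n
  define t :: "nat \<Rightarrow> real" where "t n = ((\<lambda>v. (1 + v * v) / 2) ^^ n) 0" for n
  have w0: "w 0 = 0" and wS: "w (Suc n) = (1/2) *\<^sub>R (x + m (w n) (w n))" for n
    by (simp_all add: w_def)
  have t0: "t 0 = 0" and tS: "t (Suc n) = (1 + t n * t n) / 2" for n
    by (simp_all add: t_def)
  have t01: "0 \<le> t n \<and> t n \<le> 1" for n
  proof (induction n)
    case (Suc n)
    then have "t n * t n \<le> 1" by (simp add: mult_le_one)
    then show ?case by (simp add: tS)
  qed (simp add: t0)
  have wt: "norm (w n) \<le> t n" for n
  proof (induction n)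
    case (Suc n)
    have "norm (x + m (w n) (w n)) \<le> 1 + norm (w n) * norm (w n)"
      using norm_triangle_ineq[of x "m (w n) (w n)"] x sub[of "w n" "w n"] by linarith
    also have "\<dots> \<le> 1 + t n * t n" using Suc by (simp add: mult_mono')
    finally show ?case by (simp add: wS tS)
  qed (simp add: w0 t0)
  \<comment> \<open>The increment is half of (t n - 1)^2.\<close>
  have tinc: "t n \<le> t (Suc n)" for n
    using zero_le_power2[of "t n - 1"] by (simp add: tS power2_eq_square algebra_simps)
  have inc: "norm (w (Suc n) - w n) \<le> t (Suc n) - t n" for n
  proof (induction n)
    case (Suc n)
    let ?a = "w (Suc n)" and ?b = "w n"
    have "w (Suc (Suc n)) - ?a = (1/2) *\<^sub>R (m ?a ?a - m ?b ?b)"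
      unfolding wS[of "Suc n"] using wS[of n] by (simp flip: scaleR_diff_right)
    also have "m ?a ?a - m ?b ?b = m ?a (?a - ?b) + m (?a - ?b) ?b"
      by (simp add: m.diff_left m.diff_right)
    finally have eq: "w (Suc (Suc n)) - ?a = (1/2) *\<^sub>R (m ?a (?a - ?b) + m (?a - ?b) ?b)" .
    have "norm (m ?a (?a - ?b) + m (?a - ?b) ?b)
        \<le> norm ?a * norm (?a - ?b) + norm (?a - ?b) * norm ?b"
      by (intro norm_triangle_le add_mono sub)
    also have "\<dots> \<le> t (Suc n) * (t (Suc n) - t n) + (t (Suc n) - t n) * t n"
      using Suc wt[of n] wt[of "Suc n"] t01[of n] t01[of "Suc n"] tinc[of n]
      by (intro add_mono mult_mono) auto
    also have "\<dots> = 2 * (t (Suc (Suc n)) - t (Suc n))"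
      using tS[of n] by (simp add: tS[of "Suc n"] algebra_simps)
    finally show ?case by (simp add: eq)
  qed (simp add: w0 t0 wS tS x m.zero_left)
  have wt2: "norm (w (n + k) - w n) \<le> t (n + k) - t n" for n k
  proof (induction k)
    case (Suc k)
    have "norm (w (n + Suc k) - w n) \<le> norm (w (Suc (n + k)) - w (n + k)) + norm (w (n + k) - w n)"
      using norm_triangle_ineq[of "w (Suc (n + k)) - w (n + k)" "w (n + k) - w n"] by simp
    then show ?case using Suc inc[of "n + k"] by simp
  qed simp
  have "convergent t"
    by (rule Bseq_monoseq_convergent[OF BseqI'[of _ 1]])
      (use t01 tinc in \<open>auto intro: incseq_SucI simp: monoseq_iff\<close>)
  then have "Cauchy t" by (simp add: convergent_Cauchy)
  have "Cauchy w"
  proof (rule CauchyI')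
    fix e :: real assume "e > 0"
    then obtain M where M: "\<forall>i\<ge>M. \<forall>j\<ge>M. norm (t i - t j) < e"
      using CauchyD[OF \<open>Cauchy t\<close>] by metis
    have "dist (w i) (w j) < e" if "i \<ge> M" "i < j" for i j
      using M[rule_format, of j i] wt2[of i "j - i"] that by (simp add: dist_norm norm_minus_commute)
    then show "\<exists>M. \<forall>i\<ge>M. \<forall>j>i. dist (w i) (w j) < e" by blast
  qed
  then obtain l where l: "w \<longlonglongrightarrow> l" by (auto simp: Cauchy_convergent_iff convergent_def)
  have "(\<lambda>n. w (Suc n)) \<longlonglongrightarrow> (1/2) *\<^sub>R (x + m l l)"
    unfolding wS by (intro tendsto_intros m.tendsto l)
  from LIMSEQ_unique[OF this LIMSEQ_Suc[OF l]] have "2 *\<^sub>R l = 2 *\<^sub>R (1/2) *\<^sub>R (x + m l l)"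
    by simp
  then have "2 *\<^sub>R l = x + m l l" by simp
  moreover have "norm l \<le> 1"
    by (rule LIMSEQ_le_const2[OF tendsto_norm[OF l]]) (use wt t01 order_trans in blast)
  \<comment> \<open>The solution is a limit of iterates that start at 0. Later \<open>S\<close> is
    the set of self-adjoint elements, the commutant of an element, or \<open>lusin\<close>.\<close>
  moreover have "l \<in> S" if "closed S" "0 \<in> S" "\<forall>v\<in>S. (1/2) *\<^sub>R (x + m v v) \<in> S" for S
  proof -
    have "w n \<in> S" for n by (induction n) (use that in \<open>auto simp: w0 wS\<close>)
    then show ?thesis using closed_sequentially[OF that(1) _ l] by blast
  qed
  ultimately show ?thesis by blast
qed

section \<open>Positive elements of unital C*-algebras\<close>

lemma star_scaleR: "star (r *\<^sub>R x) = r *\<^sub>R star (x :: 'a :: cstar_algebra)"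
  using star_scaleC[of "complex_of_real r" x] by (simp add: scaleC_of_real)

lemma star_zero [simp]: "star (0 :: 'a :: cstar_algebra) = 0"
  using star_add[of "0 :: 'a" 0] by simp

lemma star_minus: "star (- x) = - star (x :: 'a :: cstar_algebra)"
  using star_add[of x "- x"] by (simp add: eq_neg_iff_add_eq_0 add.commute)

lemma star_diff: "star (x - y) = star x - star (y :: 'a :: cstar_algebra)"
  using star_add[of x "- y"] by (simp add: star_minus)

lemmas star_simps = star_star star_add star_diff star_minus star_mult star_scaleR

lemma bounded_linear_star: "bounded_linear (star :: 'a :: cstar_algebra \<Rightarrow> 'a)"
  by (rule bounded_linear_intro[where K = 1]) (auto simp: star_add star_scaleR norm_star)

lemma star_one [simp]: "star (1 :: 'a :: {cstar_algebra, real_normed_algebra_1}) = 1"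
  by (metis mult.right_neutral mult.left_neutral star_mult star_star)

lemma star_of_real [simp]:
  "star (of_real r :: 'a :: {cstar_algebra, real_normed_algebra_1}) = of_real r"
  by (simp add: of_real_def star_scaleR)

lemma norm_sq_selfadjoint: "star x = x \<Longrightarrow> norm (x * x) = (norm x)\<^sup>2" for x :: "'a :: cstar_algebra"
  using norm_star_mult_self[of x] by simp

lemma scaleC_minus_one: "(- 1) *\<^sub>C x = - (x :: 'a :: complex_normed_vector)"
  using scaleC_of_real[of "- 1" x] by simp

lemma scaleC_one [simp]: "1 *\<^sub>C x = (x :: 'a :: complex_normed_vector)"
  using scaleC_of_real[of 1 x] by simp

lemma scaleC_zero_right [simp]: "c *\<^sub>C (0 :: 'a :: complex_normed_vector) = 0"
  using norm_scaleC[of c "0 :: 'a"] by simp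

lemma scaleC_minus_right: "c *\<^sub>C (- x) = - (c *\<^sub>C (x :: 'a :: complex_normed_vector))"
  using scaleC_add_right[of c x "- x"] by (simp add: eq_neg_iff_add_eq_0 add.commute)

lemma scaleC_diff_right: "c *\<^sub>C (x - y) = c *\<^sub>C x - c *\<^sub>C (y :: 'a :: complex_normed_vector)"
  using scaleC_add_right[of c x "- y"] by (simp add: scaleC_minus_right)

lemma scaleC_i_i: "\<i> *\<^sub>C \<i> *\<^sub>C x = - (x :: 'a :: complex_normed_vector)"
  by (simp add: scaleC_scaleC scaleC_minus_one)

lemma scaleC_scaleR: "c *\<^sub>C r *\<^sub>R x = r *\<^sub>R c *\<^sub>C (x :: 'a :: complex_normed_vector)"
  by (simp add: scaleC_scaleC mult.commute flip: scaleC_of_real)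

text \<open>Put a = 1 - w with 2 w = x + w^2. The bound on 1 - a is the norm criterion by which the
  root is itself recognised as positive.\<close>

lemma sqrt_of_one_minus:
  fixes x :: "'a :: {cstar_algebra, real_normed_algebra_1}"
  assumes x: "star x = x" "norm x \<le> 1"
  obtains a where "star a = a" "a * a = 1 - x" "\<And>y. x * y = y * x \<Longrightarrow> a * y = y * a"
    "norm (1 - a) \<le> 1"
proof -
  obtain w where w: "2 *\<^sub>R w = x + w * w" "norm w \<le> 1"
    and S: "\<And>S. closed S \<Longrightarrow> 0 \<in> S \<Longrightarrow> (\<And>v. v \<in> S \<Longrightarrow> (1/2) *\<^sub>R (x + v * v) \<in> S) \<Longrightarrow> w \<in> S"
    using sqrt_iteration[OF bounded_bilinear_mult norm_mult_ineq x(2)] by auto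
  have "w \<in> {v. star v = v}"
    by (rule S) (auto simp: star_simps x intro!: closed_Collect_eq continuous_intros
        bounded_linear.continuous_on[OF bounded_linear_star])
  then have sw: "star w = w" by simp
  have wy: "w * y = y * w" if "x * y = y * x" for y
  proof -
    have "w \<in> {v. v * y = y * v}"
    proof (rule S)
      fix v assume "v \<in> {v. v * y = y * v}"
      then have "v * y = y * v" by simp
      then have "v * v * y = y * (v * v)" by (metis mult.assoc)
      then show "(1/2) *\<^sub>R (x + v * v) \<in> {v. v * y = y * v}"
        using that by (simp add: distrib_left distrib_right)
    qed (auto intro!: closed_Collect_eq continuous_intros)
    then show ?thesis by simp
  qed
  show ?thesis
  proof (rule that)
    show "(1 - w) * (1 - w) = 1 - x" using w(1) by (simp add: algebra_simps scaleR_2)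
    show "(1 - w) * y = y * (1 - w)" if "x * y = y * x" for y
      by (simp add: left_diff_distrib right_diff_distrib wy[OF that])
  qed (use w(2) in \<open>simp_all add: star_diff sw\<close>)
qed

text \<open>Positivity without spectra: the working characterisation is the norm criterion of
  \<open>hpos_norm\<close> and \<open>hposI_norm\<close>, and agreement with the elements c^* c is
  the theorem \<open>hpos_star_mult_self\<close>.\<close>

definition hpos :: "'a :: cstar_algebra \<Rightarrow> bool"
  where "hpos p \<longleftrightarrow> (\<exists>a. star a = a \<and> p = a * a)"

lemma hpos_selfadjoint: "hpos p \<Longrightarrow> star p = p"
  by (auto simp: hpos_def star_mult)

lemma hpos_square: "star a = a \<Longrightarrow> hpos (a * a)"
  by (auto simp: hpos_def)

lemma hpos_zero [simp]: "hpos 0"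
  using hpos_square[of 0] by simp

lemma hpos_one [simp]: "hpos (1 :: 'a :: {cstar_algebra, real_normed_algebra_1})"
  using hpos_square[of "1 :: 'a"] by simp

lemma hpos_scaleR: "0 \<le> r \<Longrightarrow> hpos p \<Longrightarrow> hpos (r *\<^sub>R p)"
proof -
  assume "0 \<le> r" "hpos p"
  then obtain a where "star a = a" "p = a * a" by (auto simp: hpos_def)
  with \<open>0 \<le> r\<close> show ?thesis
    using hpos_square[of "sqrt r *\<^sub>R a"] by (simp add: star_scaleR)
qed

text \<open>Rescaling reduces to \<open>sqrt_of_one_minus\<close> with x = 1 - p/t, whose norm is at
  most 1 by the assumption; t = 0 forces p = 0. The last conclusion repeats the norm criterion for
  the root.\<close>

lemma hpos_sqrt_norm:
  fixes p :: "'a :: {cstar_algebra, real_normed_algebra_1}"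
  assumes "star p = p" "norm (of_real t - p) \<le> t"
  obtains a s where "star a = a" "a * a = p" "\<And>y. p * y = y * p \<Longrightarrow> a * y = y * a"
    "norm (of_real s - a) \<le> s"
proof (cases "t = 0")
  case True
  with assms show ?thesis by (intro that[of 0 0]) auto
next
  case False
  with assms(2) norm_ge_zero[of "of_real t - p"] have t: "t > 0" by linarith
  define x where "x = 1 - (1/t) *\<^sub>R p"
  have "x = (1/t) *\<^sub>R (of_real t - p)" using t by (simp add: x_def algebra_simps of_real_def)
  then have "norm x \<le> 1" using assms(2) t by simp
  moreover have "star x = x" by (simp add: x_def star_simps assms)
  ultimately obtain a where a: "star a = a" "a * a = 1 - x" "\<And>y. x * y = y * x \<Longrightarrow> a * y = y * a"
    "norm (1 - a) \<le> 1"
    using sqrt_of_one_minus by blast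
  define c where "c = sqrt t"
  have c: "c > 0" "c * c = t" using t by (auto simp: c_def)
  have "norm (of_real c - c *\<^sub>R a) = norm (c *\<^sub>R (1 - a))"
    by (simp add: of_real_def scaleR_right_diff_distrib)
  also have "\<dots> \<le> c" using c a(4) by simp
  finally have le: "norm (of_real c - c *\<^sub>R a) \<le> c" .
  show ?thesis
  proof (rule that[OF _ _ _ le])
    show "star (c *\<^sub>R a) = c *\<^sub>R a" by (simp add: star_scaleR a(1))
    have "(c *\<^sub>R a) * (c *\<^sub>R a) = t *\<^sub>R (a * a)" by (simp flip: c(2))
    then show "(c *\<^sub>R a) * (c *\<^sub>R a) = p" using t by (simp add: a(2) x_def)
    show "(c *\<^sub>R a) * y = y * (c *\<^sub>R a)" if "p * y = y * p" for y
    proof -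
      have "x * y = y * x" using that by (simp add: x_def left_diff_distrib right_diff_distrib)
      from a(3)[OF this] show ?thesis by simp
    qed
  qed
qed


text \<open>The element u = a + i b is unitary, and \<open>a\<close> is its real part.\<close>

lemma norm_le_one_of_unitary:
  fixes a b :: "'a :: {cstar_algebra, real_normed_algebra_1}"
  assumes ab: "star a = a" "star b = b" "a * b = b * a" "a * a + b * b = 1"
  shows "norm a \<le> 1"
proof -
  define u where "u = a + \<i> *\<^sub>C b"
  have su: "star u = a - \<i> *\<^sub>C b"
    using star_scaleC[of "\<i>" b] scaleC_scaleC[of "-1" "\<i>" b]
    by (simp add: u_def star_add ab scaleC_minus_one)
  have "star u * u = 1"
    unfolding su by (simp add: u_def algebra_simps scaleC_add_right scaleC_diff_right
        scaleC_mult_left scaleC_mult_right scaleC_i_i ab)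
  then have "(norm u)\<^sup>2 = 1" using norm_star_mult_self[of u] by simp
  then have "norm u = 1" using norm_ge_zero[of u] by (simp add: power2_eq_1_iff)
  moreover have "2 *\<^sub>R a = u + star u" unfolding su by (simp add: u_def scaleR_2)
  then have "2 * norm a \<le> norm u + norm (star u)"
    using norm_triangle_ineq[of u "star u"] by (simp flip: \<open>2 *\<^sub>R a = u + star u\<close>)
  ultimately show ?thesis by (simp add: norm_star)
qed

text \<open>After scaling to norm 1, c + i b with b the root of 1 - c^2 is unitary. Hence b has norm
  at most 1, and so has b^2 = 1 - c^2.\<close>

lemma norm_of_real_diff_square:
  fixes a :: "'a :: {cstar_algebra, real_normed_algebra_1}"
  assumes a: "star a = a"
  shows "norm (of_real ((norm a)\<^sup>2) - a * a) \<le> (norm a)\<^sup>2"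
proof (cases "a = 0")
  case False
  define c where "c = (1 / norm a) *\<^sub>R a"
  have c: "star c = c" "norm c = 1" using False by (auto simp: c_def star_scaleR a)
  then have cc: "star (c * c) = c * c" "norm (c * c) \<le> 1"
    by (auto simp: star_mult norm_sq_selfadjoint)
  obtain b where b: "star b = b" "b * b = 1 - c * c" "\<And>y. c * c * y = y * (c * c) \<Longrightarrow> b * y = y * b"
    using sqrt_of_one_minus[OF cc] by blast
  have "norm b \<le> 1"
    by (rule norm_le_one_of_unitary[where b = c]) (auto simp: b c mult.assoc)
  then have "norm (1 - c * c) \<le> 1"
    using norm_sq_selfadjoint[OF b(1)] by (simp add: b(2) power_le_one)
  have ac: "a = norm a *\<^sub>R c" using False by (simp add: c_def)
  have "a * a = (norm a)\<^sup>2 *\<^sub>R (c * c)"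
    by (subst (1 2) ac) (simp add: power2_eq_square)
  then have "of_real ((norm a)\<^sup>2) - a * a = (norm a)\<^sup>2 *\<^sub>R (1 - c * c)"
    by (simp add: of_real_def scaleR_right_diff_distrib)
  then show ?thesis
    using mult_left_mono[OF \<open>norm (1 - c * c) \<le> 1\<close>, of "(norm a)\<^sup>2"] by simp
qed simp

lemma hpos_norm:
  fixes p :: "'a :: {cstar_algebra, real_normed_algebra_1}"
  assumes "hpos p"
  shows "norm (of_real (norm p) - p) \<le> norm p"
proof -
  obtain a where "star a = a" "p = a * a" using assms by (auto simp: hpos_def)
  then show ?thesis using norm_of_real_diff_square[of a] norm_sq_selfadjoint[of a] by simp
qed

lemma hposI_norm:
  fixes p :: "'a :: {cstar_algebra, real_normed_algebra_1}"
  assumes "star p = p" "norm (of_real t - p) \<le> t"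
  shows "hpos p"
  using hpos_sqrt_norm[OF assms] hpos_square by metis

lemma hpos_sqrt:
  fixes p :: "'a :: {cstar_algebra, real_normed_algebra_1}"
  assumes "hpos p"
  obtains a where "hpos a" "star a = a" "a * a = p" "\<And>y. p * y = y * p \<Longrightarrow> a * y = y * a"
  using hpos_sqrt_norm[OF hpos_selfadjoint[OF assms] hpos_norm[OF assms]] hposI_norm by metis

text \<open>The norm criterion is additive by the triangle inequality, with the constants
  added.\<close>

lemma hpos_add:
  fixes p q :: "'a :: {cstar_algebra, real_normed_algebra_1}"
  assumes "hpos p" "hpos q"
  shows "hpos (p + q)"
proof (rule hposI_norm)
  have "of_real (norm p + norm q) - (p + q) = (of_real (norm p) - p) + (of_real (norm q) - q)"
    by simp
  then show "norm (of_real (norm p + norm q) - (p + q)) \<le> norm p + norm q"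
    using norm_triangle_mono[OF hpos_norm[OF assms(1)] hpos_norm[OF assms(2)]]
    by (simp add: add_diff_add)
qed (simp add: star_add hpos_selfadjoint assms)

lemma hpos_mult:
  fixes p q :: "'a :: {cstar_algebra, real_normed_algebra_1}"
  assumes "hpos p" "hpos q" "p * q = q * p"
  shows "hpos (p * q)"
proof -
  obtain a where a: "star a = a" "a * a = p" "\<And>y. p * y = y * p \<Longrightarrow> a * y = y * a"
    using hpos_sqrt[OF assms(1)] by blast
  obtain b where b: "star b = b" "b * b = q" "\<And>y. q * y = y * q \<Longrightarrow> b * y = y * b"
    using hpos_sqrt[OF assms(2)] by blast
  have "a * q = q * a" using a(3) assms(3) by simp
  then have ba: "b * a = a * b" using b(3) by metis
  then have "star (a * b) = a * b" by (simp add: star_mult a b)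
  moreover have "a * b * (a * b) = a * (b * a) * b" by (simp only: mult.assoc)
  then have "a * b * (a * b) = (a * a) * (b * b)" by (simp only: ba mult.assoc)
  ultimately show ?thesis
    using hpos_square[of "a * b"] by (simp add: a b)
qed

text \<open>The product 1 - y^2 of the two commuting factors is positive; its root b commutes with
  y, and y + i b is unitary.\<close>

lemma norm_le_oneI:
  fixes y :: "'a :: {cstar_algebra, real_normed_algebra_1}"
  assumes "hpos (1 - y)" "hpos (1 + y)"
  shows "norm y \<le> 1"
proof -
  have y: "star y = y" using hpos_selfadjoint[OF assms(2)] by (simp add: star_add)
  have "hpos ((1 - y) * (1 + y))" by (intro hpos_mult assms) (simp add: algebra_simps)
  then have "hpos (1 - y * y)" by (simp add: algebra_simps)
  then obtain b where b: "star b = b" "b * b = 1 - y * y"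
      "\<And>z. (1 - y * y) * z = z * (1 - y * y) \<Longrightarrow> b * z = z * b"
    using hpos_sqrt by blast
  have "b * y = y * b" by (rule b(3)) (simp add: algebra_simps)
  then show ?thesis
    by (intro norm_le_one_of_unitary[where b = b]) (auto simp: b y)
qed

lemma norm_leI:
  fixes y :: "'a :: {cstar_algebra, real_normed_algebra_1}"
  assumes "hpos (of_real s - y)" "hpos (of_real s + y)" "0 \<le> s"
  shows "norm y \<le> s"
proof (rule field_le_epsilon)
  fix e :: real assume "e > 0"
  \<comment> \<open>The margin \<open>e\<close> permits division by \<open>t\<close> when
    \<open>s\<close> is 0.\<close>
  define t where "t = s + e"
  have t: "t > 0" "e > 0" using assms \<open>e > 0\<close> by (auto simp: t_def)
  have e: "hpos (e *\<^sub>R (1 :: 'a))" using t by (intro hpos_scaleR) auto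
  have "hpos ((1/t) *\<^sub>R ((of_real s - y) + e *\<^sub>R 1))" "hpos ((1/t) *\<^sub>R ((of_real s + y) + e *\<^sub>R 1))"
    using t by (intro hpos_scaleR hpos_add assms e; simp)+
  moreover have "(1/t) *\<^sub>R ((of_real s - y) + e *\<^sub>R 1) = 1 - (1/t) *\<^sub>R y"
    "(1/t) *\<^sub>R ((of_real s + y) + e *\<^sub>R 1) = 1 + (1/t) *\<^sub>R y"
    using t by (auto simp: t_def of_real_def algebra_simps simp flip: scaleR_add_left)
  ultimately have "norm ((1/t) *\<^sub>R y) \<le> 1" using norm_le_oneI by metis
  then show "norm y \<le> s + e" using t by (simp add: field_simps t_def)
qed

lemma hpos_norm_minus:
  fixes y :: "'a :: {cstar_algebra, real_normed_algebra_1}"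
  assumes "star y = y" "norm y \<le> s"
  shows "hpos (of_real s - y)"
  by (rule hposI_norm[where t = s]) (use assms in \<open>auto simp: star_simps\<close>)

lemma hpos_norm_mono:
  fixes p q :: "'a :: {cstar_algebra, real_normed_algebra_1}"
  assumes "hpos p" "hpos (q - p)"
  shows "norm p \<le> norm q"
proof (rule norm_leI)
  have "hpos q" using hpos_add[OF assms] by simp
  then have "hpos (of_real (norm q) - q)" by (intro hpos_norm_minus hpos_selfadjoint) auto
  from hpos_add[OF this assms(2)] show "hpos (of_real (norm q) - p)" by simp
  have "hpos (of_real (norm q) :: 'a)" using hpos_scaleR[OF norm_ge_zero hpos_one] by (simp add: of_real_def)
  then show "hpos (of_real (norm q) + p)" by (intro hpos_add assms)
qed simp

text \<open>
  With \<open>r = d d\<^sup>*\<close> and \<open>s = - d\<^sup>* d\<close> both positive and \<open>\<parallel>d\<parallel> = 1\<close>, one has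
  \<open>r (1 + r)\<^sup>n = d (1 - s)\<^sup>n d\<^sup>*\<close>; the right-hand side has norm at most 1, whereas the
  left-hand side dominates \<open>n r\<^sup>2\<close>.
\<close>

lemma star_mult_self_not_negative:
  fixes d :: "'a :: {cstar_algebra, real_normed_algebra_1}"
  assumes neg: "hpos (- (star d * d))"
  shows "d = 0"
proof (rule ccontr)
  assume "d \<noteq> 0"
  define c where "c = (1 / norm d) *\<^sub>R d"
  have nc: "norm c = 1" using \<open>d \<noteq> 0\<close> by (simp add: c_def)
  define s where "s = - (star c * c)"
  have "s = (1 / norm d)\<^sup>2 *\<^sub>R (- (star d * d))"
    by (simp add: s_def c_def star_scaleR power2_eq_square)
  then have s: "hpos s" using neg by (simp only: hpos_scaleR zero_le_power2)
  define r where "r = c * star c"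
  \<comment> \<open>The real and imaginary parts of \<open>c\<close>; the identity c c^* + c^* c = 2
    a^2 + 2 b^2 exhibits \<open>r\<close> as a sum of positive elements.\<close>
  define a b where "a = (1/2) *\<^sub>R (c + star c)" and "b = (1/2) *\<^sub>R \<i> *\<^sub>C (star c - c)"
  have sb: "star b = b"
    using star_scaleC[of "\<i>" "star c - c"] scaleC_scaleC[of "-1" "\<i>" "c - star c"]
    by (simp add: b_def star_simps scaleC_minus_one flip: scaleC_minus_right)
  have sa: "star a = a" by (simp add: a_def star_simps add.commute)
  have ns: "norm s = 1" using norm_star_mult_self[of c] nc by (simp add: s_def)
  have r': "r = 2 *\<^sub>R (a * a) + 2 *\<^sub>R (b * b) + s"
  proof -
    have "4 *\<^sub>R (a * a) = (c + star c) * (c + star c)" by (simp add: a_def)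
    moreover have "4 *\<^sub>R (b * b) = - ((star c - c) * (star c - c))"
      by (simp add: b_def scaleC_mult_left scaleC_mult_right scaleC_scaleR scaleC_i_i)
    ultimately have "4 *\<^sub>R (a * a) + 4 *\<^sub>R (b * b) = 2 *\<^sub>R (r - s)"
      by (simp add: r_def s_def algebra_simps scaleR_2)
    then have "2 *\<^sub>R (2 *\<^sub>R (a * a) + 2 *\<^sub>R (b * b)) = 2 *\<^sub>R (r - s)"
      by (simp add: scaleR_add_right)
    then have "2 *\<^sub>R (a * a) + 2 *\<^sub>R (b * b) = r - s"
      unfolding scaleR_cancel_left by simp
    then show ?thesis by (simp add: algebra_simps)
  qed
  have r: "hpos r"
    unfolding r' by (intro hpos_add hpos_scaleR hpos_square s sa sb) auto
  have nr: "norm r = 1"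
    using norm_star_mult_self[of "star c"] nc by (simp add: r_def star_star norm_star)
  have comm: "r ^ k * r = r * r ^ k" for k by (rule power_commutes)
  \<comment> \<open>Moving c^* past 1 + r turns that factor into 1 - s, whose powers stay in the
    unit ball because s is positive of norm 1.\<close>
  have eq: "r * (1 + r) ^ n = c * (1 - s) ^ n * star c" for n
  proof (induction n)
    case (Suc n)
    have "r * (1 + r) ^ Suc n = (r * (1 + r) ^ n) * (1 + r)" by (simp add: power_Suc2 mult.assoc del: power_Suc)
    also have "\<dots> = c * (1 - s) ^ n * (star c * (1 + r))" by (simp add: Suc mult.assoc)
    also have "star c * (1 + r) = (1 - s) * star c" by (simp add: r_def s_def algebra_simps)
    finally show ?case by (simp add: power_Suc2 mult.assoc del: power_Suc)
  qed (simp add: r_def)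
  have "norm ((1 - s) ^ n) \<le> 1" for n
    using hpos_norm[OF s] norm_power_ineq[of "1 - s" n] power_le_one[of "norm (1 - s)" n] ns by simp
  then have ub: "norm (r * (1 + r) ^ n) \<le> 1" for n
  proof -
    have "norm (c * (1 - s) ^ n * star c) \<le> norm c * norm ((1 - s) ^ n) * norm (star c)"
      by (intro order_trans[OF norm_mult_ineq] mult_right_mono norm_mult_ineq) auto
    then show ?thesis using \<open>norm ((1 - s) ^ n) \<le> 1\<close> by (simp add: eq nc norm_star)
  qed
  have rr: "hpos (r * r)" by (intro hpos_square hpos_selfadjoint r)
  have c1: "r * (1 + r) ^ n = (1 + r) ^ n * r" for n
    by (rule power_commuting_commutes[symmetric]) (simp add: algebra_simps)
  \<comment> \<open>A Bernoulli-type bound: each step multiplies by 1 + r, and the commuting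
    products that appear are positive.\<close>
  have low: "hpos (r * (1 + r) ^ n - r - real n *\<^sub>R (r * r))" for n
  proof (induction n)
    case (Suc n)
    define N where "N = (1 + r) ^ n"
    let ?q = "r * N - r - real n *\<^sub>R (r * r)"
    have q: "hpos ?q" using Suc by (simp add: N_def)
    have N: "r * N = N * r" using c1[of n] by (simp add: N_def)
    have "r * (1 + r) ^ Suc n = r * N + r * N * r"
      by (simp only: N_def power_Suc2 distrib_left mult.assoc mult.right_neutral)
    moreover have "(r * N + r * N * r) - r - real (Suc n) *\<^sub>R (r * r)
        = ?q + ?q * r + real n *\<^sub>R (r * r * r)"
      by (simp add: left_diff_distrib scaleR_add_left)
    moreover have "hpos (?q * r)"
    proof (rule hpos_mult[OF q r])
      have "r * N * r = r * (r * N)" using N by (metis mult.assoc)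
      then show "?q * r = r * ?q" by (simp add: left_diff_distrib right_diff_distrib mult.assoc)
    qed
    moreover have "hpos (r * r * r)" by (rule hpos_mult[OF rr r]) (simp add: mult.assoc)
    ultimately show ?case using q by (simp only: hpos_add hpos_scaleR of_nat_0_le_iff)
  qed simp
  have "real n * 1 \<le> 1" for n
  proof -
    have "hpos (real n *\<^sub>R (r * r))" by (intro hpos_scaleR rr) simp
    moreover have "hpos (r * (1 + r) ^ n - real n *\<^sub>R (r * r))"
      using hpos_add[OF low[of n] r] by simp
    ultimately have "norm (real n *\<^sub>R (r * r)) \<le> norm (r * (1 + r) ^ n)" by (rule hpos_norm_mono)
    also have "norm (real n *\<^sub>R (r * r)) = real n * 1"
      by (simp only: norm_scaleR norm_sq_selfadjoint[OF hpos_selfadjoint[OF r]] nr) simp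
    finally show ?thesis using ub[of n] by (rule order_trans)
  qed
  from this[of 2] show False by simp
qed

text \<open>With \<open>y = c\<^sup>* c\<close> and \<open>n = \<bar>y\<bar> - y\<close>, the element \<open>(c n)\<^sup>* (c n) = n y n = - n \<bar>y\<bar> n\<close> is negative.\<close>

theorem hpos_star_mult_self:
  fixes c :: "'a :: {cstar_algebra, real_normed_algebra_1}"
  shows "hpos (star c * c)"
proof -
  define y where "y = star c * c"
  have sy: "star y = y" by (simp add: y_def star_simps)
  \<comment> \<open>\<open>m\<close> is the absolute value of \<open>y\<close>; its root
    \<open>q\<close> serves to write n m n as the square of n q.\<close>
  obtain m where m: "hpos m" "star m = m" "m * m = y * y" and my: "m * y = y * m"
    using hpos_sqrt[OF hpos_square[OF sy]] by (metis mult.assoc)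
  obtain q where q: "star q = q" "q * q = m" and qy: "q * y = y * q"
    using hpos_sqrt[OF m(1)] my by metis
  define n where "n = m - y"
  have sn: "star n = n" by (simp add: n_def star_simps m sy)
  have qm: "q * m = m * q" by (simp add: mult.assoc flip: q(2))
  have qn: "q * n = n * q" by (simp add: n_def algebra_simps qy qm)
  have yn: "y * n = - (m * n)" by (simp add: n_def algebra_simps m my)
  have "- (star (c * n) * (c * n)) = - (n * (y * n))" by (simp add: star_mult sn y_def mult.assoc)
  also have "\<dots> = n * (m * n)" by (simp add: yn)
  also have "\<dots> = n * (q * (q * n))" by (simp add: mult.assoc flip: q(2))
  also have "\<dots> = (n * q) * (n * q)" by (simp only: qn mult.assoc)
  finally have eq: "- (star (c * n) * (c * n)) = (n * q) * (n * q)" .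
  have "star (n * q) = n * q" by (simp add: star_mult sn q qn)
  then have "hpos (- (star (c * n) * (c * n)))" unfolding eq by (rule hpos_square)
  then have cn: "c * n = 0" by (rule star_mult_self_not_negative)
  then have "y * n = 0" by (simp add: y_def mult.assoc)
  then have mn: "m * n = 0" using yn by simp
  \<comment> \<open>Both terms vanish, so \<open>y\<close> coincides with its absolute
    value.\<close>
  have "n * n = m * n - y * n" by (simp add: n_def algebra_simps)
  then have "n * n = 0" using mn \<open>y * n = 0\<close> by simp
  then have "n = 0" using norm_sq_selfadjoint[OF sn] by simp
  then show ?thesis using m(1) by (simp add: n_def y_def)
qed

instance cstar_algebra \<subseteq> banach ..

section \<open>Resolvents of positive elements\<close>

lemma hpos_conj:
  fixes p c :: "'a :: {cstar_algebra, real_normed_algebra_1}"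
  assumes "hpos p"
  shows "hpos (star c * p * c)"
proof -
  obtain a where "star a = a" "p = a * a" using assms by (auto simp: hpos_def)
  then have "star c * p * c = star (a * c) * (a * c)" by (simp add: star_mult mult.assoc)
  then show ?thesis by (simp add: hpos_star_mult_self)
qed

lemma hpos_conj_selfadjoint:
  fixes p c :: "'a :: {cstar_algebra, real_normed_algebra_1}"
  assumes "hpos p" "star c = c"
  shows "hpos (c * p * c)"
  using hpos_conj[OF assms(1), of c] assms(2) by simp

lemma neumann_inverse:
  fixes x :: "'a :: {real_normed_algebra_1, banach}"
  assumes "norm x < 1"
  obtains s where "s * (1 - x) = 1" "(1 - x) * s = 1"
proof -
  have sm: "summable (\<lambda>n. x ^ n)" by (rule complete_algebra_summable_geometric[OF assms])
  define s where "s = (\<Sum>n. x ^ n)"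
  have "s = (\<Sum>n. x ^ Suc n) + 1"
    using suminf_split_head[OF sm] by (simp add: s_def)
  moreover have "(\<Sum>n. x ^ Suc n) = x * s"
    using suminf_mult[OF sm, of x] by (simp add: s_def)
  moreover have "(\<Sum>n. x ^ Suc n) = s * x"
    using suminf_mult2[OF sm, of x] by (simp add: s_def power_Suc2 del: power_Suc)
  ultimately have "s = x * s + 1" "s = s * x + 1" by metis+
  then show ?thesis
    by (intro that[of s]) (simp_all add: left_diff_distrib right_diff_distrib diff_eq_eq add.commute)
qed

definition resolvent :: "'a :: {cstar_algebra, real_normed_algebra_1} \<Rightarrow> 'a"
  where "resolvent b = (SOME s. s * (1 + b) = 1 \<and> (1 + b) * s = 1)"

context
  fixes b :: "'a :: {cstar_algebra, real_normed_algebra_1}"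
  assumes b: "hpos b"
begin

text \<open>Write 1 + b = t (1 - x) with t = 1 + norm b and x = (norm b - b) / t. The norm criterion
  gives norm x < 1, so the Neumann series applies.\<close>

lemma resolvent_mult: "resolvent b * (1 + b) = 1" "(1 + b) * resolvent b = 1"
proof -
  define t where "t = 1 + norm b"
  have t: "t > 0" by (simp add: t_def add_pos_nonneg)
  define x where "x = (1/t) *\<^sub>R (of_real (norm b) - b)"
  have "norm x = norm (of_real (norm b) - b) / t" using t by (simp add: x_def)
  also have "\<dots> \<le> norm b / t" using hpos_norm[OF b] t by (simp add: divide_right_mono)
  also have "\<dots> < 1" using t by (simp add: t_def)
  finally obtain s where s: "s * (1 - x) = 1" "(1 - x) * s = 1" using neumann_inverse by blast
  have "t *\<^sub>R x = of_real (norm b) - b" using t by (simp add: x_def)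
  then have e: "1 + b = t *\<^sub>R (1 - x)"
    by (simp add: t_def scaleR_right_diff_distrib scaleR_add_left of_real_def)
  have "((1/t) *\<^sub>R s) * (1 + b) = 1 \<and> (1 + b) * ((1/t) *\<^sub>R s) = 1"
    unfolding e using t s by simp
  then have "resolvent b * (1 + b) = 1 \<and> (1 + b) * resolvent b = 1"
    unfolding resolvent_def by (rule someI)
  then show "resolvent b * (1 + b) = 1" "(1 + b) * resolvent b = 1" by auto
qed

lemma resolvent_plus: "resolvent b + resolvent b * b = 1" "resolvent b + b * resolvent b = 1"
  using resolvent_mult by (simp_all add: distrib_left distrib_right)

lemma star_resolvent: "star (resolvent b) = resolvent b"
proof -
  have "(1 + b) * star (resolvent b) = 1"
    using arg_cong[OF resolvent_mult(1), of star] by (simp add: star_simps hpos_selfadjoint[OF b])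
  then have "resolvent b * ((1 + b) * star (resolvent b)) = resolvent b" by simp
  then show ?thesis by (simp add: resolvent_mult flip: mult.assoc)
qed

lemma resolvent_commute: "resolvent b * b = b * resolvent b"
  using resolvent_plus by (metis add_left_cancel)

text \<open>Both summands on the left are positive, so the resolvent is positive and dominates its
  square.\<close>

lemma resolvent_square: "resolvent b * resolvent b + resolvent b * b * resolvent b = resolvent b"
proof -
  have "(resolvent b + resolvent b * b) * resolvent b = resolvent b" by (simp add: resolvent_plus)
  then show ?thesis by (simp add: distrib_right)
qed

lemma hpos_resolvent: "hpos (resolvent b)"
proof -
  have "hpos (resolvent b * resolvent b + resolvent b * b * resolvent b)"
    by (intro hpos_add hpos_square hpos_conj_selfadjoint b star_resolvent)
  then show ?thesis by (simp add: resolvent_square)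
qed

lemma hpos_resolvent_diff_square: "hpos (resolvent b - resolvent b * resolvent b)"
proof -
  have "hpos (resolvent b * b * resolvent b)" by (intro hpos_conj_selfadjoint b star_resolvent)
  moreover have "resolvent b - resolvent b * resolvent b = resolvent b * b * resolvent b"
    using resolvent_square by (metis add_diff_cancel_left')
  ultimately show ?thesis by simp
qed

lemma hpos_one_minus_resolvent: "hpos (1 - resolvent b)"
proof -
  have "1 - resolvent b = b * resolvent b" using resolvent_plus(2) by (metis add_diff_cancel_left')
  moreover have "hpos (b * resolvent b)"
    by (intro hpos_mult b hpos_resolvent resolvent_commute[symmetric])
  ultimately show ?thesis by simp
qed

text \<open>With r the resolvent, the difference is b r b. This becomes cutoff b <= b.\<close>

lemma hpos_minus_one_minus_resolvent: "hpos (b - (1 - resolvent b))"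
proof -
  have e: "1 - resolvent b = b * resolvent b" using resolvent_plus(2) by (metis add_diff_cancel_left')
  have "b - b * resolvent b = b * (1 - resolvent b)" by (simp add: right_diff_distrib)
  moreover have "b * (1 - resolvent b) = b * resolvent b * b"
    by (simp add: e mult.assoc resolvent_commute)
  moreover have "hpos (b * resolvent b * b)"
    by (intro hpos_conj_selfadjoint hpos_resolvent hpos_selfadjoint b)
  ultimately show ?thesis by (simp add: e)
qed

end

text \<open>Inserting the resolvent identity into itself writes r - s as s e s + (e s)^* r (e s),
  where e = c - b.\<close>

lemma resolvent_antimono:
  fixes b c :: "'a :: {cstar_algebra, real_normed_algebra_1}"
  assumes b: "hpos b" and d: "hpos (c - b)"
  shows "hpos (resolvent b - resolvent c)"
proof -
  have c: "hpos c" using hpos_add[OF b d] by simp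
  define r s e where "r = resolvent b" and "s = resolvent c" and "e = c - b"
  have c_eq: "1 + c = (1 + b) + e" by (simp add: e_def)
  have "r = r * (1 + c) * s" by (simp add: r_def s_def mult.assoc resolvent_mult c)
  also have "\<dots> = (r * (1 + b)) * s + r * e * s" by (simp only: c_eq distrib_left distrib_right)
  finally have 1: "r = s + r * e * s" by (simp add: r_def resolvent_mult[OF b])
  have "r = s * (1 + c) * r" by (simp add: r_def s_def resolvent_mult c)
  also have "\<dots> = s * ((1 + b) * r) + s * e * r"
    by (simp only: c_eq distrib_left distrib_right mult.assoc)
  finally have 2: "r = s + s * e * r" by (simp add: r_def resolvent_mult[OF b])
  have "r - s = s * e * r" by (subst 2) simp
  also have "\<dots> = s * e * (s + r * e * s)" by (subst 1) simp
  also have "\<dots> = s * e * s + star (e * s) * r * (e * s)"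
    by (simp add: distrib_left mult.assoc star_mult s_def star_resolvent[OF c] hpos_selfadjoint[OF d, folded e_def])
  finally have eq: "r - s = s * e * s + star (e * s) * r * (e * s)" .
  have "hpos (s * e * s)"
    unfolding s_def e_def by (intro hpos_conj_selfadjoint d star_resolvent c)
  moreover have "hpos (star (e * s) * r * (e * s))"
    unfolding r_def by (intro hpos_conj hpos_resolvent b)
  ultimately show ?thesis using eq by (simp add: r_def s_def hpos_add)
qed

text \<open>\<open>T = a (1 + n a\<^sup>* a)\<^sup>-\<^sup>1 a\<^sup>*\<close> satisfies \<open>n T\<^sup>2 \<le> T\<close>.\<close>

lemma norm_mult_resolvent:
  fixes a b :: "'a :: {cstar_algebra, real_normed_algebra_1}"
  assumes n: "n > 0" and d: "hpos (b - n *\<^sub>R (star a * a))"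
  shows "(norm (a * resolvent b))\<^sup>2 \<le> 1 / n"
proof -
  define c where "c = n *\<^sub>R (star a * a)"
  have c: "hpos c" unfolding c_def using n by (intro hpos_scaleR hpos_star_mult_self) auto
  have b: "hpos b" using hpos_add[OF c d[folded c_def]] by simp
  define T where "T = a * resolvent c * star a"
  have "(norm (a * resolvent b))\<^sup>2 = norm (a * (resolvent b * resolvent b) * star a)"
    using norm_star_mult_self[of "star (a * resolvent b)"] norm_star[of "a * resolvent b"]
    by (simp add: star_simps norm_star star_resolvent[OF b] mult.assoc)
  \<comment> \<open>The resolvent dominates its square; afterwards antimonotonicity replaces b by c
    = n a^* a.\<close>
  also have "\<dots> \<le> norm (a * resolvent b * star a)"
  proof (rule hpos_norm_mono)
    have "hpos (star (star a) * (resolvent b * resolvent b) * star a)"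
      by (intro hpos_conj hpos_square star_resolvent b)
    then show "hpos (a * (resolvent b * resolvent b) * star a)" by (simp add: star_star)
    have "hpos (star (star a) * (resolvent b - resolvent b * resolvent b) * star a)"
      by (intro hpos_conj hpos_resolvent_diff_square b)
    then show "hpos (a * resolvent b * star a - a * (resolvent b * resolvent b) * star a)"
      by (simp add: star_star left_diff_distrib right_diff_distrib)
  qed
  also have "\<dots> \<le> norm T"
    unfolding T_def
  proof (rule hpos_norm_mono)
    have "hpos (star (star a) * resolvent b * star a)" by (intro hpos_conj hpos_resolvent b)
    then show "hpos (a * resolvent b * star a)" by (simp add: star_star)
    have "hpos (star (star a) * (resolvent c - resolvent b) * star a)"
      by (intro hpos_conj resolvent_antimono c) (simp add: c_def d)
    then show "hpos (a * resolvent c * star a - a * resolvent b * star a)"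
      by (simp add: star_star left_diff_distrib right_diff_distrib)
  qed
  also have "norm T \<le> 1 / n"
  proof -
    have sT: "star T = T" by (simp add: T_def star_simps star_resolvent[OF c] mult.assoc)
    have "n *\<^sub>R (T * T) = a * (resolvent c * c * resolvent c) * star a"
      by (simp add: T_def c_def mult.assoc)
    then have "T - n *\<^sub>R (T * T) = a * (resolvent c - resolvent c * c * resolvent c) * star a"
      by (simp add: T_def left_diff_distrib right_diff_distrib)
    also have "resolvent c - resolvent c * c * resolvent c = resolvent c * resolvent c"
      using resolvent_square[OF c] by (metis add_diff_cancel_right')
    finally have "T - n *\<^sub>R (T * T) = star (star a) * (resolvent c * resolvent c) * star a"
      by (simp add: star_star)
    then have "hpos (T - n *\<^sub>R (T * T))"
      by (simp only: hpos_conj hpos_square star_resolvent[OF c])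
    moreover have "hpos (n *\<^sub>R (T * T))" using n by (intro hpos_scaleR hpos_square sT) auto
    ultimately have "norm (n *\<^sub>R (T * T)) \<le> norm T" by (intro hpos_norm_mono)
    \<comment> \<open>The C*-identity turns n T^2 <= T into an inequality between norms.\<close>
    then have "n * norm T * norm T \<le> 1 * norm T"
      using n by (simp add: norm_sq_selfadjoint[OF sT] power2_eq_square mult.assoc)
    then show ?thesis using n
      by (cases "norm T = 0") (simp_all add: field_simps)
  qed
  finally show ?thesis .
qed

section \<open>The unitization\<close>

datatype 'a unitization = Unitization (alg_part: 'a) (scalar_part: complex)

lemmas unitization_eqI = unitization.expand[OF conjI]

definition lmult :: "'a :: cstar_algebra unitization \<Rightarrow> 'a \<Rightarrow> 'a"
  where "lmult x b = alg_part x * b + scalar_part x *\<^sub>C b"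

lemma bounded_linear_scaleC: "bounded_linear (\<lambda>x. c *\<^sub>C (x :: 'a :: complex_normed_vector))"
  by (rule bounded_linear_intro[where K = "cmod c"])
    (auto simp: scaleC_add_right scaleC_scaleR norm_scaleC mult.commute)

lemma bounded_linear_lmult: "bounded_linear (lmult x)"
  unfolding lmult_def
  by (intro bounded_linear_add bounded_linear_mult_right bounded_linear_scaleC)

lemma scaleC_zero_left [simp]: "0 *\<^sub>C x = (0 :: 'a :: complex_normed_vector)"
  using norm_scaleC[of 0 x] by simp

lemma scaleC_minus_left: "(- c) *\<^sub>C x = - (c *\<^sub>C (x :: 'a :: complex_normed_vector))"
  using scaleC_add_left[of c "- c" x] by (simp add: eq_neg_iff_add_eq_0 add.commute)

lemma scaleC_diff_left: "(c - d) *\<^sub>C x = c *\<^sub>C x - d *\<^sub>C (x :: 'a :: complex_normed_vector)"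
  using scaleC_add_left[of c "- d" x] by (simp add: scaleC_minus_left)

lemmas scaleC_simps = scaleC_add_left scaleC_add_right scaleC_diff_left scaleC_diff_right
  scaleC_minus_left scaleC_minus_right scaleC_mult_left scaleC_mult_right scaleC_scaleC scaleC_scaleR

instantiation unitization :: (cstar_algebra) real_normed_vector
begin

definition zero_unitization :: "'a unitization"
  where "zero_unitization = Unitization 0 0"

definition plus_unitization :: "'a unitization \<Rightarrow> 'a unitization \<Rightarrow> 'a unitization"
  where "plus_unitization x y = Unitization (alg_part x + alg_part y) (scalar_part x + scalar_part y)"

definition minus_unitization :: "'a unitization \<Rightarrow> 'a unitization \<Rightarrow> 'a unitization"
  where "minus_unitization x y = Unitization (alg_part x - alg_part y) (scalar_part x - scalar_part y)"

definition uminus_unitization :: "'a unitization \<Rightarrow> 'a unitization"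
  where "uminus_unitization x = Unitization (- alg_part x) (- scalar_part x)"

definition scaleR_unitization :: "real \<Rightarrow> 'a unitization \<Rightarrow> 'a unitization"
  where "scaleR_unitization r x = Unitization (r *\<^sub>R alg_part x) (r *\<^sub>R scalar_part x)"

text \<open>If A already has a unit, the operator norm of left multiplication on A is only a
  seminorm on the unitization. The scalar part is a character, and the maximum with its modulus is
  definite and keeps the C*-identity.\<close>

definition norm_unitization :: "'a unitization \<Rightarrow> real"
  where "norm_unitization x = max (cmod (scalar_part x)) (onorm (lmult x))"

definition sgn_unitization :: "'a unitization \<Rightarrow> 'a unitization"
  where "sgn_unitization x = scaleR (inverse (norm x)) x"

definition dist_unitization :: "'a unitization \<Rightarrow> 'a unitization \<Rightarrow> real"
  where "dist_unitization x y = norm (x - y)"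

definition uniformity_unitization :: "('a unitization \<times> 'a unitization) filter"
  where "uniformity_unitization = (INF e\<in>{0 <..}. principal {(x, y). dist x y < e})"

definition open_unitization :: "'a unitization set \<Rightarrow> bool"
  where "open_unitization S = (\<forall>x\<in>S. \<forall>\<^sub>F (x', y) in uniformity. x' = x \<longrightarrow> y \<in> S)"

lemma unitization_sel [simp]:
  "alg_part (0 :: 'a unitization) = 0" "scalar_part (0 :: 'a unitization) = 0"
  "alg_part (x + y) = alg_part x + alg_part y" "scalar_part (x + y) = scalar_part x + scalar_part y"
  "alg_part (x - y) = alg_part x - alg_part y" "scalar_part (x - y) = scalar_part x - scalar_part y"
  "alg_part (- x) = - alg_part x" "scalar_part (- x) = - scalar_part x"
  "alg_part (r *\<^sub>R x) = r *\<^sub>R alg_part x" "scalar_part (r *\<^sub>R x) = r *\<^sub>R scalar_part x"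
  for x y :: "'a unitization"
  by (simp_all add: zero_unitization_def plus_unitization_def minus_unitization_def
      uminus_unitization_def scaleR_unitization_def)

text \<open>Test the operator on the adjoint of \<open>alg_part x\<close> and use the C*-identity.
  This gives definiteness of the norm and boundedness of \<open>alg_part\<close>.\<close>

lemma norm_le_onorm_lmult: "norm (alg_part x) \<le> onorm (lmult x) + cmod (scalar_part x)" for x :: "'a unitization"
proof (cases "alg_part x = 0")
  case True
  then show ?thesis by (simp add: onorm_pos_le bounded_linear_lmult)
next
  case False
  let ?b = "star (alg_part x)"
  have "norm (alg_part x * ?b) = norm (alg_part x) * norm ?b"
    using norm_star_mult_self[of ?b] by (simp add: star_star norm_star power2_eq_square)
  moreover have "alg_part x * ?b = lmult x ?b - scalar_part x *\<^sub>C ?b" by (simp add: lmult_def)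
  moreover have "norm (lmult x ?b - scalar_part x *\<^sub>C ?b)
      \<le> onorm (lmult x) * norm ?b + cmod (scalar_part x) * norm ?b"
    by (intro norm_triangle_le_diff add_mono onorm bounded_linear_lmult) (simp add: norm_scaleC)
  ultimately have "norm (alg_part x) * norm ?b \<le> (onorm (lmult x) + cmod (scalar_part x)) * norm ?b"
    by (simp add: distrib_right)
  then show ?thesis using False by (simp add: norm_star)
qed

instance
proof
  fix x y z :: "'a unitization" and r s :: real
  show "x + y + z = x + (y + z)" "0 + x = x" "x + y = y + x" "- x + x = 0" "x - y = x + - y"
    "r *\<^sub>R (x + y) = r *\<^sub>R x + r *\<^sub>R y" "(r + s) *\<^sub>R x = r *\<^sub>R x + s *\<^sub>R x"
    "r *\<^sub>R s *\<^sub>R x = (r * s) *\<^sub>R x" "1 *\<^sub>R x = x"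
    by (auto intro!: unitization_eqI simp: algebra_simps)
  show "dist x y = norm (x - y)" "sgn x = inverse (norm x) *\<^sub>R x"
    by (simp_all add: dist_unitization_def sgn_unitization_def)
  show "uniformity = (INF e\<in>{0 <..}. principal {(x :: 'a unitization, y). dist x y < e})"
    by (rule uniformity_unitization_def)
  show "open U = (\<forall>x\<in>U. \<forall>\<^sub>F (x', y) in uniformity. x' = x \<longrightarrow> y \<in> U)" for U :: "'a unitization set"
    by (rule open_unitization_def)
  have "lmult (0 :: 'a unitization) = (\<lambda>_. 0)" by (rule ext) (simp add: lmult_def)
  moreover have "x = 0" if "norm x = 0"
  proof -
    have "cmod (scalar_part x) = 0 \<and> onorm (lmult x) = 0"
      using that onorm_pos_le[OF bounded_linear_lmult[of x]]
      by (simp add: norm_unitization_def max_def split: if_splits)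
    moreover from this have "alg_part x = 0" using norm_le_onorm_lmult[of x] by simp
    ultimately show ?thesis by (intro unitization_eqI) auto
  qed
  ultimately show "(norm x = 0) = (x = 0)" by (auto simp: norm_unitization_def onorm_zero)
  have "lmult (x + y) = (\<lambda>b. lmult x b + lmult y b)"
    by (rule ext) (simp add: lmult_def scaleC_simps algebra_simps)
  then have "onorm (lmult (x + y)) \<le> onorm (lmult x) + onorm (lmult y)"
    by (simp add: onorm_triangle bounded_linear_lmult)
  then show "norm (x + y) \<le> norm x + norm y"
    using norm_triangle_ineq[of "scalar_part x" "scalar_part y"] by (auto simp: norm_unitization_def)
  have "lmult (r *\<^sub>R x) = (\<lambda>b. r *\<^sub>R lmult x b)"
    by (rule ext) (simp add: lmult_def scaleC_simps scaleR_add_right scaleR_conv_of_real flip: scaleC_of_real)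
  then show "norm (r *\<^sub>R x) = \<bar>r\<bar> * norm x"
    by (simp add: norm_unitization_def onorm_scaleR bounded_linear_lmult max_mult_distrib_left)
qed

end

instantiation unitization :: (cstar_algebra) complex_normed_vector
begin

definition scaleC_unitization :: "complex \<Rightarrow> 'a unitization \<Rightarrow> 'a unitization"
  where "scaleC_unitization c x = Unitization (c *\<^sub>C alg_part x) (c * scalar_part x)"

lemma unitization_sel_scaleC [simp]:
  "alg_part (c *\<^sub>C x) = c *\<^sub>C alg_part x" "scalar_part (c *\<^sub>C x) = c * scalar_part x"
  for x :: "'a unitization"
  by (simp_all add: scaleC_unitization_def)

lemma lmult_scaleC: "lmult (c *\<^sub>C x) b = c *\<^sub>C lmult x b" for x :: "'a unitization"
  by (simp add: lmult_def scaleC_simps)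

instance
proof
  fix x y :: "'a unitization" and r :: real and c d :: complex
  show "c *\<^sub>C (x + y) = c *\<^sub>C x + c *\<^sub>C y" "(c + d) *\<^sub>C x = c *\<^sub>C x + d *\<^sub>C x"
    "c *\<^sub>C d *\<^sub>C x = (c * d) *\<^sub>C x" "complex_of_real r *\<^sub>C x = r *\<^sub>R x"
    by (auto intro!: unitization_eqI simp: scaleC_simps scaleC_of_real algebra_simps scaleR_conv_of_real)
  have le: "norm (c *\<^sub>C x) \<le> cmod c * norm x" for c and x :: "'a unitization"
  proof -
    have "onorm (lmult (c *\<^sub>C x)) \<le> cmod c * onorm (lmult x)"
    proof (rule onorm_bound)
      show "norm (lmult (c *\<^sub>C x) b) \<le> cmod c * onorm (lmult x) * norm b" for b
        using mult_left_mono[OF onorm[OF bounded_linear_lmult], of "cmod c" x b]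
        by (simp add: lmult_scaleC norm_scaleC mult.assoc)
    qed (simp add: onorm_pos_le bounded_linear_lmult)
    then show ?thesis
      by (auto simp: norm_unitization_def max_mult_distrib_left norm_mult)
  qed
  show "norm (c *\<^sub>C x) = cmod c * norm x"
  proof (cases "c = 0")
    case True
    then show ?thesis using le[of 0 x] by simp
  next
    case False
    have "inverse c *\<^sub>C c *\<^sub>C x = x"
      using False by (intro unitization_eqI) (simp_all add: scaleC_scaleC)
    then have "norm x \<le> inverse (cmod c) * norm (c *\<^sub>C x)"
      using le[of "inverse c" "c *\<^sub>C x"] by (simp only: norm_inverse)
    then have "cmod c * norm x \<le> norm (c *\<^sub>C x)"
      using False by (simp add: field_simps)
    then show ?thesis using le[of c x] by simp
  qed
qed

end

instantiation unitization :: (cstar_algebra) real_normed_algebra_1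
begin

definition one_unitization :: "'a unitization"
  where "one_unitization = Unitization 0 1"

definition times_unitization :: "'a unitization \<Rightarrow> 'a unitization \<Rightarrow> 'a unitization"
  where "times_unitization x y = Unitization
    (alg_part x * alg_part y + scalar_part x *\<^sub>C alg_part y + scalar_part y *\<^sub>C alg_part x)
    (scalar_part x * scalar_part y)"

lemma unitization_sel_mult [simp]:
  "alg_part (1 :: 'a unitization) = 0" "scalar_part (1 :: 'a unitization) = 1"
  "alg_part (x * y) = alg_part x * alg_part y + scalar_part x *\<^sub>C alg_part y + scalar_part y *\<^sub>C alg_part x"
  "scalar_part (x * y) = scalar_part x * scalar_part y"
  for x y :: "'a unitization"
  by (simp_all add: one_unitization_def times_unitization_def)

lemma lmult_mult: "lmult (x * y) = lmult x \<circ> lmult y" for x y :: "'a unitization"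
  by (rule ext) (simp add: lmult_def scaleC_simps algebra_simps)

instance
proof
  fix x y z :: "'a unitization" and r :: real
  show "x * y * z = x * (y * z)" "(x + y) * z = x * z + y * z" "x * (y + z) = x * y + x * z"
    "1 * x = x" "x * 1 = x" "(r *\<^sub>R x) * y = r *\<^sub>R (x * y)" "x * (r *\<^sub>R y) = r *\<^sub>R (x * y)"
    by (auto intro!: unitization_eqI simp: scaleC_simps algebra_simps scaleR_conv_of_real
        simp flip: scaleC_of_real)
  show "(0 :: 'a unitization) \<noteq> 1" by (metis unitization_sel(2) unitization_sel_mult(2) zero_neq_one)
  have "onorm (lmult (x * y)) \<le> onorm (lmult x) * onorm (lmult y)"
    unfolding lmult_mult by (intro onorm_compose bounded_linear_lmult)
  also have "\<dots> \<le> norm x * norm y"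
    by (intro mult_mono) (auto simp: norm_unitization_def onorm_pos_le bounded_linear_lmult le_max_iff_disj)
  moreover have "cmod (scalar_part x) * cmod (scalar_part y) \<le> norm x * norm y"
    by (intro mult_mono) (auto simp: norm_unitization_def le_max_iff_disj)
  ultimately show "norm (x * y) \<le> norm x * norm y"
    by (simp add: norm_unitization_def[of "x * y"] norm_mult)
  have "lmult (1 :: 'a unitization) = (\<lambda>b. b)" by (rule ext) (simp add: lmult_def)
  then show "norm (1 :: 'a unitization) = 1"
    using onorm_id_le[where 'a = 'a] by (simp add: norm_unitization_def id_def max_absorb1)
qed

end

text \<open>The projections to the two parts are bounded, and the norm is at most the sum of the
  norms of the parts, so limits can be taken in each part.\<close>

instance unitization :: (cstar_algebra) complete_space
proof
  fix X :: "nat \<Rightarrow> 'a unitization"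
  assume X: "Cauchy X"
  have sle: "cmod (scalar_part x) \<le> norm x" and ole: "onorm (lmult x) \<le> norm x" for x :: "'a unitization"
    by (simp_all add: norm_unitization_def)
  have ale: "norm (alg_part x) \<le> 2 * norm x" for x :: "'a unitization"
    using norm_le_onorm_lmult[of x] sle[of x] ole[of x] by linarith
  have "bounded_linear (alg_part :: 'a unitization \<Rightarrow> 'a)"
    by (rule bounded_linear_intro[where K = 2]) (use ale in \<open>auto simp: mult.commute\<close>)
  from bounded_linear.Cauchy[OF this X] obtain a where a: "(\<lambda>n. alg_part (X n)) \<longlonglongrightarrow> a"
    by (auto simp: Cauchy_convergent_iff convergent_def)
  have "bounded_linear (scalar_part :: 'a unitization \<Rightarrow> complex)"
    by (rule bounded_linear_intro[where K = 1]) (use sle in auto)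
  from bounded_linear.Cauchy[OF this X] obtain l where l: "(\<lambda>n. scalar_part (X n)) \<longlonglongrightarrow> l"
    by (auto simp: Cauchy_convergent_iff convergent_def)
  have nle: "norm x \<le> norm (alg_part x) + cmod (scalar_part x)" for x :: "'a unitization"
  proof -
    have "onorm (lmult x) \<le> norm (alg_part x) + cmod (scalar_part x)"
    proof (rule onorm_bound)
      show "norm (lmult x b) \<le> (norm (alg_part x) + cmod (scalar_part x)) * norm b" for b
        unfolding lmult_def distrib_right
        by (intro norm_triangle_le add_mono norm_mult_ineq) (simp add: norm_scaleC)
    qed simp
    then show ?thesis by (simp add: norm_unitization_def)
  qed
  define g where "g n = norm (alg_part (X n) - a) + cmod (scalar_part (X n) - l)" for n
  have "g \<longlonglongrightarrow> 0 + 0"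
    unfolding g_def
    by (rule tendsto_add[OF tendsto_norm_zero[OF LIM_zero[OF a]] tendsto_norm_zero[OF LIM_zero[OF l]]])
  then have g0: "g \<longlonglongrightarrow> 0" by simp
  have "norm (X n - Unitization a l) \<le> g n" for n
    using nle[of "X n - Unitization a l"] by (simp add: g_def)
  then have "(\<lambda>n. X n - Unitization a l) \<longlonglongrightarrow> 0"
    by (rule Lim_null_comparison[OF always_eventually[OF allI] g0])
  then have "X \<longlonglongrightarrow> Unitization a l"
    by (rule LIM_zero_cancel)
  then show "convergent X" by (auto simp: convergent_def)
qed

instantiation unitization :: (cstar_algebra) cstar_algebra
begin

definition star_unitization :: "'a unitization \<Rightarrow> 'a unitization"
  where "star_unitization x = Unitization (star (alg_part x)) (cnj (scalar_part x))"

lemma unitization_sel_star [simp]: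
  "alg_part (star x) = star (alg_part x)" "scalar_part (star x) = cnj (scalar_part x)"
  for x :: "'a unitization"
  by (simp_all add: star_unitization_def)

instance
proof
  fix x y :: "'a unitization" and c
  show "(c *\<^sub>C x) * y = c *\<^sub>C (x * y)" "x * (c *\<^sub>C y) = c *\<^sub>C (x * y)"
    "star (star x) = x" "star (x + y) = star x + star y" "star (c *\<^sub>C x) = cnj c *\<^sub>C star x"
    "star (x * y) = star y * star x"
    by (auto intro!: unitization_eqI simp: scaleC_simps star_simps star_scaleC algebra_simps)
  have le: "(norm x)\<^sup>2 \<le> norm (star x * x)" for x :: "'a unitization"
  proof -
    \<comment> \<open>\<open>lmult (star x)\<close> is the adjoint of \<open>lmult x\<close> for the
      A-valued inner product b^* c; the C*-inequality for the operator norm follows.\<close>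
    have adj: "star (lmult x b) * c = star b * lmult (star x) c" for b c
      by (simp add: lmult_def star_simps star_scaleC scaleC_simps algebra_simps)
    have "onorm (lmult x) \<le> sqrt (onorm (lmult (star x * x)))"
    proof (rule onorm_bound)
      fix b
      have "(norm (lmult x b))\<^sup>2 = norm (star b * lmult (star x * x) b)"
        using norm_star_mult_self[of "lmult x b"] by (simp add: adj lmult_mult)
      also have "\<dots> \<le> norm b * (onorm (lmult (star x * x)) * norm b)"
        by (intro order_trans[OF norm_mult_ineq] mult_mono onorm bounded_linear_lmult)
          (auto simp: norm_star)
      also have "\<dots> = (sqrt (onorm (lmult (star x * x))) * norm b)\<^sup>2"
        by (simp add: power_mult_distrib onorm_pos_le bounded_linear_lmult power2_eq_square[of "norm b"])
      finally show "norm (lmult x b) \<le> sqrt (onorm (lmult (star x * x))) * norm b"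
        by (rule power2_le_imp_le) (simp add: onorm_pos_le bounded_linear_lmult)
    qed (simp add: onorm_pos_le bounded_linear_lmult)
    then have "(onorm (lmult x))\<^sup>2 \<le> onorm (lmult (star x * x))"
      using onorm_pos_le[OF bounded_linear_lmult] by (metis real_le_lsqrt sqrt_ge_absD abs_of_nonneg)
    moreover have "(cmod (scalar_part x))\<^sup>2 = cmod (scalar_part (star x * x))"
      by (simp add: norm_mult power2_eq_square)
    ultimately show ?thesis
      by (auto simp: norm_unitization_def max_def)
  qed
  have sub: "norm (star x * x) \<le> norm (star x) * norm x" for x :: "'a unitization"
    by (rule norm_mult_ineq)
  have "norm x \<le> norm (star x)" for x :: "'a unitization"
  proof (cases "norm x = 0")
    case False
    have "norm x * norm x \<le> norm (star x) * norm x"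
      using le[of x] sub[of x] by (simp add: power2_eq_square)
    with False show ?thesis by (simp add: mult_le_cancel_right)
  qed simp
  from this[of x] this[of "star x"] \<open>star (star x) = x\<close> have "norm (star x) = norm x" by simp
  then show "norm (star x * x) = (norm x)\<^sup>2"
    using le[of x] sub[of x] by (simp add: power2_eq_square)
qed

end

section \<open>Positive elements of non-unital C*-algebras\<close>

definition unitize :: "'a \<Rightarrow> 'a :: cstar_algebra unitization"
  where "unitize a = Unitization a 0"

lemma unitize_sel [simp]: "alg_part (unitize a) = a" "scalar_part (unitize a) = 0"
  by (simp_all add: unitize_def)

lemma unitize_alg_part: "scalar_part x = 0 \<Longrightarrow> unitize (alg_part x) = x"
  by (rule unitization_eqI) simp_all

lemma unitize_simps:
  "unitize (a + b) = unitize a + unitize b" "unitize (a - b) = unitize a - unitize b"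
  "unitize (- a) = - unitize a" "unitize (r *\<^sub>R a) = r *\<^sub>R unitize a"
  "unitize (c *\<^sub>C a) = c *\<^sub>C unitize a"
  "unitize (a * b) = unitize a * unitize b" "unitize (star a) = star (unitize a)"
  by (rule unitization_eqI; simp)+

lemma norm_unitize: "norm (unitize a) = norm a"
proof (rule antisym)
  have "onorm (lmult (unitize a)) \<le> norm a"
    by (rule onorm_bound) (simp_all add: lmult_def norm_mult_ineq)
  then show "norm (unitize a) \<le> norm a" by (simp add: norm_unitization_def)
  show "norm a \<le> norm (unitize a)"
    using norm_le_onorm_lmult[of "unitize a"] by (simp add: norm_unitization_def)
qed

definition cpos :: "'a :: cstar_algebra \<Rightarrow> bool"
  where "cpos a \<longleftrightarrow> (\<exists>c. a = star c * c)"

lemma cstar_le_iff: "cstar_le a b \<longleftrightarrow> cpos (b - a)"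
  by (simp add: cstar_le_def cpos_def)

text \<open>The scalar part is multiplicative, so a self-adjoint root of \<open>unitize a\<close>
  has scalar part 0 and lies in A. Positivity in A can thus be computed in the unitization.\<close>

lemma cpos_iff: "cpos a \<longleftrightarrow> hpos (unitize a)"
proof
  assume "cpos a"
  then show "hpos (unitize a)" by (auto simp: cpos_def unitize_simps hpos_star_mult_self)
next
  assume "hpos (unitize a)"
  then obtain h where h: "star h = h" "unitize a = h * h" by (auto simp: hpos_def)
  from arg_cong[OF h(2), of scalar_part] have "scalar_part h = 0" by simp
  then have "alg_part (h * h) = alg_part h * alg_part h" by simp
  moreover have "star (alg_part h) = alg_part h" by (metis h(1) unitization_sel_star(1))
  moreover have "a = alg_part (h * h)" by (metis h(2) unitize_sel(1))
  ultimately have "a = star (alg_part h) * alg_part h" by simp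
  then show "cpos a" by (auto simp: cpos_def)
qed

lemma cpos_zero [simp]: "cpos 0"
  by (auto simp: cpos_def intro: exI[of _ 0])

lemma cpos_star_mult_self: "cpos (star c * c)"
  by (auto simp: cpos_def)

lemma cpos_selfadjoint: "cpos a \<Longrightarrow> star a = a"
  by (auto simp: cpos_def star_simps)

lemma cpos_add: "cpos a \<Longrightarrow> cpos b \<Longrightarrow> cpos (a + b)"
  by (simp add: cpos_iff unitize_simps hpos_add)

lemma cpos_scaleR: "0 \<le> r \<Longrightarrow> cpos a \<Longrightarrow> cpos (r *\<^sub>R a)"
  by (simp add: cpos_iff unitize_simps hpos_scaleR)

lemma cpos_conj: "cpos a \<Longrightarrow> cpos (star c * a * c)"
  by (simp add: cpos_iff unitize_simps hpos_conj)

lemma cstar_le_refl: "cstar_le a a" for a :: "'a :: cstar_algebra"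
  by (simp add: cstar_le_iff)

lemma cstar_le_trans: "cstar_le a b \<Longrightarrow> cstar_le b c \<Longrightarrow> cstar_le a c" for a b c :: "'a :: cstar_algebra"
  using cpos_add[of "b - a" "c - b"] by (simp add: cstar_le_iff)

text \<open>In the unitization this is \<open>1 - (1 + b)\<^sup>-\<^sup>1 = b (1 + b)\<^sup>-\<^sup>1\<close>, which lies in \<open>A\<close>.\<close>

definition cutoff :: "'a \<Rightarrow> 'a :: cstar_algebra"
  where "cutoff b = alg_part (1 - resolvent (unitize b))"

text \<open>The scalar part is a character with value 1 on \<open>1 + unitize b\<close>, hence also
  on the resolvent.\<close>

lemma unitize_cutoff:
  assumes "cpos b"
  shows "unitize (cutoff b) = 1 - resolvent (unitize b)"
proof -
  have "scalar_part (resolvent (unitize b) * (1 + unitize b)) = 1"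
    using assms by (simp only: cpos_iff resolvent_mult unitization_sel_mult)
  then show ?thesis unfolding cutoff_def by (intro unitize_alg_part) simp
qed

lemma cpos_cutoff: "cpos b \<Longrightarrow> cpos (cutoff b)"
  by (simp add: cpos_iff[of "cutoff b"] unitize_cutoff) (simp add: cpos_iff hpos_one_minus_resolvent)

lemma cpos_diff_cutoff: "cpos b \<Longrightarrow> cpos (b - cutoff b)"
  by (simp add: cpos_iff[of "b - cutoff b"] unitize_cutoff unitize_simps)
    (simp add: cpos_iff hpos_minus_one_minus_resolvent)

lemma cutoff_mono: "cpos b \<Longrightarrow> cpos (c - b) \<Longrightarrow> cpos (cutoff c - cutoff b)"
proof -
  assume b: "cpos b" and d: "cpos (c - b)"
  have c: "cpos c" using cpos_add[OF b d] by simp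
  have "hpos (resolvent (unitize b) - resolvent (unitize c))"
    using b d by (intro resolvent_antimono) (simp_all add: cpos_iff unitize_simps)
  then show ?thesis by (simp add: cpos_iff[of "cutoff c - cutoff b"] unitize_cutoff b c unitize_simps)
qed

lemma norm_cutoff: "cpos b \<Longrightarrow> norm (cutoff b) \<le> 1"
proof -
  assume b: "cpos b"
  have "norm (unitize (cutoff b)) \<le> norm (1 :: 'a unitization)"
  proof (rule hpos_norm_mono)
    show "hpos (unitize (cutoff b))" using cpos_cutoff[OF b] by (simp add: cpos_iff)
    show "hpos (1 - unitize (cutoff b))"
      using b by (simp add: unitize_cutoff) (simp add: cpos_iff hpos_resolvent)
  qed
  then show ?thesis by (simp add: norm_unitize)
qed

lemma cutoff_plus:
  assumes "cpos b"
  shows "cutoff b + b * cutoff b = b" "cutoff b + cutoff b * b = b"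
proof -
  have h: "hpos (unitize b)" using assms by (simp add: cpos_iff)
  let ?r = "resolvent (unitize b)"
  have "(1 - ?r) + unitize b * (1 - ?r) = (1 - (?r + unitize b * ?r)) + unitize b"
    by (simp add: right_diff_distrib)
  then have "unitize (cutoff b + b * cutoff b) = unitize b"
    by (simp add: resolvent_plus[OF h] unitize_cutoff[OF assms] unitize_simps)
  then show "cutoff b + b * cutoff b = b" by (metis unitize_sel(1))
  have "(1 - ?r) + (1 - ?r) * unitize b = (1 - (?r + ?r * unitize b)) + unitize b"
    by (simp add: left_diff_distrib)
  then have "unitize (cutoff b + cutoff b * b) = unitize b"
    by (simp add: resolvent_plus[OF h] unitize_cutoff[OF assms] unitize_simps)
  then show "cutoff b + cutoff b * b = b" by (metis unitize_sel(1))
qed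

text \<open>In the unitization, a - a (cutoff b) is a times the resolvent.\<close>

lemma norm_diff_mult_cutoff:
  assumes n: "n > 0" and b: "cpos (b - n *\<^sub>R (star a * a))"
  shows "(norm (a - a * cutoff b))\<^sup>2 \<le> 1 / n"
proof -
  have "cpos (n *\<^sub>R (star a * a))" using n by (intro cpos_scaleR cpos_star_mult_self) simp
  from cpos_add[OF this b] have cb: "cpos b" by simp
  have "unitize (a - a * cutoff b) = unitize a * resolvent (unitize b)"
    by (simp add: unitize_simps unitize_cutoff[OF cb] right_diff_distrib)
  then have "norm (a - a * cutoff b) = norm (unitize a * resolvent (unitize b))"
    by (metis norm_unitize)
  moreover have "hpos (unitize b - n *\<^sub>R (star (unitize a) * unitize a))"
    using b by (simp add: cpos_iff unitize_simps)
  ultimately show ?thesis using norm_mult_resolvent[OF n] by simp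
qed

text \<open>Take b0 = n a^* a. The estimate persists for all larger b, so that it can be met
  together with another eventual condition.\<close>

lemma approximate_right_unit:
  assumes "e > 0"
  shows "\<exists>b0. cpos b0 \<and> (\<forall>b. cpos (b - b0) \<longrightarrow> norm (a - a * cutoff b) < e)"
proof -
  \<comment> \<open>Then 1/n is the square of e/2, which leaves room for the strict
    inequality.\<close>
  define n where "n = 4 / e\<^sup>2"
  have n: "n > 0" using assms by (simp add: n_def)
  have "norm (a - a * cutoff b) < e" if "cpos (b - n *\<^sub>R (star a * a))" for b
  proof -
    have "1 / n = (e / 2)\<^sup>2" by (simp add: n_def power_divide)
    then have "(norm (a - a * cutoff b))\<^sup>2 \<le> (e / 2)\<^sup>2"
      using norm_diff_mult_cutoff[OF n that] by (simp only:)
    then have "norm (a - a * cutoff b) \<le> e / 2" by (rule power2_le_imp_le) (use assms in simp)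
    then show ?thesis using assms by linarith
  qed
  then show ?thesis using n by (intro exI[of _ "n *\<^sub>R (star a * a)"] conjI cpos_scaleR cpos_star_mult_self) auto
qed

section \<open>Dominated extension of linear functionals\<close>

definition sublinear :: "('v :: real_vector \<Rightarrow> real) \<Rightarrow> bool"
  where "sublinear p \<longleftrightarrow> (\<forall>x y. p (x + y) \<le> p x + p y) \<and> (\<forall>r\<ge>0. \<forall>x. p (r *\<^sub>R x) = r * p x)"

lemma sublinearI:
  assumes "\<And>x y. p (x + y) \<le> p x + p y" and "p 0 = 0"
    and "\<And>r x. r > 0 \<Longrightarrow> p (r *\<^sub>R x) \<le> r * p x"
  shows "sublinear p"
  unfolding sublinear_def
proof (intro conjI allI impI assms)
  fix r :: real and x assume "r \<ge> 0"
  show "p (r *\<^sub>R x) = r * p x"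
  proof (cases "r = 0")
    case False
    with \<open>r \<ge> 0\<close> have r: "r > 0" by simp
    have "p (inverse r *\<^sub>R r *\<^sub>R x) \<le> inverse r * p (r *\<^sub>R x)" using r by (intro assms) simp
    then have "r * p x \<le> p (r *\<^sub>R x)" using r by (simp add: field_simps)
    with assms(3)[OF r, of x] show ?thesis by simp
  qed (simp add: assms)
qed

lemma sublinear_add: "sublinear p \<Longrightarrow> p (x + y) \<le> p x + p y"
  by (simp add: sublinear_def)

lemma sublinear_scaleR: "sublinear p \<Longrightarrow> 0 \<le> r \<Longrightarrow> p (r *\<^sub>R x) = r * p x"
  by (simp add: sublinear_def)

lemma sublinear_zero: "sublinear p \<Longrightarrow> p 0 = 0"
  using sublinear_scaleR[of p 0 0] by simp

lemma sublinear_minus: "sublinear p \<Longrightarrow> - p (- x) \<le> p x"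
  using sublinear_add[of p x "- x"] by (simp add: sublinear_zero)

text \<open>
  The witness is \<open>q x = inf\<^sub>v (p (x + v) - F v)\<close>. For a subspace \<open>K\<close> this forces extension of \<open>F\<close>, for a
  ray \<open>K\<close> it shows that minimal sublinear functionals are linear, and for \<open>F = 0\<close> and a cone \<open>K\<close> it
  forces positivity on \<open>K\<close>.
\<close>

lemma sublinear_convolution:
  fixes p :: "'v :: real_vector \<Rightarrow> real"
  assumes p: "sublinear p" and K: "0 \<in> K" "\<And>u v. u \<in> K \<Longrightarrow> v \<in> K \<Longrightarrow> u + v \<in> K"
      "\<And>r v. r > 0 \<Longrightarrow> v \<in> K \<Longrightarrow> r *\<^sub>R v \<in> K"
    and F: "F 0 = 0" "\<And>u v. u \<in> K \<Longrightarrow> v \<in> K \<Longrightarrow> F (u + v) = F u + F v"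
      "\<And>r v. r > 0 \<Longrightarrow> v \<in> K \<Longrightarrow> F (r *\<^sub>R v) = r * F v"
    and le: "\<And>v. v \<in> K \<Longrightarrow> F v \<le> p v"
  obtains q where "sublinear q" "\<And>x. q x \<le> p x" "\<And>x v. v \<in> K \<Longrightarrow> q x \<le> p (x + v) - F v"
    "\<And>c x. (\<And>v. v \<in> K \<Longrightarrow> c \<le> p (x + v) - F v) \<Longrightarrow> c \<le> q x"
proof -
  define q where "q x = Inf ((\<lambda>v. p (x + v) - F v) ` K)" for x
  \<comment> \<open>This lower bound makes the infimum finite.\<close>
  have lb: "- p (- x) \<le> p (x + v) - F v" if "v \<in> K" for x v
  proof -
    have "p v \<le> p (- x) + p (x + v)" using sublinear_add[OF p, of "- x" "x + v"] by simp
    with le[OF that] show ?thesis by linarith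
  qed
  then have bdd: "bdd_below ((\<lambda>v. p (x + v) - F v) ` K)" for x by (intro bdd_belowI2)
  have q_le: "q x \<le> p (x + v) - F v" if "v \<in> K" for x v
    unfolding q_def by (rule cINF_lower[OF bdd that])
  have q_ge: "c \<le> q x" if "\<And>v. v \<in> K \<Longrightarrow> c \<le> p (x + v) - F v" for c x
    unfolding q_def by (rule cINF_greatest) (use that K in auto)
  have qp: "q x \<le> p x" for x using q_le[OF K(1), of x] by (simp add: F)
  have "sublinear q"
  proof (rule sublinearI)
    fix x y
    have "q (x + y) - (p (y + v) - F v) \<le> p (x + u) - F u" if "u \<in> K" "v \<in> K" for u v
    proof -
      have "q (x + y) \<le> p ((x + u) + (y + v)) - F (u + v)"
        using q_le[OF K(2)[OF that], of "x + y"] by (simp add: algebra_simps)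
      then show ?thesis using sublinear_add[OF p, of "x + u" "y + v"] F(2)[OF that] by linarith
    qed
    then have "q (x + y) - (p (y + v) - F v) \<le> q x" if "v \<in> K" for v using that by (intro q_ge) auto
    then have "q (x + y) - q x \<le> q y" by (intro q_ge) fastforce
    then show "q (x + y) \<le> q x + q y" by simp
  next
    have "0 \<le> q 0" using q_ge[of 0 0] lb[of _ 0] by (simp add: sublinear_zero[OF p])
    then show "q 0 = 0" using qp[of 0] by (simp add: sublinear_zero[OF p])
  next
    fix r :: real and x assume r: "r > 0"
    have "q (r *\<^sub>R x) / r \<le> p (x + v) - F v" if "v \<in> K" for v
    proof -
      have "q (r *\<^sub>R x) \<le> p (r *\<^sub>R x + r *\<^sub>R v) - F (r *\<^sub>R v)" using r that by (intro q_le K)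
      also have "\<dots> = r * (p (x + v) - F v)"
        using sublinear_scaleR[OF p, of r "x + v"] r F(3)[OF r that]
        by (simp add: scaleR_add_right right_diff_distrib)
      finally show ?thesis using r by (simp add: field_simps)
    qed
    then have "q (r *\<^sub>R x) / r \<le> q x" by (intro q_ge)
    then show "q (r *\<^sub>R x) \<le> r * q x" using r by (simp add: field_simps)
  qed
  from that[OF this qp q_le q_ge] show ?thesis .
qed

text \<open>Zorn, with pointwise infima of chains. Every sublinear q below p satisfies - p (- x) <=
  q x, so the infima are finite; they are subadditive because of two members of a chain one lies
  below both.\<close>

lemma minimal_sublinear_exists:
  fixes p :: "'v :: real_vector \<Rightarrow> real"
  assumes p: "sublinear p"
  obtains m where "sublinear m" "m \<le> p" "\<And>q. sublinear q \<Longrightarrow> q \<le> m \<Longrightarrow> q = m"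
proof -
  define A where "A = {q. sublinear q \<and> q \<le> p}"
  \<comment> \<open>The order is reversed, so that a maximal element is a minimal
    functional.\<close>
  let ?P = "\<lambda>f g :: 'v \<Rightarrow> real. g \<le> f"
  have po: "partial_order_on A (relation_of ?P A)"
    by (auto simp: partial_order_on_def preorder_on_def refl_on_def trans_def antisym_def relation_of_def)
  have "\<exists>m\<in>A. \<forall>a\<in>A. ?P m a \<longrightarrow> a = m"
  proof (rule predicate_Zorn[OF po])
    fix C assume C: "C \<in> Chains (relation_of ?P A)"
    then have CA: "C \<subseteq> A" by (auto simp: Chains_def relation_of_def)
    have tot: "f \<le> g \<or> g \<le> f" if "f \<in> C" "g \<in> C" for f g
      using C that by (auto simp: Chains_def relation_of_def)
    show "\<exists>u\<in>A. \<forall>a\<in>C. ?P a u"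
    proof (cases "C = {}")
      case True
      then show ?thesis using p by (auto simp: A_def)
    next
      case False
      define u where "u x = Inf ((\<lambda>q. q x) ` C)" for x
      have "- p (- x) \<le> q x" if "q \<in> C" for q x
      proof -
        have q: "sublinear q" "q (- x) \<le> p (- x)" using CA that by (auto simp: A_def le_fun_def)
        then show ?thesis using sublinear_minus[OF q(1), of x] by linarith
      qed
      then have bdd: "bdd_below ((\<lambda>q. q x) ` C)" for x by (intro bdd_belowI2)
      have u_le: "u x \<le> q x" if "q \<in> C" for q x unfolding u_def by (rule cINF_lower[OF bdd that])
      have u_ge: "c \<le> u x" if "\<And>q. q \<in> C \<Longrightarrow> c \<le> q x" for c x
        unfolding u_def by (rule cINF_greatest) (use that False in auto)
      have "sublinear u"
      proof (rule sublinearI)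
        fix x y
        have "u (x + y) - g y \<le> f x" if fg: "f \<in> C" "g \<in> C" for f g
        proof -
          obtain h where h: "h \<in> C" "h \<le> f" "h \<le> g" using tot[OF fg] fg by blast
          have "u (x + y) \<le> h (x + y)" by (rule u_le[OF h(1)])
          also have "\<dots> \<le> h x + h y" using CA h(1) by (auto simp: A_def intro: sublinear_add)
          also have "\<dots> \<le> f x + g y" using h by (intro add_mono) (auto simp: le_fun_def)
          finally show ?thesis by simp
        qed
        then have "u (x + y) - g y \<le> u x" if "g \<in> C" for g using that by (intro u_ge) auto
        then have "u (x + y) - u x \<le> u y" by (intro u_ge) fastforce
        then show "u (x + y) \<le> u x + u y" by simp
      next
        have z: "q 0 = 0" if "q \<in> C" for q using CA that by (auto simp: A_def intro: sublinear_zero)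
        obtain q where "q \<in> C" using False by blast
        then show "u 0 = 0" using u_le[of q 0] u_ge[of 0 0] z by fastforce
      next
        fix r :: real and x assume r: "r > 0"
        have "u (r *\<^sub>R x) / r \<le> q x" if "q \<in> C" for q
        proof -
          have "u (r *\<^sub>R x) \<le> q (r *\<^sub>R x)" by (rule u_le[OF that])
          also have "\<dots> = r * q x" using CA that r by (auto simp: A_def intro!: sublinear_scaleR)
          finally show ?thesis using r by (simp add: field_simps)
        qed
        then have "u (r *\<^sub>R x) / r \<le> u x" by (rule u_ge)
        then show "u (r *\<^sub>R x) \<le> r * u x" using r by (simp add: field_simps)
      qed
      moreover have "u \<le> p"
      proof -
        obtain q where q: "q \<in> C" using False by blast
        then have "q \<le> p" using CA by (auto simp: A_def)
        with u_le[OF q] show ?thesis by (meson le_funI le_funD order_trans)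
      qed
      ultimately have "u \<in> A" by (simp add: A_def)
      moreover have "u \<le> q" if "q \<in> C" for q using u_le[OF that] by (rule le_funI)
      ultimately show ?thesis by (intro bexI ballI)
    qed
  qed
  then obtain m where m: "m \<in> A" "\<And>a. a \<in> A \<Longrightarrow> a \<le> m \<Longrightarrow> a = m" by blast
  show ?thesis
  proof (rule that)
    show "sublinear m" "m \<le> p" using m(1) by (auto simp: A_def)
    show "q = m" if "sublinear q" "q \<le> m" for q
      using that m(1) by (intro m(2)) (auto simp: A_def)
  qed
qed

text \<open>Convolve m with itself along the ray of v. The result q lies below m, hence equals m,
  and q x <= m (x + v) - m v becomes superadditivity.\<close>

lemma minimal_sublinear_linear:
  fixes m :: "'v :: real_vector \<Rightarrow> real"
  assumes m: "sublinear m" and min: "\<And>q. sublinear q \<Longrightarrow> q \<le> m \<Longrightarrow> q = m"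
  shows "linear m"
proof -
  have ge: "m x + m v \<le> m (x + v)" for x v
  proof -
    define K where "K = {t *\<^sub>R v |t. t \<ge> 0}"
    have mK: "m (t *\<^sub>R v) = t * m v" if "t \<ge> 0" for t using that m by (rule sublinear_scaleR[rotated])
    have "\<exists>q. sublinear q \<and> (\<forall>x. q x \<le> m x) \<and> (\<forall>x. \<forall>w\<in>K. q x \<le> m (x + w) - m w)"
    proof (rule sublinear_convolution[OF m, of K m])
      show "0 \<in> K" unfolding K_def by (auto intro: exI[of _ 0])
      show "u + w \<in> K" if uw: "u \<in> K" "w \<in> K" for u w
      proof -
        obtain t s where "t \<ge> 0" "s \<ge> 0" "u = t *\<^sub>R v" "w = s *\<^sub>R v" using uw by (auto simp: K_def)
        then have "u + w = (t + s) *\<^sub>R v" "t + s \<ge> 0" by (auto simp: scaleR_add_left)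
        then show ?thesis unfolding K_def by blast
      qed
      show "r *\<^sub>R w \<in> K" if r: "r > 0" and w: "w \<in> K" for r w
      proof -
        obtain t where "t \<ge> 0" "w = t *\<^sub>R v" using w by (auto simp: K_def)
        then have "r *\<^sub>R w = (r * t) *\<^sub>R v" "r * t \<ge> 0" using r by auto
        then show ?thesis unfolding K_def by blast
      qed
      show "m (u + w) = m u + m w" if "u \<in> K" "w \<in> K" for u w
        using that by (auto simp: K_def mK distrib_right simp flip: scaleR_add_left)
      show "m (r *\<^sub>R w) = r * m w" if "r > 0" "w \<in> K" for r w
        using that m by (simp add: sublinear_scaleR)
    qed (use sublinear_zero[OF m] in auto)
    then obtain q where q: "sublinear q" "q \<le> m" "\<And>x w. w \<in> K \<Longrightarrow> q x \<le> m (x + w) - m w"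
      by (auto simp: le_fun_def)
    from min[OF q(1,2)] have "q = m" .
    moreover have "v \<in> K" unfolding K_def by (auto intro: exI[of _ 1])
    ultimately show ?thesis using q(3)[of v x] by simp
  qed
  have add: "m (x + y) = m x + m y" for x y
    using ge[of x y] sublinear_add[OF m, of x y] by simp
  have neg: "m (- x) = - m x" for x using add[of x "- x"] sublinear_zero[OF m] by simp
  show ?thesis
  proof (rule linearI)
    show "m (x + y) = m x + m y" for x y by (rule add)
    show "m (r *\<^sub>R x) = r *\<^sub>R m x" for r x
    proof (cases "r \<ge> 0")
      case True
      then show ?thesis by (simp add: sublinear_scaleR[OF m])
    next
      case False
      then show ?thesis using sublinear_scaleR[OF m, of "- r" x] neg[of "r *\<^sub>R x"] by simp
    qed
  qed
qed

text \<open>A minimal functional m below the convolution q is linear, and q (- v) <= - F v gives F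
  <= m on V; replacing v by - v gives equality.\<close>

theorem hahn_banach:
  fixes p :: "'v :: real_vector \<Rightarrow> real"
  assumes p: "sublinear p" and V: "subspace V"
    and F: "\<And>u v. u \<in> V \<Longrightarrow> v \<in> V \<Longrightarrow> F (u + v) = F u + F v" "\<And>r v. v \<in> V \<Longrightarrow> F (r *\<^sub>R v) = r * F v"
    and le: "\<And>v. v \<in> V \<Longrightarrow> F v \<le> p v"
  obtains G where "linear G" "\<And>x. G x \<le> p x" "\<And>v. v \<in> V \<Longrightarrow> G v = F v"
proof -
  have F0: "F 0 = 0" using F(2)[of 0 0] subspace_0[OF V] by simp
  obtain q where q: "sublinear q" "\<And>x. q x \<le> p x" "\<And>x v. v \<in> V \<Longrightarrow> q x \<le> p (x + v) - F v"
    by (rule sublinear_convolution[OF p, of V F])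
      (use V F F0 le in \<open>auto simp: subspace_0 subspace_add subspace_scale\<close>)
  obtain m where m: "sublinear m" "m \<le> q" "\<And>q. sublinear q \<Longrightarrow> q \<le> m \<Longrightarrow> q = m"
    using minimal_sublinear_exists[OF q(1)] by blast
  have lin: "linear m" using m(1,3) by (rule minimal_sublinear_linear)
  have mp: "m x \<le> p x" for x using m(2) q(2)[of x] by (auto simp: le_fun_def intro: order_trans)
  have ge: "F v \<le> m v" if "v \<in> V" for v
  proof -
    have "m (- v) \<le> q (- v)" using m(2) by (simp add: le_fun_def)
    also have "\<dots> \<le> - F v" using q(3)[OF that, of "- v"] by (simp add: sublinear_zero[OF p])
    finally show ?thesis by (simp add: linear_neg[OF lin])
  qed
  show ?thesis
  proof (rule that[OF lin mp])
    fix v assume v: "v \<in> V"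
    have "F (- v) \<le> m (- v)" using v V by (intro ge subspace_neg)
    then have "m v \<le> F v" using F(2)[OF v, of "-1"] by (simp add: linear_neg[OF lin])
    with ge[OF v] show "m v = F v" by simp
  qed
qed

section \<open>Positive functionals\<close>

text \<open>States without normalisation: the zero functional is included, and the class is stable
  under passing from \<phi> to \<phi> (b^* . b).\<close>

definition positive_functional :: "'a :: cstar_algebra cdual \<Rightarrow> bool"
  where "positive_functional \<phi> \<longleftrightarrow> (\<forall>a. cdual_apply \<phi> (star a * a) \<in> \<real>\<^sub>\<ge>\<^sub>0)"

lemma positive_functionalD: "positive_functional \<phi> \<Longrightarrow> cdual_apply \<phi> (star a * a) \<in> \<real>\<^sub>\<ge>\<^sub>0"
  by (simp add: positive_functional_def)

lemma positive_functional_cpos: "positive_functional \<phi> \<Longrightarrow> cpos a \<Longrightarrow> cdual_apply \<phi> a \<in> \<real>\<^sub>\<ge>\<^sub>0"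
  by (auto simp: cpos_def positive_functional_def)

lemmas cdual_rep_eq = zero_cdual.rep_eq minus_cdual.rep_eq uminus_cdual.rep_eq scaleR_cdual.rep_eq

lemma cdual_zero: "cdual_apply f 0 = 0"
  using cdual_add[of f 0 0] by simp

lemma cdual_minus: "cdual_apply f (- x) = - cdual_apply f x"
  using cdual_scaleC[of f "-1" x] by (simp add: scaleC_minus_one)

lemma cdual_diff: "cdual_apply f (x - y) = cdual_apply f x - cdual_apply f y"
  using cdual_add[of f x "- y"] by (simp add: cdual_minus)

lemma cdual_scaleR: "cdual_apply f (r *\<^sub>R x) = complex_of_real r * cdual_apply f x"
  using cdual_scaleC[of f "complex_of_real r" x] by (simp add: scaleC_of_real)

lemmas cdual_linear_simps = cdual_zero cdual_minus cdual_diff cdual_add cdual_scaleR cdual_scaleC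

text \<open>Polarisation: \<phi> is real on the squares of a + b and a + i b.\<close>

lemma positive_functional_swap:
  assumes "positive_functional \<phi>"
  shows "cdual_apply \<phi> (star a * b) = cnj (cdual_apply \<phi> (star b * a))"
proof -
  have im: "Im (cdual_apply \<phi> (star c * c)) = 0" for c
    using positive_functionalD[OF assms, of c] by (auto simp: complex_nonneg_Reals_iff)
  have "Im (cdual_apply \<phi> (star a * b)) + Im (cdual_apply \<phi> (star b * a)) = 0"
    using im[of "a + b"] im[of a] im[of b]
    by (simp add: star_simps distrib_left distrib_right cdual_linear_simps)
  moreover have "Re (cdual_apply \<phi> (star a * b)) - Re (cdual_apply \<phi> (star b * a)) = 0"
    using im[of "a + \<i> *\<^sub>C b"] im[of a] im[of b]
    by (simp add: star_simps star_scaleC distrib_left distrib_right cdual_linear_simps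
        scaleC_mult_left scaleC_mult_right)
  ultimately show ?thesis by (simp add: complex_eq_iff)
qed

lemma cdual_apply_close: "norm (a - b) \<le> d \<Longrightarrow> cmod (cdual_apply f a - cdual_apply f b) \<le> norm f * d"
  using norm_cdual_apply[of f "a - b"] mult_left_mono[of "norm (a - b)" d "norm f"]
  by (simp add: cdual_diff)

text \<open>An approximate right unit e replaces the unit: \<phi> (star a) is close to \<phi> (e
  star a), which by \<open>positive_functional_swap\<close> is the conjugate of \<phi> (a
  e).\<close>

lemma positive_functional_star:
  assumes "positive_functional \<phi>"
  shows "cdual_apply \<phi> (star a) = cnj (cdual_apply \<phi> a)"
proof -
  define D where "D = cmod (cdual_apply \<phi> (star a) - cnj (cdual_apply \<phi> a))"
  have "D \<le> 0 + e" if "e > 0" for e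
  proof -
    \<comment> \<open>The error will be 2 d times the norm of \<phi>; the summand 1 covers \<phi> =
      0.\<close>
    define d where "d = e / (2 * norm \<phi> + 1)"
    have d: "d > 0" using that by (simp add: d_def add_nonneg_pos)
    obtain b where b: "cpos b" "norm (a - a * cutoff b) < d"
      using approximate_right_unit[OF d, of a] by force
    let ?e = "cutoff b"
    have se: "star ?e = ?e" by (intro cpos_selfadjoint cpos_cutoff b)
    have "star (a - a * ?e) = star a - ?e * star a" by (simp add: star_simps se)
    then have "norm (star a - ?e * star a) < d" using b(2) norm_star[of "a - a * ?e"] by simp
    then have 1: "cmod (cdual_apply \<phi> (star a) - cdual_apply \<phi> (?e * star a)) \<le> norm \<phi> * d"
      by (intro cdual_apply_close) simp
    have 2: "cmod (cdual_apply \<phi> a - cdual_apply \<phi> (a * ?e)) \<le> norm \<phi> * d"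
      using b(2) by (intro cdual_apply_close) simp
    have "cdual_apply \<phi> (?e * star a) = cnj (cdual_apply \<phi> (a * ?e))"
      using positive_functional_swap[OF assms, of ?e "star a"] by (simp add: se star_star)
    then have "cdual_apply \<phi> (star a) - cnj (cdual_apply \<phi> a) =
        (cdual_apply \<phi> (star a) - cdual_apply \<phi> (?e * star a))
        - cnj (cdual_apply \<phi> a - cdual_apply \<phi> (a * ?e))" by simp
    then have "D \<le> cmod (cdual_apply \<phi> (star a) - cdual_apply \<phi> (?e * star a))
          + cmod (cdual_apply \<phi> a - cdual_apply \<phi> (a * ?e))"
      unfolding D_def by (metis norm_triangle_ineq4 complex_mod_cnj)
    also have "\<dots> \<le> 2 * norm \<phi> * d" using 1 2 by simp
    also have "\<dots> \<le> (2 * norm \<phi> + 1) * d" using d by (simp add: distrib_right)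
    also have "\<dots> = 0 + e"
    proof -
      have "2 * norm \<phi> + 1 \<noteq> 0" using norm_ge_zero[of \<phi>] by linarith
      then show ?thesis by (simp add: d_def)
    qed
    finally show ?thesis .
  qed
  then have "D \<le> 0" by (rule field_le_epsilon)
  then show ?thesis by (simp add: D_def)
qed

lemma dual_star_positive_functional: "positive_functional \<phi> \<Longrightarrow> dual_star \<phi> = \<phi>"
  by (rule cdual_eqI) (simp add: dual_star.rep_eq positive_functional_star)

lemma norm_cdual_leI:
  assumes "\<And>a. norm a \<le> 1 \<Longrightarrow> Re (cdual_apply f a) \<le> K" and "0 \<le> K"
  shows "norm f \<le> K"
proof (rule norm_cdual_bound)
  fix x
  show "cmod (cdual_apply f x) \<le> K * norm x"
  proof (cases "cdual_apply f x = 0")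
    case True
    then show ?thesis using assms(2) by simp
  next
    case False
    then have x: "norm x > 0" by (auto simp: cdual_zero)
    define z where "z = cdual_apply f x"
    define c where "c = cnj z / (cmod z)"
    have z: "z \<noteq> 0" using False by (simp add: z_def)
    then have c: "cmod c = 1" by (simp add: c_def norm_divide)
    have "z * cnj z = complex_of_real (cmod z) * complex_of_real (cmod z)"
      using complex_norm_square[of z] by (simp add: power2_eq_square)
    then have "c * z = cmod z" using z by (simp add: c_def mult.commute[of _ z])
    then have cz: "cdual_apply f (c *\<^sub>C x) = cmod z" by (simp add: cdual_scaleC z_def)
    have "Re (cdual_apply f ((1 / norm x) *\<^sub>R c *\<^sub>C x)) \<le> K"
      using x c by (intro assms) (simp add: norm_scaleC)
    then have "cmod z / norm x \<le> K" by (simp add: cdual_scaleR cz)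
    then show ?thesis using x by (simp add: z_def field_simps)
  qed
qed (rule assms(2))

text \<open>A real part determines its functional by f a = u a - i u (i a); invariance of
  \<open>u\<close> under the involution makes f hermitian.\<close>

lemma cdual_from_real_part:
  fixes u :: "'a :: cstar_algebra \<Rightarrow> real"
  assumes add: "\<And>a b. u (a + b) = u a + u b" and scale: "\<And>r a. u (r *\<^sub>R a) = r * u a"
    and bound: "\<And>a. \<bar>u a\<bar> \<le> K * norm a" and star: "\<And>a. u (star a) = u a"
  shows "\<exists>f. (\<forall>a. Re (cdual_apply f a) = u a) \<and> dual_star f = f"
proof -
  define g where "g a = Complex (u a) (- u (\<i> *\<^sub>C a))" for a
  have neg: "u (- a) = - u a" for a using scale[of "-1" a] by simp
  have diff: "u (a - b) = u a - u b" for a b using add[of a "- b"] by (simp add: neg)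
  have "bounded_clinear g"
  proof (rule bounded_clinearI[where K = "2 * K"])
    show "g (a + b) = g a + g b" for a b
      by (simp add: g_def scaleC_add_right add complex_eq_iff)
    show "g (c *\<^sub>C a) = c * g a" for c a
    proof -
      have sc: "d *\<^sub>C a = Re d *\<^sub>R a + Im d *\<^sub>R \<i> *\<^sub>C a" for d a
        by (simp add: scaleC_scaleC mult.commute flip: scaleC_of_real scaleC_add_left complex_eq)
      have "u (c *\<^sub>C a) = Re c * u a + Im c * u (\<i> *\<^sub>C a)"
        by (subst sc) (simp add: add scale)
      moreover have "u (\<i> *\<^sub>C c *\<^sub>C a) = Re c * u (\<i> *\<^sub>C a) - Im c * u a"
        by (subst sc[of c]) (simp add: scaleC_add_right scaleC_scaleR scaleC_i_i add diff scale)
      ultimately show ?thesis by (simp add: g_def complex_eq_iff)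
    qed
    show "cmod (g a) \<le> 2 * K * norm a" for a
      using cmod_le[of "g a"] bound[of a] bound[of "\<i> *\<^sub>C a"] by (simp add: g_def norm_scaleC)
  qed
  then have app: "cdual_apply (CDual g) = g" by (simp add: CDual_inverse)
  show ?thesis
  proof (intro exI[of _ "CDual g"] conjI allI)
    show "Re (cdual_apply (CDual g) a) = u a" for a by (simp add: app g_def)
    have "u (\<i> *\<^sub>C star a) = - u (\<i> *\<^sub>C a)" for a
      using star[of "\<i> *\<^sub>C a"] neg[of "\<i> *\<^sub>C star a"] by (simp add: star_scaleC scaleC_minus_left)
    then show "dual_star (CDual g) = CDual g"
      by (intro cdual_eqI) (simp add: dual_star.rep_eq app g_def star complex_eq_iff)
  qed
qed

text \<open>
  Hahn-Banach on two copies of the unitization: the functional \<open>(a, - a) \<mapsto> Re (f a)\<close> is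
  dominated by \<open>\<parallel>f\<parallel>\<close> times the distance from the negative cone, because
  \<open>\<parallel>a\<parallel> \<le> max \<parallel>a + u\<parallel> \<parallel>v - a\<parallel>\<close> for self-adjoint \<open>a\<close> and positive \<open>u\<close>, \<open>v\<close>.
\<close>

theorem jordan_decomposition:
  fixes f :: "'a :: cstar_algebra cdual"
  assumes f: "dual_star f = f"
  obtains \<phi> \<psi> where "positive_functional \<phi>" "positive_functional \<psi>" "f = \<phi> - \<psi>"
    "norm \<phi> + norm \<psi> \<le> norm f"
proof -
  define K where "K = norm f"
  have K: "K \<ge> 0" by (simp add: K_def)
  define re where "re x = (1/2) *\<^sub>R (x + star x)" for x :: "'a unitization"
  have re: "star (re x) = re x" "norm (re x) \<le> norm x" "re (x + y) = re x + re y"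
    "re (r *\<^sub>R x) = r *\<^sub>R re x" "re (star x) = re x" for x y r
  proof -
    show "star (re x) = re x" "re (x + y) = re x + re y" "re (r *\<^sub>R x) = r *\<^sub>R re x" "re (star x) = re x"
      by (simp_all add: re_def star_simps algebra_simps)
    show "norm (re x) \<le> norm x"
      using norm_triangle_ineq[of x "star x"] by (simp add: re_def norm_star)
  qed
  have re_diff: "re (x - y) = re x - re y" for x y by (simp add: re_def star_simps algebra_simps)
  have re_sa: "re x = x" if "star x = x" for x using that by (simp add: re_def flip: scaleR_2)
  \<comment> \<open>The maximum norm is chosen because its dual norm is a sum, which yields the
    bound on the sum of the norms of \<phi> and \<psi>.\<close>
  define p :: "'a unitization \<times> 'a unitization \<Rightarrow> real" where "p z = K * max (norm (fst z)) (norm (snd z))" for z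
  have p: "sublinear p"
  proof (rule sublinearI)
    show "p (z + w) \<le> p z + p w" for z w
    proof -
      have "max (norm (fst (z + w))) (norm (snd (z + w)))
          \<le> max (norm (fst z)) (norm (snd z)) + max (norm (fst w)) (norm (snd w))"
        using norm_triangle_ineq[of "fst z" "fst w"] norm_triangle_ineq[of "snd z" "snd w"] by auto
      from mult_left_mono[OF this K] show ?thesis by (simp add: p_def distrib_left)
    qed
    show "p (r *\<^sub>R z) \<le> r * p z" if "r > 0" for r z
    proof -
      have "max (norm (fst (r *\<^sub>R z))) (norm (snd (r *\<^sub>R z))) = r * max (norm (fst z)) (norm (snd z))"
        using that by (simp add: max_mult_distrib_left)
      then show ?thesis by (simp only: p_def mult.left_commute)
    qed
  qed (simp add: p_def)
  have p_nonneg: "0 \<le> p z" for z using K by (simp add: p_def le_max_iff_disj)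
  define C where "C = {z :: 'a unitization \<times> 'a unitization. hpos (fst z) \<and> hpos (snd z)}"
  \<comment> \<open>With F = 0 the value q z is \<open>K\<close> times the distance from z to the
    negative cone, so a linear functional below \<open>q\<close> is positive on
    \<open>C\<close>.\<close>
  obtain q where q: "sublinear q" "\<And>x. q x \<le> p x" "\<And>x v. v \<in> C \<Longrightarrow> q x \<le> p (x + v) - 0"
      "\<And>c x. (\<And>v. v \<in> C \<Longrightarrow> c \<le> p (x + v) - 0) \<Longrightarrow> c \<le> q x"
    by (rule sublinear_convolution[OF p, of C "\<lambda>_. 0"])
      (auto simp: C_def hpos_add hpos_scaleR p_nonneg)
  \<comment> \<open>On the antidiagonal pair (a, - a) a functional of the form \<phi> x + \<psi> y
    takes the value (\<phi> - \<psi>) a.\<close>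
  define V where "V = range (\<lambda>a :: 'a. (unitize a, - unitize a))"
  have "linear (\<lambda>a :: 'a. (unitize a, - unitize a))"
    by (rule linearI) (simp_all add: unitize_simps)
  then have V: "subspace V" unfolding V_def by (rule linear_subspace_image) (rule subspace_UNIV)
  define F where "F z = Re (cdual_apply f (alg_part (fst z)))" for z :: "'a unitization \<times> 'a unitization"
  have FV: "F v \<le> q v" if "v \<in> V" for v
  proof (rule q(4))
    obtain a where v: "v = (unitize a, - unitize a)" using \<open>v \<in> V\<close> by (auto simp: V_def)
    fix w assume "w \<in> C"
    then have w: "hpos (fst w)" "hpos (snd w)" by (auto simp: C_def)
    define M where "M = max (norm (unitize a + fst w)) (norm (- unitize a + snd w))"
    \<comment> \<open>As \<open>f\<close> is hermitian, Re (f a) depends only on the self-adjoint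
      part of \<open>a\<close>, for which norm and order can be compared.\<close>
    define h where "h = (1/2) *\<^sub>R (a + star a)"
    have uh: "unitize h = re (unitize a)" by (simp add: h_def re_def unitize_simps)
    have "norm (unitize h) \<le> M"
    proof (rule norm_leI)
      have "re (unitize a + fst w) = unitize h + fst w" "re (- unitize a + snd w) = - unitize h + snd w"
        by (simp_all add: re re_diff re_sa hpos_selfadjoint w uh)
      moreover have "norm (re (unitize a + fst w)) \<le> M" "norm (re (- unitize a + snd w)) \<le> M"
        by (auto simp: M_def intro!: order_trans[OF re(2)])
      ultimately have "hpos (of_real M - (unitize h + fst w))" "hpos (of_real M - (- unitize h + snd w))"
        by (metis hpos_norm_minus re(1))+
      from hpos_add[OF this(1) w(1)] hpos_add[OF this(2) w(2)]
      show "hpos (of_real M - unitize h)" "hpos (of_real M + unitize h)"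
        by (simp_all add: algebra_simps)
    qed (simp add: M_def le_max_iff_disj)
    then have hM: "norm h \<le> M" by (simp add: norm_unitize)
    have "cdual_apply f (star a) = cnj (cdual_apply f a)"
      by (metis f dual_star.rep_eq complex_cnj_cnj)
    then have "F v = Re (cdual_apply f h)" by (simp add: F_def v h_def cdual_linear_simps)
    also have "\<dots> \<le> cmod (cdual_apply f h)" by (rule complex_Re_le_cmod)
    also have "\<dots> \<le> K * norm h" unfolding K_def by (rule norm_cdual_apply)
    also have "\<dots> \<le> K * M" using hM K by (rule mult_left_mono)
    finally show "F v \<le> p (v + w) - 0" by (simp add: p_def v M_def)
  qed
  obtain G where G: "linear G" "\<And>x. G x \<le> q x" "\<And>v. v \<in> V \<Longrightarrow> G v = F v"
    by (rule hahn_banach[OF q(1) V, of F]) (use FV in \<open>auto simp: F_def cdual_linear_simps\<close>)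
  have Gp: "G z \<le> p z" for z using G(2)[of z] q(2)[of z] by linarith
  have Gpos: "0 \<le> G z" if "z \<in> C" for z
  proof -
    have "G (- z) \<le> 0" using G(2)[of "- z"] q(3)[OF that, of "- z"] by (simp add: p_def)
    then show ?thesis by (simp add: linear_neg[OF G(1)])
  qed
  have Gsplit: "G (x, y) = G (x, 0) + G (0, y)" for x y
    using linear_add[OF G(1), of "(x, 0)" "(0, y)"] by simp
  define u v where "u a = G (re (unitize a), 0)" and "v a = G (0, re (unitize a))" for a
  have bnd: "u a + v b \<le> K * max (norm a) (norm b)" for a b
  proof -
    have "u a + v b \<le> p (re (unitize a), re (unitize b))"
      using Gp[of "(re (unitize a), re (unitize b))"] Gsplit[of "re (unitize a)" "re (unitize b)"]
      by (simp add: u_def v_def)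
    also have "\<dots> \<le> K * max (norm a) (norm b)"
      unfolding p_def using K re(2)[of "unitize a"] re(2)[of "unitize b"]
      by (intro mult_left_mono) (auto simp: norm_unitize)
    finally show ?thesis .
  qed
  have lin: "u (a + b) = u a + u b" "u (r *\<^sub>R a) = r * u a" "v (a + b) = v a + v b" "v (r *\<^sub>R a) = r * v a"
    for a b r
    using linear_add[OF G(1), of "(re (unitize a), 0)" "(re (unitize b), 0)"]
      linear_add[OF G(1), of "(0, re (unitize a))" "(0, re (unitize b))"]
      linear_scale[OF G(1), of r "(re (unitize a), 0)"] linear_scale[OF G(1), of r "(0, re (unitize a))"]
    by (simp_all add: u_def v_def unitize_simps re)
  have z: "u 0 = 0" "v 0 = 0" using lin(2)[of 0 0] lin(4)[of 0 0] by simp_all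
  have n: "u (- a) = - u a" "v (- a) = - v a" for a using lin(2)[of "-1" a] lin(4)[of "-1" a] by simp_all
  have "\<bar>u a\<bar> \<le> K * norm a" "\<bar>v a\<bar> \<le> K * norm a" for a
    using bnd[of a 0] bnd[of "- a" 0] bnd[of 0 a] bnd[of 0 "- a"] by (simp_all add: z n)
  note bounds = this
  have stars: "u (star a) = u a" "v (star a) = v a" for a
    by (simp_all add: u_def v_def unitize_simps re)
  obtain \<phi> where \<phi>: "\<And>a. Re (cdual_apply \<phi> a) = u a" "dual_star \<phi> = \<phi>"
    using cdual_from_real_part[OF lin(1,2) bounds(1) stars(1)] by blast
  obtain \<psi> where \<psi>: "\<And>a. Re (cdual_apply \<psi> a) = v a" "dual_star \<psi> = \<psi>"
    using cdual_from_real_part[OF lin(3,4) bounds(2) stars(2)] by blast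
  have real: "Im (cdual_apply g a) = 0" if "dual_star g = g" "star a = a" for g :: "'a cdual" and a
  proof -
    have "cdual_apply g a = cnj (cdual_apply g a)" using that by (metis dual_star.rep_eq)
    then show ?thesis by (simp add: complex_eq_iff)
  qed
  have "re (unitize (star a * a)) = star (unitize a) * unitize a" for a
    by (subst re_sa) (simp_all add: unitize_simps star_simps)
  then have "0 \<le> u (star a * a)" "0 \<le> v (star a * a)" for a
    unfolding u_def v_def by (auto intro!: Gpos simp: C_def hpos_star_mult_self)
  then have pos: "positive_functional \<phi>" "positive_functional \<psi>"
    unfolding positive_functional_def
    by (auto simp: complex_nonneg_Reals_iff \<phi> \<psi> real star_simps)
  have Re_eq: "Re (cdual_apply f a) = Re (cdual_apply (\<phi> - \<psi>) a)" for a
  proof -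
    have "u a - v a = G (re (unitize a), 0) + G (0, - re (unitize a))"
      using linear_neg[OF G(1), of "(0, re (unitize a))"] by (simp add: u_def v_def)
    also have "\<dots> = G (unitize ((1/2) *\<^sub>R (a + star a)), - unitize ((1/2) *\<^sub>R (a + star a)))"
      by (subst Gsplit[of "unitize _"]) (simp add: re_def unitize_simps)
    also have "\<dots> = Re (cdual_apply f ((1/2) *\<^sub>R (a + star a)))"
      by (subst G(3)) (auto simp: V_def F_def)
    also have "\<dots> = Re (cdual_apply f a)"
    proof -
      have "cdual_apply f (star a) = cnj (cdual_apply f a)"
        by (metis f dual_star.rep_eq complex_cnj_cnj)
      then show ?thesis by (simp add: cdual_linear_simps)
    qed
    finally show ?thesis by (simp add: cdual_rep_eq \<phi> \<psi>)
  qed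
  have "f = \<phi> - \<psi>"
  proof (rule cdual_eqI)
    fix a
    have "Re (\<i> * cdual_apply f a) = Re (\<i> * cdual_apply (\<phi> - \<psi>) a)"
      using Re_eq[of "\<i> *\<^sub>C a"] by (simp only: cdual_scaleC)
    with Re_eq[of a] show "cdual_apply f a = cdual_apply (\<phi> - \<psi>) a" by (simp add: complex_eq_iff)
  qed
  \<comment> \<open>On unit balls u a + v b <= K; the suprema over a and over b are taken one after
    the other.\<close>
  moreover have "norm \<psi> + norm \<phi> \<le> K"
  proof -
    have "norm \<phi> \<le> K - v b" if "norm b \<le> 1" for b
    proof (rule norm_cdual_leI)
      have le1: "u a + v b \<le> K" if "norm a \<le> 1" for a
      proof -
        have "K * max (norm a) (norm b) \<le> K * 1" using that \<open>norm b \<le> 1\<close> K by (intro mult_left_mono) auto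
        then show ?thesis using bnd[of a b] by simp
      qed
      show "0 \<le> K - v b" using le1[of 0] by (simp add: z)
      show "Re (cdual_apply \<phi> a) \<le> K - v b" if "norm a \<le> 1" for a using le1[OF that] by (simp add: \<phi>)
    qed
    then have le: "v b \<le> K - norm \<phi>" if "norm b \<le> 1" for b using that by fastforce
    have "norm \<psi> \<le> K - norm \<phi>"
      by (rule norm_cdual_leI) (use le le[of 0] in \<open>auto simp: \<psi> z\<close>)
    then show ?thesis by simp
  qed
  ultimately show ?thesis using pos that by (simp add: K_def add.commute)
qed

section \<open>Reduction of general functionals to positive ones\<close>

lemma dual_star_linear:
  "dual_star (f + g) = dual_star f + dual_star g" "dual_star (f - g) = dual_star f - dual_star g"
  "dual_star (c *\<^sub>C f) = cnj c *\<^sub>C dual_star f" "dual_star (dual_star f) = f"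
  by (rule cdual_eqI; simp add: dual_star.rep_eq cdual_rep_eq star_star)+

lemma cartesian_decomposition:
  obtains g h where "dual_star g = g" "dual_star h = h" "f = g + \<i> *\<^sub>C h" "norm g \<le> norm f"
proof (rule that)
  let ?g = "(1/2) *\<^sub>C (f + dual_star f)" and ?h = "(- \<i> / 2) *\<^sub>C (f - dual_star f)"
  show "dual_star ?g = ?g" by (simp add: dual_star_linear add.commute)
  show "dual_star ?h = ?h" by (rule cdual_eqI) (simp add: dual_star_linear cdual_rep_eq algebra_simps)
  show "f = ?g + \<i> *\<^sub>C ?h" by (rule cdual_eqI) (simp add: cdual_rep_eq field_simps)
  show "norm ?g \<le> norm f"
    using norm_triangle_ineq[of f "dual_star f"] norm_dual_star[of f] by (simp add: norm_scaleC)
qed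

text \<open>Each functional is a complex combination of four positive ones, so linear identities and
  limits can be checked on positive functionals.\<close>

lemma functional_induct [case_names positive add scaleC]:
  assumes "\<And>\<phi>. positive_functional \<phi> \<Longrightarrow> P \<phi>" and "\<And>f g. P f \<Longrightarrow> P g \<Longrightarrow> P (f + g)"
    and "\<And>c f. P f \<Longrightarrow> P (c *\<^sub>C f)"
  shows "P (f :: 'a :: cstar_algebra cdual)"
proof -
  have herm: "P g" if g: "dual_star g = g" for g :: "'a cdual"
  proof -
    obtain \<phi> \<psi> where d: "positive_functional \<phi>" "positive_functional \<psi>" "g = \<phi> - \<psi>"
      using jordan_decomposition[OF g] by blast
    then have "P (\<phi> + (- 1) *\<^sub>C \<psi>)" by (intro assms)
    then show ?thesis by (simp add: d scaleC_minus_one)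
  qed
  obtain g h where "dual_star g = g" "dual_star h = h" "f = g + \<i> *\<^sub>C h"
    by (rule cartesian_decomposition)
  then show ?thesis using herm assms(2,3) by blast
qed

lemma bidual_eqI:
  assumes "\<And>\<phi>. positive_functional \<phi> \<Longrightarrow> cdual_apply x \<phi> = cdual_apply y \<phi>"
  shows "x = (y :: 'a :: cstar_algebra bidual)"
proof (rule cdual_eqI)
  show "cdual_apply x f = cdual_apply y f" for f
    by (induction f rule: functional_induct) (simp_all add: assms cdual_add cdual_scaleC)
qed

section \<open>The Arens product on the bidual of a C*-algebra\<close>

text \<open>Discriminant argument along c = - s w: s = 1/B is optimal, and for B = 0 a large s shows
  that w = 0.\<close>

lemma quadratic_form_bound:
  fixes w :: complex
  assumes pos: "\<And>c. 0 \<le> d + 2 * Re (cnj c * w) + (cmod c)\<^sup>2 * B" and B: "0 \<le> B"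
  shows "(cmod w)\<^sup>2 \<le> d * B"
proof -
  have *: "0 \<le> d - 2 * s * (cmod w)\<^sup>2 + s\<^sup>2 * (cmod w)\<^sup>2 * B" for s :: real
  proof -
    have "Re (cnj (complex_of_real (- s) * w) * w) = - s * (cmod w)\<^sup>2"
      by (simp add: cmod_power2) (simp add: power2_eq_square algebra_simps)
    with pos[of "complex_of_real (- s) * w"] show ?thesis
      by (simp add: norm_mult power_mult_distrib)
  qed
  show ?thesis
  proof (cases "B = 0")
    case True
    show ?thesis
    proof (rule ccontr)
      assume "\<not> ?thesis"
      then have "(cmod w)\<^sup>2 > 0" using True by simp
      with *[of "(\<bar>d\<bar> + 1) / (cmod w)\<^sup>2"] show False by (simp add: True)
    qed
  next
    case False
    with B have B: "B > 0" by simp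
    have "2 * (1/B) * (cmod w)\<^sup>2 = 2 * ((cmod w)\<^sup>2 / B)" "(1/B)\<^sup>2 * (cmod w)\<^sup>2 * B = (cmod w)\<^sup>2 / B"
      using B by (simp_all add: power2_eq_square)
    with *[of "1/B"] have "(cmod w)\<^sup>2 / B \<le> d" by linarith
    then show ?thesis using B by (simp add: field_simps)
  qed
qed

text \<open>The square of the GNS seminorm; the GNS space itself is never formed.\<close>

definition seminorm_sq :: "'a :: cstar_algebra cdual \<Rightarrow> 'a \<Rightarrow> real"
  where "seminorm_sq \<phi> a = Re (cdual_apply \<phi> (star a * a))"

context
  fixes \<phi> :: "'a :: cstar_algebra cdual"
  assumes pos: "positive_functional \<phi>"
begin

lemma seminorm_sq_nonneg: "0 \<le> seminorm_sq \<phi> a"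
  using positive_functionalD[OF pos, of a] by (auto simp: seminorm_sq_def complex_nonneg_Reals_iff)

lemma cdual_apply_star_mult_self: "cdual_apply \<phi> (star a * a) = complex_of_real (seminorm_sq \<phi> a)"
  using positive_functionalD[OF pos, of a]
  by (simp add: seminorm_sq_def complex_nonneg_Reals_iff complex_eq_iff)

lemma seminorm_sq_le: "seminorm_sq \<phi> a \<le> norm \<phi> * (norm a)\<^sup>2"
proof -
  have "seminorm_sq \<phi> a \<le> cmod (cdual_apply \<phi> (star a * a))"
    unfolding seminorm_sq_def by (rule complex_Re_le_cmod)
  also have "\<dots> \<le> norm \<phi> * norm (star a * a)" by (rule norm_cdual_apply)
  finally show ?thesis by (simp add: norm_star_mult_self)
qed

lemma seminorm_sq_expand:
  "seminorm_sq \<phi> (a + c *\<^sub>C b) =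
    seminorm_sq \<phi> a + 2 * Re (cnj c * cdual_apply \<phi> (star b * a)) + (cmod c)\<^sup>2 * seminorm_sq \<phi> b"
proof -
  have "cdual_apply \<phi> (star (a + c *\<^sub>C b) * (a + c *\<^sub>C b)) =
      cdual_apply \<phi> (star a * a) + c * cdual_apply \<phi> (star a * b) + cnj c * cdual_apply \<phi> (star b * a)
      + (cnj c * c) * cdual_apply \<phi> (star b * b)"
    by (simp add: star_simps star_scaleC distrib_left distrib_right cdual_linear_simps
        scaleC_mult_left scaleC_mult_right)
  moreover have "Re (c * cdual_apply \<phi> (star a * b)) = Re (cnj c * cdual_apply \<phi> (star b * a))"
    by (simp add: positive_functional_swap[OF pos, of a b])
  moreover have "cnj c * c = complex_of_real ((cmod c)\<^sup>2)"
    by (simp add: complex_norm_square mult.commute del: of_real_power)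
  ultimately show ?thesis
    unfolding seminorm_sq_def by (simp del: of_real_power)
qed

lemma cauchy_schwarz:
  "(cmod (cdual_apply \<phi> (star b * a)))\<^sup>2 \<le> seminorm_sq \<phi> a * seminorm_sq \<phi> b"
  using seminorm_sq_nonneg[of "a + c *\<^sub>C b" for c] seminorm_sq_nonneg[of b]
  by (intro quadratic_form_bound) (simp_all add: seminorm_sq_expand)

lemma norm_dual_rmult_positive: "norm (dual_rmult \<phi> (star b)) \<le> sqrt (norm \<phi>) * sqrt (seminorm_sq \<phi> b)"
proof (rule norm_cdual_bound)
  fix a
  have "(cmod (cdual_apply \<phi> (star b * a)))\<^sup>2 \<le> seminorm_sq \<phi> a * seminorm_sq \<phi> b"
    by (rule cauchy_schwarz)
  also have "\<dots> \<le> (norm \<phi> * (norm a)\<^sup>2) * seminorm_sq \<phi> b"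
    by (intro mult_right_mono seminorm_sq_le seminorm_sq_nonneg)
  also have "\<dots> = (sqrt (norm \<phi>) * sqrt (seminorm_sq \<phi> b) * norm a)\<^sup>2"
    by (simp add: power_mult_distrib seminorm_sq_nonneg)
  finally show "cmod (cdual_apply (dual_rmult \<phi> (star b)) a) \<le> sqrt (norm \<phi>) * sqrt (seminorm_sq \<phi> b) * norm a"
    unfolding dual_rmult.rep_eq by (rule power2_le_imp_le) (simp add: seminorm_sq_nonneg)
qed (simp add: seminorm_sq_nonneg)

text \<open>
  In the GNS space of \<open>\<phi>\<close> the functional \<open>y \<cdot> \<phi>\<close> is bounded, hence represented by a vector; the
  element \<open>a\<close> approximates this vector. It nearly minimises
  \<open>J a = \<phi> (a\<^sup>* a) - 2 Re ((y \<cdot> \<phi>) (a\<^sup>*))\<close>.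
\<close>

lemma gns_approximation:
  fixes y :: "'a bidual"
  assumes e: "0 < e" "e \<le> 1"
  shows "\<exists>a. seminorm_sq \<phi> a \<le> 4 * (norm y)\<^sup>2 * norm \<phi> + 2 \<and>
    (\<forall>c. cmod (cdual_apply \<phi> (star c * a) - cdual_apply (bidual_lmult y \<phi>) (star c)) \<le> e * sqrt (seminorm_sq \<phi> c))"
proof -
  define G where "G = cdual_apply (bidual_lmult y \<phi>)"
  define N where "N = norm y * sqrt (norm \<phi>)"
  have N: "N \<ge> 0" by (simp add: N_def)
  have G: "cmod (G (star a)) \<le> N * sqrt (seminorm_sq \<phi> a)" for a
  proof -
    have "cmod (G (star a)) \<le> norm y * norm (dual_rmult \<phi> (star a))"
      unfolding G_def bidual_lmult.rep_eq by (rule norm_cdual_apply)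
    also have "\<dots> \<le> norm y * (sqrt (norm \<phi>) * sqrt (seminorm_sq \<phi> a))"
      by (intro mult_left_mono norm_dual_rmult_positive) simp
    finally show ?thesis by (simp add: N_def mult.assoc)
  qed
  define J where "J a = seminorm_sq \<phi> a - 2 * Re (G (star a))" for a
  have J: "J a \<ge> seminorm_sq \<phi> a - 2 * N * sqrt (seminorm_sq \<phi> a)" for a
    using complex_Re_le_cmod[of "G (star a)"] G[of a] by (simp add: J_def)
  have "J a \<ge> - N\<^sup>2" for a
  proof -
    have "0 \<le> (sqrt (seminorm_sq \<phi> a) - N)\<^sup>2" by simp
    also have "\<dots> = seminorm_sq \<phi> a - 2 * N * sqrt (seminorm_sq \<phi> a) + N\<^sup>2"
      by (simp add: power2_diff seminorm_sq_nonneg)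
    finally show ?thesis using J[of a] by linarith
  qed
  then have bdd: "bdd_below (range J)" by (intro bdd_belowI2)
  define m where "m = Inf (range J)"
  have m: "m \<le> J a" for a unfolding m_def by (rule cINF_lower[OF bdd]) simp
  have "m < m + e\<^sup>2" using e by simp
  \<comment> \<open>A minimiser would represent the functional exactly; within e^2 of the infimum
    the error is at most e times the seminorm.\<close>
  then obtain a where a: "J a < m + e\<^sup>2"
    unfolding m_def using cInf_lessD[of "range J" "m + e\<^sup>2"] by (auto simp: m_def)
  have "seminorm_sq \<phi> a \<le> 4 * (norm y)\<^sup>2 * norm \<phi> + 2"
  proof -
    have "J 0 = 0" by (simp add: J_def seminorm_sq_def G_def cdual_zero)
    then have "m \<le> 0" using m[of 0] by simp
    moreover have "e\<^sup>2 \<le> 1" using e by (simp add: power_le_one)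
    ultimately have 1: "seminorm_sq \<phi> a - 2 * N * sqrt (seminorm_sq \<phi> a) \<le> 1"
      using J[of a] a by linarith
    \<comment> \<open>Absorbs the cross term, so that the bound on \<open>a\<close> does not depend
      on \<open>e\<close>.\<close>
    have "0 \<le> (sqrt (seminorm_sq \<phi> a) - 2 * N)\<^sup>2" by simp
    also have "\<dots> = seminorm_sq \<phi> a - 4 * N * sqrt (seminorm_sq \<phi> a) + 4 * N\<^sup>2"
      by (simp add: power2_diff seminorm_sq_nonneg power_mult_distrib)
    finally have "seminorm_sq \<phi> a \<le> 4 * N\<^sup>2 + 2" using 1 by linarith
    then show ?thesis by (simp add: N_def power_mult_distrib)
  qed
  moreover have "cmod (cdual_apply \<phi> (star c * a) - G (star c)) \<le> e * sqrt (seminorm_sq \<phi> c)" for c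
  proof -
    \<comment> \<open>First variation of J at \<open>a\<close> in direction \<open>c\<close>: as a
      function of \<open>s\<close>, the change of J stays above - e^2.\<close>
    have "(cmod (cdual_apply \<phi> (star c * a) - G (star c)))\<^sup>2 \<le> e\<^sup>2 * seminorm_sq \<phi> c"
    proof (rule quadratic_form_bound)
      fix s
      have "J (a + s *\<^sub>C c) = J a + 2 * Re (cnj s * (cdual_apply \<phi> (star c * a) - G (star c)))
          + (cmod s)\<^sup>2 * seminorm_sq \<phi> c"
        unfolding J_def seminorm_sq_expand
        by (simp add: G_def star_simps star_scaleC cdual_add cdual_scaleC right_diff_distrib)
      then show "0 \<le> e\<^sup>2 + 2 * Re (cnj s * (cdual_apply \<phi> (star c * a) - G (star c)))
          + (cmod s)\<^sup>2 * seminorm_sq \<phi> c"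
        using m[of "a + s *\<^sub>C c"] a by linarith
    qed (rule seminorm_sq_nonneg)
    then have "(cmod (cdual_apply \<phi> (star c * a) - G (star c)))\<^sup>2 \<le> (e * sqrt (seminorm_sq \<phi> c))\<^sup>2"
      by (simp add: power_mult_distrib seminorm_sq_nonneg)
    then show ?thesis by (rule power2_le_imp_le) (use e in \<open>simp add: seminorm_sq_nonneg\<close>)
  qed
  ultimately show ?thesis unfolding G_def by blast
qed

lemma gns_approximation_norm:
  fixes y :: "'a bidual"
  assumes e: "0 \<le> e"
    and a: "\<And>c. cmod (cdual_apply \<phi> (star c * a) - cdual_apply (bidual_lmult y \<phi>) (star c)) \<le> e * sqrt (seminorm_sq \<phi> c)"
  shows "norm (dual_rmult \<phi> (star a) - dual_star (bidual_lmult y \<phi>)) \<le> e * sqrt (norm \<phi>)"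
proof (rule norm_cdual_bound)
  fix c
  have "cdual_apply \<phi> (star a * c) = cnj (cdual_apply \<phi> (star c * a))"
    by (rule positive_functional_swap[OF pos])
  then have "cdual_apply (dual_rmult \<phi> (star a) - dual_star (bidual_lmult y \<phi>)) c
      = cnj (cdual_apply \<phi> (star c * a) - cdual_apply (bidual_lmult y \<phi>) (star c))"
    by (simp add: cdual_rep_eq dual_rmult.rep_eq dual_star.rep_eq)
  then have "cmod (cdual_apply (dual_rmult \<phi> (star a) - dual_star (bidual_lmult y \<phi>)) c)
      \<le> e * sqrt (seminorm_sq \<phi> c)"
    using a[of c] by (metis complex_mod_cnj)
  also have "\<dots> \<le> e * sqrt (norm \<phi> * (norm c)\<^sup>2)"
    using e seminorm_sq_le by (intro mult_left_mono real_sqrt_le_mono)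
  finally show "cmod (cdual_apply (dual_rmult \<phi> (star a) - dual_star (bidual_lmult y \<phi>)) c)
      \<le> e * sqrt (norm \<phi>) * norm c"
    by (simp add: real_sqrt_mult mult.assoc)
qed (use e in simp)

text \<open>Arens regularity, tested on \<phi>: if a and b are GNS approximants of y and of the
  adjoint of x, both sides are within a multiple of e of \<phi> (b^* a). It makes the involution
  reverse the Arens product.\<close>

lemma bidual_lmult_swap:
  fixes x y :: "'a bidual"
  shows "cdual_apply x (bidual_lmult y \<phi>) = cdual_apply y (dual_star (bidual_lmult (bidual_star x) \<phi>))"
proof -
  let ?x = "bidual_star x"
  \<comment> \<open>Collects the coefficients of \<open>e\<close> in the four estimates 1 to 4
    below.\<close>
  define K where "K = (norm x + norm y) * sqrt (norm \<phi>) + sqrt (4 * (norm y)\<^sup>2 * norm \<phi> + 2)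
    + sqrt (4 * (norm ?x)\<^sup>2 * norm \<phi> + 2)"
  have K: "K > 0"
  proof -
    have "0 < sqrt (4 * (norm y)\<^sup>2 * norm \<phi> + 2)" by (simp add: add_nonneg_pos)
    moreover have "0 \<le> (norm x + norm y) * sqrt (norm \<phi>)" "0 \<le> sqrt (4 * (norm ?x)\<^sup>2 * norm \<phi> + 2)" by simp_all
    ultimately show ?thesis unfolding K_def by linarith
  qed
  define D where "D = cmod (cdual_apply x (bidual_lmult y \<phi>) - cdual_apply y (dual_star (bidual_lmult ?x \<phi>)))"
  have bound: "D \<le> e * K" if e: "0 < e" "e \<le> 1" for e
  proof -
    obtain a where a: "seminorm_sq \<phi> a \<le> 4 * (norm y)\<^sup>2 * norm \<phi> + 2"
      "\<And>c. cmod (cdual_apply \<phi> (star c * a) - cdual_apply (bidual_lmult y \<phi>) (star c)) \<le> e * sqrt (seminorm_sq \<phi> c)"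
      using gns_approximation[OF e, of y] by blast
    obtain b where b: "seminorm_sq \<phi> b \<le> 4 * (norm ?x)\<^sup>2 * norm \<phi> + 2"
      "\<And>c. cmod (cdual_apply \<phi> (star c * b) - cdual_apply (bidual_lmult ?x \<phi>) (star c)) \<le> e * sqrt (seminorm_sq \<phi> c)"
      using gns_approximation[OF e, of ?x] by blast
    let ?fa = "dual_rmult \<phi> (star a)" and ?fb = "dual_rmult \<phi> (star b)"
    have 1: "cmod (cdual_apply x (bidual_lmult y \<phi>) - cdual_apply x (dual_star ?fa)) \<le> norm x * (e * sqrt (norm \<phi>))"
    proof (rule cdual_apply_close)
      have "norm (dual_star (?fa - dual_star (bidual_lmult y \<phi>))) \<le> norm (?fa - dual_star (bidual_lmult y \<phi>))"
        by (rule norm_dual_star)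
      also have "\<dots> \<le> e * sqrt (norm \<phi>)" using e a by (intro gns_approximation_norm) auto
      finally show "norm (bidual_lmult y \<phi> - dual_star ?fa) \<le> e * sqrt (norm \<phi>)"
        by (simp add: dual_star_linear norm_minus_commute)
    qed
    have "cmod (cdual_apply (bidual_lmult ?x \<phi>) (star a) - cdual_apply \<phi> (star a * b)) \<le> e * sqrt (seminorm_sq \<phi> a)"
      using b(2)[of a] by (simp add: norm_minus_commute)
    moreover have "cdual_apply x (dual_star ?fa) = cnj (cdual_apply (bidual_lmult ?x \<phi>) (star a))"
      by (simp add: bidual_lmult.rep_eq bidual_star.rep_eq)
    moreover have "cdual_apply \<phi> (star b * a) = cnj (cdual_apply \<phi> (star a * b))"
      by (rule positive_functional_swap[OF pos])
    ultimately have 2: "cmod (cdual_apply x (dual_star ?fa) - cdual_apply \<phi> (star b * a)) \<le> e * sqrt (seminorm_sq \<phi> a)"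
      by (metis complex_cnj_diff complex_mod_cnj)
    have 3: "cmod (cdual_apply \<phi> (star b * a) - cdual_apply y ?fb) \<le> e * sqrt (seminorm_sq \<phi> b)"
      using a(2)[of b] by (simp add: bidual_lmult.rep_eq)
    have 4: "cmod (cdual_apply y ?fb - cdual_apply y (dual_star (bidual_lmult ?x \<phi>))) \<le> norm y * (e * sqrt (norm \<phi>))"
      using e b by (intro cdual_apply_close gns_approximation_norm) auto
    have "e * sqrt (seminorm_sq \<phi> a) \<le> e * sqrt (4 * (norm y)\<^sup>2 * norm \<phi> + 2)"
      "e * sqrt (seminorm_sq \<phi> b) \<le> e * sqrt (4 * (norm ?x)\<^sup>2 * norm \<phi> + 2)"
      using e a(1) b(1) by (intro mult_left_mono real_sqrt_le_mono; simp)+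
    moreover have "D \<le> cmod (cdual_apply x (bidual_lmult y \<phi>) - cdual_apply x (dual_star ?fa))
        + cmod (cdual_apply x (dual_star ?fa) - cdual_apply \<phi> (star b * a))
        + cmod (cdual_apply \<phi> (star b * a) - cdual_apply y ?fb)
        + cmod (cdual_apply y ?fb - cdual_apply y (dual_star (bidual_lmult ?x \<phi>)))"
      unfolding D_def by norm
    ultimately show ?thesis using 1 2 3 4 by (simp add: K_def distrib_left distrib_right algebra_simps)
  qed
  have "D \<le> 0"
  proof (rule ccontr)
    assume "\<not> D \<le> 0"
    then have D: "D > 0" by simp
    define e where "e = min 1 (D / (2 * K))"
    have "0 < e" "e \<le> 1" using D K by (simp_all add: e_def)
    from bound[OF this] have "D \<le> e * K" .
    also have "\<dots> \<le> D / (2 * K) * K" using K by (intro mult_right_mono) (auto simp: e_def)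
    also have "\<dots> = D / 2" using K by simp
    finally show False using D by simp
  qed
  then show ?thesis by (simp add: D_def)
qed

text \<open>With a the GNS approximant of z, the conjugate of the value is approximated by the
  nonnegative numbers \<phi> (a^* a), hence the value is real and nonnegative.\<close>

lemma positive_functional_bidual_star_mult_self:
  fixes z :: "'a bidual"
  shows "cdual_apply (bidual_star z \<odot> z) \<phi> \<in> \<real>\<^sub>\<ge>\<^sub>0"
proof -
  define t where "t = cdual_apply (bidual_star z \<odot> z) \<phi>"
  have t: "cnj t = cdual_apply z (dual_star (bidual_lmult z \<phi>))"
    by (simp add: t_def arens.rep_eq bidual_star.rep_eq)
  define K where "K = norm z * sqrt (norm \<phi>) + sqrt (4 * (norm z)\<^sup>2 * norm \<phi> + 2)"
  have K: "K > 0" unfolding K_def by (intro add_nonneg_pos) (simp_all add: add_nonneg_pos)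
  have "\<exists>r\<ge>0. cmod (cnj t - complex_of_real r) \<le> e * K" if e: "0 < e" "e \<le> 1" for e
  proof -
    obtain a where a: "seminorm_sq \<phi> a \<le> 4 * (norm z)\<^sup>2 * norm \<phi> + 2"
      "\<And>c. cmod (cdual_apply \<phi> (star c * a) - cdual_apply (bidual_lmult z \<phi>) (star c)) \<le> e * sqrt (seminorm_sq \<phi> c)"
      using gns_approximation[OF e, of z] by blast
    let ?fa = "dual_rmult \<phi> (star a)"
    have 1: "cmod (cdual_apply z ?fa - cdual_apply z (dual_star (bidual_lmult z \<phi>))) \<le> norm z * (e * sqrt (norm \<phi>))"
      using e a by (intro cdual_apply_close gns_approximation_norm) auto
    have 2: "cmod (cdual_apply \<phi> (star a * a) - cdual_apply z ?fa) \<le> e * sqrt (seminorm_sq \<phi> a)"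
      using a(2)[of a] by (simp add: bidual_lmult.rep_eq)
    have 3: "e * sqrt (seminorm_sq \<phi> a) \<le> e * sqrt (4 * (norm z)\<^sup>2 * norm \<phi> + 2)"
      using e a(1) by (intro mult_left_mono real_sqrt_le_mono) auto
    have "cmod (cnj t - cdual_apply \<phi> (star a * a)) \<le>
        cmod (cdual_apply \<phi> (star a * a) - cdual_apply z ?fa)
        + cmod (cdual_apply z ?fa - cdual_apply z (dual_star (bidual_lmult z \<phi>)))"
      unfolding t by norm
    with 1 2 3 have "cmod (cnj t - complex_of_real (seminorm_sq \<phi> a)) \<le> e * K"
      by (simp add: K_def cdual_apply_star_mult_self algebra_simps)
    then show ?thesis using seminorm_sq_nonneg by blast
  qed
  note approx = this
  have e_bounds: "\<bar>Im t\<bar> \<le> e * K \<and> - (e * K) \<le> Re t" if e: "0 < e" "e \<le> 1" for e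
  proof -
    obtain r where "r \<ge> 0" "cmod (cnj t - complex_of_real r) \<le> e * K" using approx[OF e] by blast
    then show ?thesis
      using abs_Im_le_cmod[of "cnj t - complex_of_real r"] abs_Re_le_cmod[of "cnj t - complex_of_real r"] by simp
  qed
  have small: "v \<le> 0" if "\<And>e. 0 < e \<Longrightarrow> e \<le> 1 \<Longrightarrow> v \<le> e * K" for v
  proof (rule ccontr)
    assume "\<not> v \<le> 0"
    then have v: "v > 0" by simp
    have "v \<le> min 1 (v / (2 * K)) * K" using v K by (intro that) simp_all
    also have "\<dots> \<le> v / (2 * K) * K" using K by (intro mult_right_mono) auto
    also have "\<dots> = v / 2" using K by simp
    finally show False using v by simp
  qed
  have "\<bar>Im t\<bar> \<le> 0" "- Re t \<le> 0" using e_bounds by (intro small; fastforce)+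
  then show ?thesis by (simp add: complex_nonneg_Reals_iff flip: t_def)
qed

end

section \<open>The bidual as an involutive Banach algebra\<close>

lemma dual_rmult_rmult: "dual_rmult (dual_rmult f a) b = dual_rmult f (a * b)"
  by (rule cdual_eqI) (simp add: dual_rmult.rep_eq mult.assoc)

lemma bidual_lmult_arens: "bidual_lmult (x \<odot> y) f = bidual_lmult x (bidual_lmult y f)"
proof (rule cdual_eqI)
  fix a
  have "dual_rmult (bidual_lmult y f) a = bidual_lmult y (dual_rmult f a)"
    by (rule cdual_eqI) (simp add: dual_rmult.rep_eq bidual_lmult.rep_eq dual_rmult_rmult)
  then show "cdual_apply (bidual_lmult (x \<odot> y) f) a = cdual_apply (bidual_lmult x (bidual_lmult y f)) a"
    by (simp add: bidual_lmult.rep_eq arens.rep_eq)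
qed

lemma arens_assoc: "(x \<odot> y) \<odot> z = x \<odot> (y \<odot> z)"
  by (rule cdual_eqI) (simp add: arens.rep_eq bidual_lmult_arens)

lemma bidual_lmult_linear:
  "bidual_lmult (x + y) f = bidual_lmult x f + bidual_lmult y f"
  "bidual_lmult (c *\<^sub>C x) f = c *\<^sub>C bidual_lmult x f"
  by (rule cdual_eqI; simp add: bidual_lmult.rep_eq)+

lemma arens_add: "(x + y) \<odot> z = x \<odot> z + y \<odot> z" "x \<odot> (y + z) = x \<odot> y + x \<odot> z"
  by (rule cdual_eqI; simp add: arens.rep_eq bidual_lmult_linear cdual_add)+

lemma arens_scaleC: "(c *\<^sub>C x) \<odot> y = c *\<^sub>C (x \<odot> y)" "x \<odot> (c *\<^sub>C y) = c *\<^sub>C (x \<odot> y)"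
  by (rule cdual_eqI; simp add: arens.rep_eq bidual_lmult_linear cdual_scaleC)+

lemma norm_arens: "norm (x \<odot> y) \<le> norm x * norm y"
proof (rule norm_cdual_bound)
  fix f
  have "cmod (cdual_apply (x \<odot> y) f) \<le> norm x * norm (bidual_lmult y f)"
    unfolding arens.rep_eq by (rule norm_cdual_apply)
  also have "\<dots> \<le> norm x * (norm y * norm f)" by (intro mult_left_mono norm_bidual_lmult) simp
  finally show "cmod (cdual_apply (x \<odot> y) f) \<le> norm x * norm y * norm f" by (simp add: mult.assoc)
qed simp

lemma bounded_bilinear_arens: "bounded_bilinear (\<odot>)"
proof
  show "(r *\<^sub>R x) \<odot> y = r *\<^sub>R (x \<odot> y)" "x \<odot> (r *\<^sub>R y) = r *\<^sub>R (x \<odot> y)" for r and x y :: "'a bidual"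
    by (simp_all add: arens_scaleC flip: scaleC_of_real)
  show "\<exists>K. \<forall>x y :: 'a bidual. norm (x \<odot> y) \<le> norm x * norm y * K"
    by (auto intro!: exI[of _ 1] norm_arens)
qed (simp_all add: arens_add)

interpretation arens: bounded_bilinear "(\<odot>)"
  by (rule bounded_bilinear_arens)

lemma bidual_star_arens: "bidual_star (x \<odot> y) = bidual_star y \<odot> bidual_star x"
proof (rule bidual_eqI)
  fix \<phi> :: "'a cdual"
  assume \<phi>: "positive_functional \<phi>"
  show "cdual_apply (bidual_star (x \<odot> y)) \<phi> = cdual_apply (bidual_star y \<odot> bidual_star x) \<phi>"
    by (simp add: bidual_star.rep_eq arens.rep_eq dual_star_positive_functional[OF \<phi>] bidual_lmult_swap[OF \<phi>])
qed

lemma bidual_star_star: "bidual_star (bidual_star x) = x"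
  by (rule cdual_eqI) (simp add: bidual_star.rep_eq dual_star_linear)

lemma bidual_star_add: "bidual_star (x + y) = bidual_star x + bidual_star y"
  by (rule cdual_eqI) (simp add: bidual_star.rep_eq)

lemma bidual_star_diff: "bidual_star (x - y) = bidual_star x - bidual_star y"
  by (rule cdual_eqI) (simp add: bidual_star.rep_eq cdual_rep_eq)

lemma bidual_star_minus: "bidual_star (- x) = - bidual_star x"
  by (rule cdual_eqI) (simp add: bidual_star.rep_eq cdual_rep_eq)

lemma bidual_star_scaleC: "bidual_star (c *\<^sub>C x) = cnj c *\<^sub>C bidual_star x"
  by (rule cdual_eqI) (simp add: bidual_star.rep_eq)

lemma bidual_star_scaleR: "bidual_star (r *\<^sub>R x) = r *\<^sub>R bidual_star x"
  by (rule cdual_eqI) (simp add: bidual_star.rep_eq cdual_rep_eq)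

lemma norm_bidual_star: "norm (bidual_star x) = norm x"
proof -
  have le: "norm (bidual_star y) \<le> norm y" for y :: "'a bidual"
  proof (rule norm_cdual_bound)
    fix f
    have "cmod (cdual_apply (bidual_star y) f) \<le> norm y * norm (dual_star f)"
      by (simp add: bidual_star.rep_eq norm_cdual_apply)
    also have "\<dots> \<le> norm y * norm f" by (intro mult_left_mono norm_dual_star) simp
    finally show "cmod (cdual_apply (bidual_star y) f) \<le> norm y * norm f" .
  qed simp
  show ?thesis using le[of x] le[of "bidual_star x"] by (simp add: bidual_star_star)
qed

lemma bounded_linear_bidual_star: "bounded_linear bidual_star"
  by (rule bounded_linear_intro[where K = 1])
    (auto simp: bidual_star_add bidual_star_scaleR norm_bidual_star)

lemmas bidual_star_simps = bidual_star_star bidual_star_add bidual_star_diff bidual_star_minus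
  bidual_star_scaleR bidual_star_arens

lemmas arens_simps = arens_assoc arens.add_left arens.add_right arens.diff_left arens.diff_right
  arens.minus_left arens.minus_right arens.scaleR_left arens.scaleR_right

text \<open>Transfer from bounded real-linear operators; the limit stays complex linear.
  \<open>sqrt_iteration\<close> asks for this completeness when roots are taken in the
  bidual.\<close>

instance cdual :: (complex_normed_vector) banach
proof
  fix X :: "nat \<Rightarrow> 'a cdual"
  assume X: "Cauchy X"
  have bl: "blinfun_apply (Blinfun (cdual_apply f)) = cdual_apply f" for f :: "'a cdual"
    by (intro bounded_linear_Blinfun_apply cdual_bounded_linear)
  have norm_eq: "norm (Blinfun (cdual_apply f)) = norm f" for f :: "'a cdual"
    by (simp add: norm_blinfun.rep_eq bl norm_cdual.rep_eq)
  have diff: "Blinfun (cdual_apply f) - Blinfun (cdual_apply g) = Blinfun (cdual_apply (f - g))" for f g :: "'a cdual"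
    by (rule blinfun_eqI) (simp only: blinfun.diff_left bl, simp only: minus_cdual.rep_eq)
  have "Cauchy (\<lambda>n. Blinfun (cdual_apply (X n)))"
    using X unfolding Cauchy_def dist_norm diff norm_eq .
  then obtain L where L: "(\<lambda>n. Blinfun (cdual_apply (X n))) \<longlonglongrightarrow> L"
    by (auto simp: Cauchy_convergent_iff convergent_def)
  have pt: "(\<lambda>n. cdual_apply (X n) a) \<longlonglongrightarrow> blinfun_apply L a" for a
    using blinfun.tendsto[OF L tendsto_const[of a]] by (simp add: bl)
  have "blinfun_apply L (c *\<^sub>C a) = c * blinfun_apply L a" for c a
  proof (rule LIMSEQ_unique[OF pt])
    show "(\<lambda>n. cdual_apply (X n) (c *\<^sub>C a)) \<longlonglongrightarrow> c * blinfun_apply L a"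
      unfolding cdual_scaleC by (intro tendsto_mult_left pt)
  qed
  then have "bounded_clinear (blinfun_apply L)"
    by (simp add: bounded_clinear_def blinfun.bounded_linear_right)
  then have app: "cdual_apply (CDual (blinfun_apply L)) = blinfun_apply L" by (simp add: CDual_inverse)
  define F where "F = CDual (blinfun_apply L)"
  have LC: "Blinfun (cdual_apply F) = L" unfolding F_def app by (rule blinfun_apply_inverse)
  have "norm (Blinfun (cdual_apply (X n)) - L) = norm (X n - F)" for n
    using diff[of "X n" F] norm_eq[of "X n - F"] unfolding LC by simp
  moreover have "(\<lambda>n. norm (Blinfun (cdual_apply (X n)) - L)) \<longlonglongrightarrow> 0"
    by (intro tendsto_norm_zero LIM_zero L)
  ultimately have "(\<lambda>n. norm (X n - F)) \<longlonglongrightarrow> 0" by simp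
  then have "(\<lambda>n. X n - F) \<longlonglongrightarrow> 0" by (rule tendsto_norm_zero_cancel)
  then have "X \<longlonglongrightarrow> F" by (rule LIM_zero_cancel)
  then show "convergent X" by (auto simp: convergent_def)
qed

section \<open>Limits of directed sets\<close>

definition cstar_directed :: "'a :: cstar_algebra set \<Rightarrow> bool"
  where "cstar_directed S \<longleftrightarrow> S \<noteq> {} \<and> bounded S \<and> (\<forall>a\<in>S. selfadjoint a) \<and>
    (\<forall>a\<in>S. \<forall>b\<in>S. \<exists>c\<in>S. cstar_le a c \<and> cstar_le b c)"

definition order_on :: "'a :: cstar_algebra set \<Rightarrow> ('a \<times> 'a) set"
  where "order_on S = {(a, b). a \<in> S \<and> b \<in> S \<and> cstar_le a b}"

text \<open>Convergence is tested on positive functionals only, where along an upward directed set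
  it is a supremum; \<open>increases_to_tendsto\<close> recovers all functionals.\<close>

definition increases_to :: "'a :: cstar_algebra set \<Rightarrow> 'a bidual \<Rightarrow> bool"
  where "increases_to S x \<longleftrightarrow> cstar_directed S \<and> bidual_sa x \<and>
    (\<forall>\<phi>. positive_functional \<phi> \<longrightarrow>
      (\<forall>a\<in>S. Re (cdual_apply \<phi> a) \<le> Re (cdual_apply x \<phi>)) \<and>
      (\<forall>e>0. \<exists>a\<in>S. Re (cdual_apply x \<phi>) < Re (cdual_apply \<phi> a) + e))"

lemma increases_toD:
  assumes "increases_to S x"
  shows "cstar_directed S" "bidual_sa x"
    "positive_functional \<phi> \<Longrightarrow> a \<in> S \<Longrightarrow> Re (cdual_apply \<phi> a) \<le> Re (cdual_apply x \<phi>)"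
    "positive_functional \<phi> \<Longrightarrow> 0 < e \<Longrightarrow> \<exists>a\<in>S. Re (cdual_apply x \<phi>) < Re (cdual_apply \<phi> a) + e"
  using assms unfolding increases_to_def by blast+

lemma eventually_tail_filter:
  assumes "directed_index I r"
  shows "eventually P (tail_filter I r) \<longleftrightarrow> (\<exists>i\<in>I. \<forall>j. (i, j) \<in> r \<longrightarrow> P j)"
proof -
  have r: "I \<noteq> {}" "trans r" and d: "\<And>i j. i \<in> I \<Longrightarrow> j \<in> I \<Longrightarrow> \<exists>k\<in>I. (i, k) \<in> r \<and> (j, k) \<in> r"
    using assms by (auto simp: directed_index_def preorder_on_def)
  have "\<exists>x\<in>I. principal {j. (x, j) \<in> r} \<le> inf (principal {j. (a, j) \<in> r}) (principal {j. (b, j) \<in> r})"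
    if "a \<in> I" "b \<in> I" for a b
    using d[OF that] transD[OF r(2)] by (auto simp: Bex_def)
  then show ?thesis
    unfolding tail_filter_def by (subst eventually_INF_base[OF r(1)]) (auto simp: eventually_principal)
qed

lemma tail_filter_nontrivial: "directed_index I r \<Longrightarrow> tail_filter I r \<noteq> bot"
  unfolding trivial_limit_def by (subst eventually_tail_filter)
    (auto simp: directed_index_def preorder_on_def refl_on_def)

lemma directed_index_order_on: "cstar_directed S \<Longrightarrow> directed_index S (order_on S)"
  unfolding directed_index_def cstar_directed_def preorder_on_def
  by (auto simp: order_on_def refl_on_def trans_def cstar_le_refl intro: cstar_le_trans)

lemma Im_positive_functional: "positive_functional \<phi> \<Longrightarrow> selfadjoint a \<Longrightarrow> Im (cdual_apply \<phi> a) = 0"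
  using positive_functional_star[of \<phi> a] by (simp add: selfadjoint_def complex_eq_iff)

lemma Im_bidual_sa: "positive_functional \<phi> \<Longrightarrow> bidual_sa x \<Longrightarrow> Im (cdual_apply x \<phi>) = 0"
proof -
  assume "positive_functional \<phi>" "bidual_sa x"
  then have "cdual_apply x \<phi> = cnj (cdual_apply x \<phi>)"
    by (metis bidual_sa_def bidual_star.rep_eq dual_star_positive_functional)
  then show ?thesis by (simp add: complex_eq_iff)
qed

lemma positive_functional_mono:
  "positive_functional \<phi> \<Longrightarrow> cstar_le a b \<Longrightarrow> Re (cdual_apply \<phi> a) \<le> Re (cdual_apply \<phi> b)"
  using positive_functional_cpos[of \<phi> "b - a"]
  by (simp add: cstar_le_iff cdual_diff complex_nonneg_Reals_iff)

lemma increases_to_tendsto: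
  assumes "increases_to S x"
  shows "((\<lambda>a. cdual_apply f a) \<longlongrightarrow> cdual_apply x f) (tail_filter S (order_on S))"
proof (induction f rule: functional_induct)
  case (positive \<phi>)
  have S: "cstar_directed S" and x: "bidual_sa x" using assms by (auto simp: increases_to_def)
  show ?case
  proof (rule tendstoI)
    fix e :: real assume "e > 0"
    then obtain a where a: "a \<in> S" "Re (cdual_apply x \<phi>) < Re (cdual_apply \<phi> a) + e"
      using increases_toD(4)[OF assms positive] by blast
    have "dist (cdual_apply \<phi> b) (cdual_apply x \<phi>) < e" if "b \<in> S" "cstar_le a b" for b
    proof -
      have "Re (cdual_apply \<phi> b) \<le> Re (cdual_apply x \<phi>)"
        by (rule increases_toD(3)[OF assms positive that(1)])
      moreover have "Re (cdual_apply \<phi> a) \<le> Re (cdual_apply \<phi> b)"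
        using positive that(2) by (rule positive_functional_mono)
      moreover have "Im (cdual_apply \<phi> b) = 0" "Im (cdual_apply x \<phi>) = 0"
        using Im_positive_functional[OF positive] Im_bidual_sa[OF positive x] S that(1)
        by (auto simp: cstar_directed_def)
      ultimately show ?thesis using a(2) by (simp add: dist_norm cmod_eq_Re)
    qed
    then show "\<forall>\<^sub>F b in tail_filter S (order_on S). dist (cdual_apply \<phi> b) (cdual_apply x \<phi>) < e"
      using a(1) by (subst eventually_tail_filter[OF directed_index_order_on[OF S]])
        (auto simp: order_on_def)
  qed
qed (auto simp: cdual_add cdual_scaleC intro: tendsto_add tendsto_mult_left)

text \<open>An increasing net and its range have the same limit, so directed sets indexed by
  themselves can replace nets.\<close>

lemma increases_to_image_net:
  fixes x :: "'a :: cstar_algebra bidual"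
  assumes net: "bounded_increasing_sa_net I r u"
    and lim: "\<forall>f. ((\<lambda>i. cdual_apply f (u i)) \<longlongrightarrow> cdual_apply x f) (tail_filter I r)"
  shows "increases_to (u ` I) x"
proof -
  have dir: "directed_index I r" and sa: "\<And>i. i \<in> I \<Longrightarrow> selfadjoint (u i)"
    and mono: "\<And>i j. (i, j) \<in> r \<Longrightarrow> cstar_le (u i) (u j)" and bdd: "bounded (u ` I)"
    using net by (auto simp: bounded_increasing_sa_net_def)
  have rI: "i \<in> I \<and> j \<in> I" if "(i, j) \<in> r" for i j
    using dir that by (auto simp: directed_index_def preorder_on_def)
  define F where "F = tail_filter I r"
  have F: "F \<noteq> bot" unfolding F_def by (rule tail_filter_nontrivial[OF dir])
  have evF: "eventually P F \<longleftrightarrow> (\<exists>i\<in>I. \<forall>j. (i, j) \<in> r \<longrightarrow> P j)" for P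
    unfolding F_def by (rule eventually_tail_filter[OF dir])
  obtain i0 where i0: "i0 \<in> I" using dir by (auto simp: directed_index_def)
  have evI: "\<forall>\<^sub>F i in F. i \<in> I" unfolding evF using i0 rI by blast
  have lim: "((\<lambda>i. cdual_apply f (u i)) \<longlongrightarrow> cdual_apply x f) F" for f
    using lim by (simp add: F_def)
  show ?thesis
    unfolding increases_to_def
  proof (intro conjI allI impI ballI)
    show "cstar_directed (u ` I)"
      unfolding cstar_directed_def
    proof (intro conjI ballI)
      fix a b assume "a \<in> u ` I" "b \<in> u ` I"
      then obtain i j where ij: "i \<in> I" "j \<in> I" "a = u i" "b = u j" by auto
      then obtain k where "k \<in> I" "(i, k) \<in> r" "(j, k) \<in> r" using dir by (auto simp: directed_index_def)
      then show "\<exists>c\<in>u ` I. cstar_le a c \<and> cstar_le b c" using ij mono by blast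
    qed (use bdd sa i0 in auto)
    show "bidual_sa x"
      unfolding bidual_sa_def
    proof (rule cdual_eqI)
      fix f
      have "((\<lambda>i. cnj (cdual_apply (dual_star f) (u i))) \<longlongrightarrow> cnj (cdual_apply x (dual_star f))) F"
        by (intro tendsto_cnj lim)
      moreover have "\<forall>\<^sub>F i in F. cnj (cdual_apply (dual_star f) (u i)) = cdual_apply f (u i)"
        using evI sa by (auto elim!: eventually_mono simp: dual_star.rep_eq selfadjoint_def)
      ultimately have "((\<lambda>i. cdual_apply f (u i)) \<longlongrightarrow> cnj (cdual_apply x (dual_star f))) F"
        by (rule Lim_transform_eventually)
      then show "cdual_apply (bidual_star x) f = cdual_apply x f"
        using tendsto_unique[OF F lim] by (simp add: bidual_star.rep_eq)
    qed
    fix \<phi> :: "'a cdual" assume \<phi>: "positive_functional \<phi>"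
    show "Re (cdual_apply \<phi> a) \<le> Re (cdual_apply x \<phi>)" if "a \<in> u ` I" for a
    proof (rule tendsto_lowerbound[OF tendsto_Re[OF lim] _ F])
      obtain i where "i \<in> I" "a = u i" using \<open>a \<in> u ` I\<close> by auto
      then show "\<forall>\<^sub>F j in F. Re (cdual_apply \<phi> a) \<le> Re (cdual_apply \<phi> (u j))"
        unfolding evF using positive_functional_mono[OF \<phi>] mono by blast
    qed
    fix e :: real assume e: "e > 0"
    have "\<forall>\<^sub>F i in F. i \<in> I \<and> dist (Re (cdual_apply \<phi> (u i))) (Re (cdual_apply x \<phi>)) < e"
      using evI tendstoD[OF tendsto_Re[OF lim] e] by (rule eventually_conj)
    then obtain i where "i \<in> I" "dist (Re (cdual_apply \<phi> (u i))) (Re (cdual_apply x \<phi>)) < e"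
      using F eventually_happens by blast
    then show "\<exists>a\<in>u ` I. Re (cdual_apply x \<phi>) < Re (cdual_apply \<phi> a) + e"
      by (auto simp: dist_real_def intro!: bexI[of _ i])
  qed
qed

lemma bounded_increasing_sa_net_order_on:
  "cstar_directed S \<Longrightarrow> bounded_increasing_sa_net S (order_on S) (\<lambda>a. a)"
  using directed_index_order_on[of S]
  by (auto simp: bounded_increasing_sa_net_def cstar_directed_def order_on_def)

text \<open>On a positive functional the values increase and are bounded. By linearity the limit
  exists on every functional, and it is bounded in the functional, hence an element of the
  bidual.\<close>

lemma increases_to_exists:
  fixes S :: "'a :: cstar_algebra set"
  assumes S: "cstar_directed S"
  shows "\<exists>x. increases_to S x"
proof -
  define F where "F = tail_filter S (order_on S)"
  note dir = directed_index_order_on[OF S]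
  have F: "F \<noteq> bot" unfolding F_def by (rule tail_filter_nontrivial[OF dir])
  have evF: "eventually P F \<longleftrightarrow> (\<exists>a\<in>S. \<forall>b\<in>S. cstar_le a b \<longrightarrow> P b)" for P
    unfolding F_def by (subst eventually_tail_filter[OF dir]) (auto simp: order_on_def)
  have evS: "\<forall>\<^sub>F b in F. b \<in> S" using S by (auto simp: evF cstar_directed_def)
  obtain K where K: "\<And>a. a \<in> S \<Longrightarrow> norm a \<le> K" using S by (auto simp: cstar_directed_def bounded_iff)
  have conv: "\<exists>l. (cdual_apply f \<longlongrightarrow> l) F" for f :: "'a cdual"
  proof (induction f rule: functional_induct)
    case (positive \<phi>)
    have bdd: "bdd_above ((\<lambda>a. Re (cdual_apply \<phi> a)) ` S)"
    proof (rule bdd_aboveI2)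
      fix a assume "a \<in> S"
      have "Re (cdual_apply \<phi> a) \<le> norm \<phi> * norm a"
        using complex_Re_le_cmod norm_cdual_apply by (rule order_trans)
      also have "\<dots> \<le> norm \<phi> * K" using K[OF \<open>a \<in> S\<close>] by (intro mult_left_mono) auto
      finally show "Re (cdual_apply \<phi> a) \<le> norm \<phi> * K" .
    qed
    define l where "l = (SUP a\<in>S. Re (cdual_apply \<phi> a))"
    have "(cdual_apply \<phi> \<longlongrightarrow> complex_of_real l) F"
    proof (rule tendstoI)
      fix e :: real assume "e > 0"
      then have "l - e < l" by simp
      then obtain a where a: "a \<in> S" "l - e < Re (cdual_apply \<phi> a)"
        unfolding l_def using S by (subst (asm) less_cSUP_iff[OF _ bdd]) (auto simp: cstar_directed_def)
      have "dist (cdual_apply \<phi> b) (complex_of_real l) < e" if "b \<in> S" "cstar_le a b" for b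
      proof -
        have "Re (cdual_apply \<phi> b) \<le> l" unfolding l_def by (rule cSUP_upper[OF that(1) bdd])
        moreover have "Re (cdual_apply \<phi> a) \<le> Re (cdual_apply \<phi> b)"
          using positive that(2) by (rule positive_functional_mono)
        moreover have "Im (cdual_apply \<phi> b) = 0"
          using Im_positive_functional[OF positive] S that(1) by (auto simp: cstar_directed_def)
        ultimately show ?thesis using a(2) by (simp add: dist_norm cmod_eq_Re)
      qed
      then show "\<forall>\<^sub>F b in F. dist (cdual_apply \<phi> b) (complex_of_real l) < e" using a(1) by (auto simp: evF)
    qed
    then show ?case by blast
  next
    case (add f g)
    then show ?case by (auto simp: plus_cdual.rep_eq intro: tendsto_add)
  next
    case (scaleC c f)
    then show ?case by (auto simp: scaleC_cdual.rep_eq intro: tendsto_mult_left)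
  qed
  define g where "g f = Lim F (cdual_apply f)" for f :: "'a cdual"
  have g: "(cdual_apply f \<longlongrightarrow> g f) F" for f
    using conv[of f] tendsto_Lim[OF F] unfolding g_def by blast
  have bound: "cmod (g f) \<le> K * norm f" for f
  proof (rule tendsto_upperbound[OF tendsto_norm[OF g] _ F])
    have "cmod (cdual_apply f a) \<le> K * norm f" if "a \<in> S" for a
      using norm_cdual_apply[of f a] mult_left_mono[OF K[OF that], of "norm f"] by (simp add: mult.commute)
    then show "\<forall>\<^sub>F a in F. cmod (cdual_apply f a) \<le> K * norm f"
      using evS by (rule eventually_mono[rotated])
  qed
  have "bounded_clinear g"
  proof (rule bounded_clinearI[OF _ _ bound])
    show "g (f + h) = g f + g h" for f h
      using tendsto_unique[OF F g] tendsto_add[OF g g] by (simp add: plus_cdual.rep_eq)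
    show "g (c *\<^sub>C f) = c * g f" for c f
      using tendsto_unique[OF F g] tendsto_mult_left[OF g] by (simp add: scaleC_cdual.rep_eq)
  qed
  then have app: "cdual_apply (CDual g) = g" by (simp add: CDual_inverse)
  have "increases_to ((\<lambda>a. a) ` S) (CDual g)"
    by (rule increases_to_image_net[OF bounded_increasing_sa_net_order_on[OF S]]) (use g in \<open>simp add: app F_def\<close>)
  then show ?thesis by auto
qed

lemma norm_increases_to:
  assumes S: "increases_to S x" and K: "\<And>a. a \<in> S \<Longrightarrow> norm a \<le> K"
  shows "norm x \<le> K"
proof -
  have d: "cstar_directed S" using S by (simp add: increases_to_def)
  note dir = directed_index_order_on[OF d]
  show ?thesis
  proof (rule norm_cdual_bound)
    obtain a where "a \<in> S" using d by (auto simp: cstar_directed_def)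
    then show "0 \<le> K" using K norm_ge_zero order_trans by blast
    fix f
    have "cmod (cdual_apply f a) \<le> K * norm f" if "a \<in> S" for a
      using norm_cdual_apply[of f a] mult_left_mono[OF K[OF that], of "norm f"] by (simp add: mult.commute)
    then have "\<forall>\<^sub>F a in tail_filter S (order_on S). cmod (cdual_apply f a) \<le> K * norm f"
      using d by (subst eventually_tail_filter[OF dir]) (auto simp: order_on_def cstar_directed_def)
    then show "cmod (cdual_apply x f) \<le> K * norm f"
      by (rule tendsto_upperbound[OF tendsto_norm[OF increases_to_tendsto[OF S]] _ tail_filter_nontrivial[OF dir]])
  qed
qed

section \<open>The unit and the order of the bidual\<close>

text \<open>The given set may be unbounded: \<open>cutoff\<close> maps it into the unit ball and,
  being operator monotone, keeps it directed.\<close>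

lemma cstar_directed_cutoff:
  assumes S: "S \<noteq> {}" "\<And>a. a \<in> S \<Longrightarrow> cpos a"
    and dir: "\<And>a b. a \<in> S \<Longrightarrow> b \<in> S \<Longrightarrow> \<exists>c\<in>S. cstar_le a c \<and> cstar_le b c"
  shows "cstar_directed (cutoff ` S)"
  unfolding cstar_directed_def
proof (intro conjI ballI)
  show "cutoff ` S \<noteq> {}" using S(1) by simp
  show "bounded (cutoff ` S)" using S(2) by (auto simp: bounded_iff intro!: exI[of _ 1] norm_cutoff)
  show "selfadjoint a" if "a \<in> cutoff ` S" for a
    using that S(2) by (auto simp: selfadjoint_def intro: cpos_selfadjoint cpos_cutoff)
  fix a b assume "a \<in> cutoff ` S" "b \<in> cutoff ` S"
  then obtain c d where cd: "c \<in> S" "d \<in> S" "a = cutoff c" "b = cutoff d" by auto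
  obtain e where "e \<in> S" "cstar_le c e" "cstar_le d e" using dir[OF cd(1,2)] by blast
  then show "\<exists>c\<in>cutoff ` S. cstar_le a c \<and> cstar_le b c"
    using cd S(2) by (auto simp: cstar_le_iff intro!: cutoff_mono)
qed

lemma cstar_directed_approximate_unit: "cstar_directed (cutoff ` Collect cpos)"
proof (rule cstar_directed_cutoff)
  show "Collect cpos \<noteq> {}" using cpos_zero by blast
  fix a b :: 'a assume "a \<in> Collect cpos" "b \<in> Collect cpos"
  then show "\<exists>c\<in>Collect cpos. cstar_le a c \<and> cstar_le b c"
    by (auto simp: cstar_le_iff cpos_add intro!: exI[of _ "a + b"])
qed simp

text \<open>A may have no unit; the approximate unit b (1 + b)^-1, with b positive, converges to the
  unit of the bidual.\<close>

definition bidual_one :: "'a :: cstar_algebra bidual"  (\<open>\<one>\<close>)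
  where "\<one> = (SOME x. increases_to (cutoff ` Collect cpos) x)"

lemma increases_to_one: "increases_to (cutoff ` Collect cpos) \<one>"
  unfolding bidual_one_def by (rule someI_ex[OF increases_to_exists[OF cstar_directed_approximate_unit]])

lemma bidual_sa_one: "bidual_star \<one> = \<one>"
  using increases_to_one by (auto simp: increases_to_def bidual_sa_def)

lemma norm_one_le: "norm \<one> \<le> 1"
  by (rule norm_increases_to[OF increases_to_one]) (auto intro: norm_cutoff)

lemma Re_one_le: "Re (cdual_apply \<one> \<phi>) \<le> norm \<phi>" for \<phi> :: "'a :: cstar_algebra cdual"
  using complex_Re_le_cmod[of "cdual_apply \<one> \<phi>"] norm_cdual_apply[of \<one> \<phi>]
    mult_right_mono[OF norm_one_le[where 'a = 'a] norm_ge_zero[of \<phi>]] by simp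

text \<open>
  Along the approximate unit \<open>f (a e)\<close> converges to \<open>\<one> (f \<cdot> a)\<close>, and \<open>f a\<close> is a cluster point.
\<close>

lemma arens_one_right [simp]: "x \<odot> \<one> = x"
proof (rule cdual_eqI)
  fix f :: "'a cdual"
  have "bidual_lmult \<one> f = f"
  proof (rule cdual_eqI)
    fix a
    let ?E = "cutoff ` (Collect cpos :: 'a set)"
    define D where "D = cmod (cdual_apply \<one> (dual_rmult f a) - cdual_apply f a)"
    have "D \<le> 0 + d" if d: "d > 0" for d
    proof -
      define e where "e = d / (norm f + 1)"
      have f1: "norm f + 1 > 0" using norm_ge_zero[of f] by linarith
      then have e: "e > 0" using d by (simp add: e_def)
      have "\<forall>\<^sub>F b in tail_filter ?E (order_on ?E). dist (cdual_apply (dual_rmult f a) b) (cdual_apply \<one> (dual_rmult f a)) < e"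
        using increases_to_tendsto[OF increases_to_one] e by (rule tendstoD)
      then obtain c where c: "cpos c"
          "\<And>b. b \<in> ?E \<Longrightarrow> cstar_le (cutoff c) b \<Longrightarrow> dist (cdual_apply f (a * b)) (cdual_apply \<one> (dual_rmult f a)) < e"
        by (subst (asm) eventually_tail_filter[OF directed_index_order_on[OF cstar_directed_approximate_unit]])
          (auto simp: order_on_def dual_rmult.rep_eq)
      obtain b0 where b0: "cpos b0" "\<And>b. cpos (b - b0) \<Longrightarrow> norm (a - a * cutoff b) < e"
        using approximate_right_unit[OF e, of a] by blast
      \<comment> \<open>An index beyond \<open>c\<close> for the convergence and beyond
        \<open>b0\<close> for the approximate right unit.\<close>
      define b where "b = cutoff (c + b0)"
      have "b \<in> ?E" unfolding b_def using c(1) b0(1) by (auto intro: cpos_add)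
      moreover have "cstar_le (cutoff c) b"
        unfolding cstar_le_iff b_def using c(1) b0(1) by (intro cutoff_mono) simp_all
      ultimately have 1: "cmod (cdual_apply \<one> (dual_rmult f a) - cdual_apply f (a * b)) < e"
        using c(2) by (simp add: dist_norm norm_minus_commute)
      have "norm (a - a * b) < e" unfolding b_def using c(1) by (intro b0(2)) simp
      then have 2: "cmod (cdual_apply f a - cdual_apply f (a * b)) \<le> norm f * e"
        by (intro cdual_apply_close) simp
      have "D \<le> cmod (cdual_apply \<one> (dual_rmult f a) - cdual_apply f (a * b))
          + cmod (cdual_apply f a - cdual_apply f (a * b))"
        unfolding D_def by norm
      also have "\<dots> \<le> (norm f + 1) * e" using 1 2 by (simp add: distrib_right)
      also have "\<dots> = d" using f1 by (simp add: e_def)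
      finally show ?thesis by simp
    qed
    then have "D \<le> 0" by (rule field_le_epsilon)
    then show "cdual_apply (bidual_lmult \<one> f) a = cdual_apply f a"
      by (simp add: D_def bidual_lmult.rep_eq)
  qed
  then show "cdual_apply (x \<odot> \<one>) f = cdual_apply x f" by (simp add: arens.rep_eq)
qed

lemma arens_one_left [simp]: "\<one> \<odot> x = x"
  by (metis arens_one_right bidual_sa_one bidual_star_arens bidual_star_star)

text \<open>Dual description of positivity, stable under sums and weak limits;
  \<open>bpos_iff\<close> identifies it with the order by z^* z.\<close>

definition bpos :: "'a :: cstar_algebra bidual \<Rightarrow> bool"
  where "bpos x \<longleftrightarrow> (\<forall>\<phi>. positive_functional \<phi> \<longrightarrow> cdual_apply x \<phi> \<in> \<real>\<^sub>\<ge>\<^sub>0)"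

lemma bposD: "bpos x \<Longrightarrow> positive_functional \<phi> \<Longrightarrow> 0 \<le> Re (cdual_apply x \<phi>)"
  by (auto simp: bpos_def complex_nonneg_Reals_iff)

lemma bposI:
  "bidual_sa x \<Longrightarrow> (\<And>\<phi>. positive_functional \<phi> \<Longrightarrow> 0 \<le> Re (cdual_apply x \<phi>)) \<Longrightarrow> bpos x"
  by (simp add: bpos_def complex_nonneg_Reals_iff Im_bidual_sa)

lemma bpos_sa: "bpos x \<Longrightarrow> bidual_star x = x"
  by (rule bidual_eqI)
    (auto simp: bpos_def bidual_star.rep_eq dual_star_positive_functional complex_nonneg_Reals_iff complex_eq_iff)

lemma bpos_zero [simp]: "bpos 0"
  by (simp add: bpos_def zero_cdual.rep_eq)

lemma bpos_add: "bpos x \<Longrightarrow> bpos y \<Longrightarrow> bpos (x + y)"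
  by (auto simp: bpos_def)

lemma bpos_scaleR: "0 \<le> r \<Longrightarrow> bpos x \<Longrightarrow> bpos (r *\<^sub>R x)"
  by (auto simp: bpos_def scaleR_cdual.rep_eq complex_nonneg_Reals_iff)

lemma bpos_star_arens: "bpos (bidual_star z \<odot> z)"
  by (simp add: bpos_def positive_functional_bidual_star_mult_self)

lemma bpos_one: "bpos \<one>"
  using bpos_star_arens[of \<one>] by (simp add: bidual_sa_one)

lemma bpos_emb: "cpos a \<Longrightarrow> bpos (bidual_emb a)"
  by (simp add: bpos_def bidual_emb.rep_eq positive_functional_cpos)

section \<open>Square roots and order in the bidual\<close>

lemma bidual_sqrt_one_minus:
  assumes x: "bidual_star x = x" "norm x \<le> 1"
  obtains w where "bidual_star (\<one> - w) = \<one> - w" "\<one> - x = (\<one> - w) \<odot> (\<one> - w)"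
    "\<And>S. closed S \<Longrightarrow> 0 \<in> S \<Longrightarrow> (\<And>v. v \<in> S \<Longrightarrow> (1/2) *\<^sub>R (x + v \<odot> v) \<in> S) \<Longrightarrow> w \<in> S"
proof -
  obtain w where w: "2 *\<^sub>R w = x + w \<odot> w"
    and S: "\<And>S. closed S \<Longrightarrow> 0 \<in> S \<Longrightarrow> (\<And>v. v \<in> S \<Longrightarrow> (1/2) *\<^sub>R (x + v \<odot> v) \<in> S) \<Longrightarrow> w \<in> S"
    using sqrt_iteration[OF bounded_bilinear_arens norm_arens x(2)] by auto
  have "w \<in> {v. bidual_star v = v}"
    by (rule S) (auto simp: bidual_star_simps x linear_0[OF bounded_linear.linear[OF bounded_linear_bidual_star]]
        intro!: closed_Collect_eq continuous_intros bounded_linear.continuous_on[OF bounded_linear_bidual_star])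
  then have "bidual_star (\<one> - w) = \<one> - w" by (simp add: bidual_star_simps bidual_sa_one)
  moreover have "(\<one> - w) \<odot> (\<one> - w) = \<one> - (2 *\<^sub>R w - w \<odot> w)"
    by (simp add: arens.diff_left arens.diff_right scaleR_2)
  then have "\<one> - x = (\<one> - w) \<odot> (\<one> - w)" by (simp add: w)
  ultimately show ?thesis using S that by blast
qed

lemma bpos_norm_minus:
  assumes x: "bidual_star x = x" "norm x \<le> r"
  shows "bpos (r *\<^sub>R \<one> - x)"
proof (cases "r = 0")
  case True
  then show ?thesis using x by simp
next
  case False
  then have r: "r > 0" using x(2) norm_ge_zero[of x] by linarith
  have "bidual_star ((1/r) *\<^sub>R x) = (1/r) *\<^sub>R x" "norm ((1/r) *\<^sub>R x) \<le> 1"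
    using r x by (simp_all add: bidual_star_scaleR)
  then have "bpos (\<one> - (1/r) *\<^sub>R x)" using bidual_sqrt_one_minus bpos_star_arens by metis
  then have "bpos (r *\<^sub>R (\<one> - (1/r) *\<^sub>R x))" using r by (intro bpos_scaleR) simp_all
  then show ?thesis using r by (simp add: scaleR_right_diff_distrib)
qed

text \<open>As x is self-adjoint, only the hermitian part g of a functional f contributes to the
  real part of x f. The norm-sharp Jordan decomposition of g then gives the constant r.\<close>

lemma norm_le_of_bpos:
  assumes "bpos (r *\<^sub>R \<one> - x)" "bpos (r *\<^sub>R \<one> + x)" "0 \<le> r"
  shows "norm x \<le> r"
proof (rule norm_cdual_leI)
  fix f :: "'a cdual" assume f: "norm f \<le> 1"
  have x: "bidual_star x = x"
    using bpos_sa[OF assms(2)] by (simp add: bidual_star_simps bidual_sa_one)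
  obtain g h where gh: "dual_star g = g" "dual_star h = h" "f = g + \<i> *\<^sub>C h" "norm g \<le> norm f"
    by (rule cartesian_decomposition)
  have "Im (cdual_apply x h) = 0"
  proof -
    have "cdual_apply x h = cnj (cdual_apply x h)" using x gh(2) by (metis bidual_star.rep_eq)
    then show ?thesis by (simp add: complex_eq_iff)
  qed
  then have "Re (cdual_apply x f) = Re (cdual_apply x g)" by (simp add: gh(3) cdual_add cdual_scaleC)
  obtain \<phi> \<psi> where d: "positive_functional \<phi>" "positive_functional \<psi>" "g = \<phi> - \<psi>" "norm \<phi> + norm \<psi> \<le> norm g"
    using jordan_decomposition[OF gh(1)] by blast
  have "Re (cdual_apply x \<phi>) \<le> r * Re (cdual_apply \<one> \<phi>)"
    using bposD[OF assms(1) d(1)] by (simp add: cdual_rep_eq)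
  also have "\<dots> \<le> r * norm \<phi>" using Re_one_le assms(3) by (rule mult_left_mono)
  finally have 1: "Re (cdual_apply x \<phi>) \<le> r * norm \<phi>" .
  have "- Re (cdual_apply x \<psi>) \<le> r * Re (cdual_apply \<one> \<psi>)"
    using bposD[OF assms(2) d(2)] by (simp add: cdual_rep_eq)
  also have "\<dots> \<le> r * norm \<psi>" using Re_one_le assms(3) by (rule mult_left_mono)
  finally have "Re (cdual_apply x g) \<le> r * (norm \<phi> + norm \<psi>)"
    using 1 by (simp add: d(3) cdual_diff distrib_left)
  also have "\<dots> \<le> r * 1" using d(4) gh(4) f assms(3) by (intro mult_left_mono) auto
  finally show "Re (cdual_apply x f) \<le> r" using \<open>Re (cdual_apply x f) = Re (cdual_apply x g)\<close> by simp
qed (rule assms(3))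

text \<open>The order bounds show that \<one> - x / norm x has norm at most 1. The clause on
  \<open>S\<close> keeps \<open>w\<close> inside closed sets stable under the iteration.\<close>

lemma bpos_sqrt:
  assumes "bpos x" "x \<noteq> 0"
  obtains w where "bidual_star (\<one> - w) = \<one> - w" "x = norm x *\<^sub>R ((\<one> - w) \<odot> (\<one> - w))"
    "\<And>S. closed S \<Longrightarrow> 0 \<in> S \<Longrightarrow>
      (\<And>v. v \<in> S \<Longrightarrow> (1/2) *\<^sub>R ((\<one> - (1 / norm x) *\<^sub>R x) + v \<odot> v) \<in> S) \<Longrightarrow> w \<in> S"
proof -
  define y where "y = \<one> - (1 / norm x) *\<^sub>R x"
  have t: "norm x > 0" using assms(2) by simp
  have sx: "bidual_star x = x" by (rule bpos_sa[OF assms(1)])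
  have "norm y \<le> 1"
  proof (rule norm_le_of_bpos)
    show "bpos (1 *\<^sub>R \<one> - y)" using t assms(1) by (simp add: y_def bpos_scaleR)
    have "bpos ((1 / norm x) *\<^sub>R (norm x *\<^sub>R \<one> - x))"
      using t by (intro bpos_scaleR bpos_norm_minus sx) simp_all
    then have "bpos (\<one> - (1 / norm x) *\<^sub>R x)" using t by (simp add: scaleR_right_diff_distrib)
    then show "bpos (1 *\<^sub>R \<one> + y)" by (simp add: y_def bpos_add bpos_one)
  qed simp
  moreover have "bidual_star y = y" by (simp add: y_def bidual_star_simps sx bidual_sa_one)
  ultimately obtain w where w: "bidual_star (\<one> - w) = \<one> - w" "\<one> - y = (\<one> - w) \<odot> (\<one> - w)"
    "\<And>S. closed S \<Longrightarrow> 0 \<in> S \<Longrightarrow> (\<And>v. v \<in> S \<Longrightarrow> (1/2) *\<^sub>R (y + v \<odot> v) \<in> S) \<Longrightarrow> w \<in> S"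
    using bidual_sqrt_one_minus by metis
  have "x = norm x *\<^sub>R (\<one> - y)" using t by (simp add: y_def)
  then have "x = norm x *\<^sub>R ((\<one> - w) \<odot> (\<one> - w))" by (simp only: w(2))
  with w(1) show ?thesis using w(3) unfolding y_def by (rule that)
qed

theorem bpos_iff: "bpos x \<longleftrightarrow> (\<exists>z. x = bidual_star z \<odot> z)"
proof
  assume x: "bpos x"
  show "\<exists>z. x = bidual_star z \<odot> z"
  proof (cases "x = 0")
    case False
    then obtain w where w: "bidual_star (\<one> - w) = \<one> - w" "x = norm x *\<^sub>R ((\<one> - w) \<odot> (\<one> - w))"
      using bpos_sqrt[OF x] by metis
    define z where "z = sqrt (norm x) *\<^sub>R (\<one> - w)"
    have "bidual_star z \<odot> z = (sqrt (norm x) * sqrt (norm x)) *\<^sub>R ((\<one> - w) \<odot> (\<one> - w))"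
      by (simp only: z_def bidual_star_scaleR w(1) arens.scaleR_left arens.scaleR_right scaleR_scaleR)
    then have "bidual_star z \<odot> z = x" using w(2) by simp
    then show ?thesis by metis
  next
    case True
    then have "x = bidual_star 0 \<odot> 0" by (simp add: arens.zero_right)
    then show ?thesis ..
  qed
qed (auto simp: bpos_star_arens)

lemma bidual_le_iff: "x \<sqsubseteq> y \<longleftrightarrow> bpos (y - x)"
  by (simp add: bidual_le_def bpos_iff)

lemma bpos_conj: "bpos x \<Longrightarrow> bpos (bidual_star z \<odot> x \<odot> z)"
proof -
  assume "bpos x"
  then obtain w where "x = bidual_star w \<odot> w" by (auto simp: bpos_iff)
  then have "bidual_star z \<odot> x \<odot> z = bidual_star (w \<odot> z) \<odot> (w \<odot> z)"
    by (simp add: bidual_star_arens arens_assoc)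
  then show ?thesis by (simp add: bpos_star_arens)
qed

text \<open>The functional has to be an element of the dual of A, so it is assembled from two module
  actions and the involution; its positivity on A comes from \<open>bpos_conj\<close>.\<close>

lemma conj_functional:
  assumes "positive_functional \<phi>"
  obtains \<psi> where "positive_functional \<psi>"
    "\<And>y. cdual_apply y \<psi> = cdual_apply (bidual_star x \<odot> y \<odot> x) \<phi>"
proof -
  define \<psi> where "\<psi> = dual_star (bidual_lmult x (dual_star (bidual_lmult x \<phi>)))"
  have y: "cdual_apply y \<psi> = cdual_apply (bidual_star x \<odot> y \<odot> x) \<phi>" for y
  proof -
    have "cdual_apply y \<psi> = cnj (cdual_apply (bidual_star y) (bidual_lmult x (dual_star (bidual_lmult x \<phi>))))"
      by (simp add: \<psi>_def bidual_star.rep_eq)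
    also have "\<dots> = cdual_apply (bidual_star (bidual_star y \<odot> x)) (bidual_lmult x \<phi>)"
      by (simp add: bidual_star.rep_eq arens.rep_eq)
    finally show ?thesis by (simp add: bidual_star_simps arens.rep_eq)
  qed
  have "cdual_apply \<psi> (star a * a) \<in> \<real>\<^sub>\<ge>\<^sub>0" for a
  proof -
    have "cdual_apply \<psi> (star a * a) = cdual_apply (bidual_star x \<odot> bidual_emb (star a * a) \<odot> x) \<phi>"
      by (simp flip: y add: bidual_emb.rep_eq)
    then show ?thesis
      using bpos_conj[OF bpos_emb[OF cpos_star_mult_self[of a]], of x] assms by (simp add: bpos_def)
  qed
  then have "positive_functional \<psi>" by (simp add: positive_functional_def)
  with y show ?thesis using that by blast
qed

text \<open>Parallelogram identity: the difference is the square of u - v.\<close>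

lemma bpos_square_le: "bpos (2 *\<^sub>R (bidual_star u \<odot> u) + 2 *\<^sub>R (bidual_star v \<odot> v) - bidual_star (u + v) \<odot> (u + v))"
proof -
  have "2 *\<^sub>R (bidual_star u \<odot> u) + 2 *\<^sub>R (bidual_star v \<odot> v) - bidual_star (u + v) \<odot> (u + v)
      = bidual_star (u - v) \<odot> (u - v)"
    by (simp add: bidual_star_simps arens_simps scaleR_2)
  then show ?thesis by (simp add: bpos_star_arens)
qed

lemma bpos_norm_sq:
  "bpos ((norm x)\<^sup>2 *\<^sub>R (bidual_star z \<odot> z) - bidual_star (x \<odot> z) \<odot> (x \<odot> z))"
proof -
  have "norm (bidual_star x \<odot> x) \<le> (norm x)\<^sup>2"
    using norm_arens[of "bidual_star x" x] by (simp add: norm_bidual_star power2_eq_square)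
  then have "bpos ((norm x)\<^sup>2 *\<^sub>R \<one> - bidual_star x \<odot> x)"
    by (intro bpos_norm_minus) (simp_all add: bidual_star_simps)
  from bpos_conj[OF this, of z] show ?thesis by (simp add: arens_simps bidual_star_simps)
qed

text \<open>Conjugate x <= r by the square root of x.\<close>

lemma bpos_square_le_norm:
  assumes x: "bpos x" and n: "norm x \<le> r"
  shows "bpos (r *\<^sub>R x - x \<odot> x)"
proof (cases "x = 0")
  case False
  obtain w where w: "bidual_star (\<one> - w) = \<one> - w" "x = norm x *\<^sub>R ((\<one> - w) \<odot> (\<one> - w))"
    using bpos_sqrt[OF x False] by metis
  define s where "s = sqrt (norm x) *\<^sub>R (\<one> - w)"
  have s: "bidual_star s = s" by (simp only: s_def bidual_star_scaleR w(1))
  have "s \<odot> s = (sqrt (norm x) * sqrt (norm x)) *\<^sub>R ((\<one> - w) \<odot> (\<one> - w))"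
    by (simp only: s_def arens.scaleR_left arens.scaleR_right scaleR_scaleR)
  then have ss: "s \<odot> s = x" using w(2) by simp
  have "bpos (bidual_star s \<odot> (r *\<^sub>R \<one> - x) \<odot> s)"
    by (intro bpos_conj bpos_norm_minus bpos_sa x n)
  moreover have "bidual_star s \<odot> (r *\<^sub>R \<one> - x) \<odot> s = r *\<^sub>R (s \<odot> s) - (s \<odot> s) \<odot> (s \<odot> s)"
    by (simp add: s arens_simps flip: ss)
  ultimately show ?thesis by (simp add: ss)
qed (simp add: arens.zero_right)

section \<open>Limits of increasing nets of positive elements\<close>

lemma bidual_emb_simps:
  "bidual_emb (a + b) = bidual_emb a + bidual_emb b" "bidual_emb (a - b) = bidual_emb a - bidual_emb b"
  "bidual_emb (- a) = - bidual_emb a" "bidual_emb 0 = 0"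
  "bidual_emb (r *\<^sub>R a) = r *\<^sub>R bidual_emb a" "bidual_emb (c *\<^sub>C a) = c *\<^sub>C bidual_emb a"
  by (rule cdual_eqI; simp add: bidual_emb.rep_eq cdual_linear_simps cdual_rep_eq scaleR_conv_of_real)+

lemma norm_bidual_emb: "norm (bidual_emb a) \<le> norm a"
  by (rule norm_cdual_bound) (simp_all add: bidual_emb.rep_eq norm_cdual_apply mult.commute[of "norm a"])

lemma bpos_trans: "bpos (y - x) \<Longrightarrow> bpos (z - y) \<Longrightarrow> bpos (z - x)"
  using bpos_add[of "y - x" "z - y"] by simp

lemma norm_bpos_mono:
  assumes "bpos x" "bpos (y - x)"
  shows "norm x \<le> norm y"
proof (rule norm_le_of_bpos)
  have y: "bpos y" using bpos_add[OF assms] by simp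
  have "bpos (norm y *\<^sub>R \<one> - y)" by (intro bpos_norm_minus bpos_sa y) simp
  from bpos_add[OF this assms(2)] show "bpos (norm y *\<^sub>R \<one> - x)" by simp
  show "bpos (norm y *\<^sub>R \<one> + x)" by (intro bpos_add bpos_scaleR bpos_one assms) simp
qed simp

lemma bpos_increases_to:
  assumes "increases_to S x" "a \<in> S"
  shows "bpos (x - bidual_emb a)"
proof (rule bposI)
  have "star a = a" using increases_toD(1)[OF assms(1)] assms(2) by (auto simp: cstar_directed_def selfadjoint_def)
  then have "bidual_star (bidual_emb a) = bidual_emb a" by (metis bidual_emb_star)
  then show "bidual_sa (x - bidual_emb a)"
    using increases_toD(2)[OF assms(1)] by (simp add: bidual_sa_def bidual_star_diff)
qed (use increases_toD(3)[OF assms(1) _ assms(2)] in \<open>simp add: cdual_rep_eq bidual_emb.rep_eq\<close>)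

lemma increases_to_singleton:
  assumes "selfadjoint a"
  shows "increases_to {a} (bidual_emb a)"
  unfolding increases_to_def cstar_directed_def
  using assms by (auto simp: bidual_emb.rep_eq cstar_le_refl bidual_sa_def selfadjoint_def simp flip: bidual_emb_star)

lemma increases_to_add:
  assumes S: "increases_to S x" and T: "increases_to T y"
  shows "increases_to {a + b |a b. a \<in> S \<and> b \<in> T} (x + y)"
  unfolding increases_to_def
proof (intro conjI allI impI ballI)
  let ?U = "{a + b |a b. a \<in> S \<and> b \<in> T}"
  note dS = increases_toD(1)[OF S, unfolded cstar_directed_def]
  note dT = increases_toD(1)[OF T, unfolded cstar_directed_def]
  show "cstar_directed ?U"
    unfolding cstar_directed_def
  proof (intro conjI ballI)
    show "?U \<noteq> {}" using dS dT by auto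
    show "bounded ?U"
    proof -
      obtain K L where "\<And>a. a \<in> S \<Longrightarrow> norm a \<le> K" "\<And>b. b \<in> T \<Longrightarrow> norm b \<le> L"
        using dS dT by (auto simp: bounded_iff)
      then have "norm (a + b) \<le> K + L" if "a \<in> S" "b \<in> T" for a b
        using that by (intro norm_triangle_le add_mono)
      then show ?thesis unfolding bounded_iff by blast
    qed
    show "selfadjoint c" if "c \<in> ?U" for c
      using that dS dT by (auto simp: selfadjoint_def star_add)
    fix c d assume "c \<in> ?U" "d \<in> ?U"
    then obtain a b a' b' where *: "a \<in> S" "b \<in> T" "a' \<in> S" "b' \<in> T" "c = a + b" "d = a' + b'" by auto
    obtain a'' where a: "a'' \<in> S" "cstar_le a a''" "cstar_le a' a''" using dS *(1,3) by blast
    obtain b'' where b: "b'' \<in> T" "cstar_le b b''" "cstar_le b' b''" using dT *(2,4) by blast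
    have "cstar_le c (a'' + b'')" "cstar_le d (a'' + b'')"
      using a b cpos_add[of "a'' - a" "b'' - b"] cpos_add[of "a'' - a'" "b'' - b'"]
      by (simp_all add: * cstar_le_iff add_diff_add)
    then show "\<exists>e\<in>?U. cstar_le c e \<and> cstar_le d e" using a b by blast
  qed
  show "bidual_sa (x + y)"
    using increases_toD(2)[OF S] increases_toD(2)[OF T] by (simp add: bidual_sa_def bidual_star_add)
  fix \<phi> :: "'a cdual" assume \<phi>: "positive_functional \<phi>"
  show "Re (cdual_apply \<phi> c) \<le> Re (cdual_apply (x + y) \<phi>)" if "c \<in> ?U" for c
    using that by (auto simp: cdual_add intro!: add_mono increases_toD(3)[OF S \<phi>] increases_toD(3)[OF T \<phi>])
  fix e :: real assume "e > 0"
  then have "e / 2 > 0" by simp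
  then obtain a b where "a \<in> S" "Re (cdual_apply x \<phi>) < Re (cdual_apply \<phi> a) + e / 2"
    "b \<in> T" "Re (cdual_apply y \<phi>) < Re (cdual_apply \<phi> b) + e / 2"
    using increases_toD(4)[OF S \<phi>] increases_toD(4)[OF T \<phi>] by meson
  then have "a + b \<in> ?U" "Re (cdual_apply (x + y) \<phi>) < Re (cdual_apply \<phi> (a + b)) + e"
    by (auto simp: cdual_add)
  then show "\<exists>c\<in>?U. Re (cdual_apply (x + y) \<phi>) < Re (cdual_apply \<phi> c) + e" by blast
qed

text \<open>The map acts on positive functionals by passing from \<phi> to \<psi>, so suprema over
  the image of \<open>S\<close> are suprema over \<open>S\<close>. It is applied to scaling and to
  conjugation by elements of A.\<close>

lemma increases_to_image:
  fixes L :: "'a :: cstar_algebra \<Rightarrow> 'a"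
  assumes S: "increases_to S x" and L: "bounded_linear L" "\<And>a. selfadjoint a \<Longrightarrow> selfadjoint (L a)"
      "\<And>a. cpos a \<Longrightarrow> cpos (L a)"
    and y: "bidual_sa y" "\<And>\<phi>. positive_functional \<phi> \<Longrightarrow> \<exists>\<psi>. positive_functional \<psi> \<and>
      cdual_apply y \<phi> = cdual_apply x \<psi> \<and> (\<forall>a. cdual_apply \<phi> (L a) = cdual_apply \<psi> a)"
  shows "increases_to (L ` S) y"
  unfolding increases_to_def
proof (intro conjI allI impI ballI)
  have dS: "S \<noteq> {}" "bounded S" "\<And>a. a \<in> S \<Longrightarrow> selfadjoint a"
    "\<And>a b. a \<in> S \<Longrightarrow> b \<in> S \<Longrightarrow> \<exists>c\<in>S. cstar_le a c \<and> cstar_le b c"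
    using increases_toD(1)[OF S] by (auto simp: cstar_directed_def)
  have mono: "cstar_le (L a) (L b)" if "cstar_le a b" for a b
    using that L(3)[of "b - a"] by (simp add: cstar_le_iff linear_diff[OF bounded_linear.linear[OF L(1)]])
  show "cstar_directed (L ` S)"
    unfolding cstar_directed_def
  proof (intro conjI ballI)
    show "L ` S \<noteq> {}" using dS(1) by simp
    show "bounded (L ` S)" using dS(2) L(1) by (rule bounded_linear_image)
    show "selfadjoint c" if "c \<in> L ` S" for c using that dS(3) L(2) by blast
    fix c d assume "c \<in> L ` S" "d \<in> L ` S"
    then obtain a b where *: "a \<in> S" "b \<in> S" "c = L a" "d = L b" by auto
    obtain e where "e \<in> S" "cstar_le a e" "cstar_le b e" using dS(4)[OF *(1,2)] by blast
    then show "\<exists>e\<in>L ` S. cstar_le c e \<and> cstar_le d e" using *(3,4) mono by blast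
  qed
  fix \<phi> :: "'a cdual" assume "positive_functional \<phi>"
  then obtain \<psi> where \<psi>: "positive_functional \<psi>" "cdual_apply y \<phi> = cdual_apply x \<psi>"
    "\<And>a. cdual_apply \<phi> (L a) = cdual_apply \<psi> a" using y(2) by blast
  show "Re (cdual_apply \<phi> c) \<le> Re (cdual_apply y \<phi>)" if "c \<in> L ` S" for c
    using that increases_toD(3)[OF S \<psi>(1)] by (auto simp: \<psi>)
  show "\<exists>c\<in>L ` S. Re (cdual_apply y \<phi>) < Re (cdual_apply \<phi> c) + e" if "e > 0" for e
    using increases_toD(4)[OF S \<psi>(1) that] by (simp add: \<psi>)
qed (rule y(1))

text \<open>The members of the net are positive, not only its limit: this allows
  \<open>cutoff\<close> to be applied to each of them.\<close>

definition positive_limits :: "'a :: cstar_algebra bidual set"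
  where "positive_limits = {x. \<exists>S. (\<forall>a\<in>S. cpos a) \<and> increases_to S x}"

lemma bpos_positive_limits: "x \<in> positive_limits \<Longrightarrow> bpos x"
proof -
  assume "x \<in> positive_limits"
  then obtain S where S: "\<forall>a\<in>S. cpos a" "increases_to S x" by (auto simp: positive_limits_def)
  obtain a where "a \<in> S" using increases_toD(1)[OF S(2)] by (auto simp: cstar_directed_def)
  with S have "increases_to S x" "a \<in> S" "cpos a" by auto
  then show "bpos x" using bpos_add[OF bpos_increases_to bpos_emb, of S x a a] by simp
qed

lemma positive_limits_emb: "cpos a \<Longrightarrow> bidual_emb a \<in> positive_limits"
  using increases_to_singleton[of a] by (auto simp: positive_limits_def selfadjoint_def cpos_selfadjoint)

lemma positive_limits_zero: "0 \<in> positive_limits"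
  using positive_limits_emb[of 0] by (simp add: bidual_emb_simps)

lemma positive_limits_one: "\<one> \<in> positive_limits"
proof -
  have "\<forall>a\<in>cutoff ` Collect cpos. cpos a" by (auto intro: cpos_cutoff)
  with increases_to_one show ?thesis unfolding positive_limits_def by blast
qed

lemma positive_limits_add:
  assumes "x \<in> positive_limits" "y \<in> positive_limits"
  shows "x + y \<in> positive_limits"
proof -
  obtain S T where S: "\<forall>a\<in>S. cpos a" "increases_to S x" and T: "\<forall>a\<in>T. cpos a" "increases_to T y"
    using assms by (auto simp: positive_limits_def)
  have "\<forall>c\<in>{a + b |a b. a \<in> S \<and> b \<in> T}. cpos c" using S(1) T(1) by (auto intro: cpos_add)
  with increases_to_add[OF S(2) T(2)] show ?thesis unfolding positive_limits_def by blast
qed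

lemma positive_limits_scaleR:
  assumes "x \<in> positive_limits" "0 \<le> r"
  shows "r *\<^sub>R x \<in> positive_limits"
proof -
  obtain S where S: "\<forall>a\<in>S. cpos a" "increases_to S x" using assms by (auto simp: positive_limits_def)
  have "increases_to ((\<lambda>a. r *\<^sub>R a) ` S) (r *\<^sub>R x)"
  proof (rule increases_to_image[OF S(2)])
    show "bounded_linear (\<lambda>a :: 'a. r *\<^sub>R a)" by (rule bounded_linear_scaleR_right)
    show "bidual_sa (r *\<^sub>R x)"
      using increases_toD(2)[OF S(2)] by (simp add: bidual_sa_def bidual_star_scaleR)
    fix \<phi> :: "'a cdual" assume "positive_functional \<phi>"
    then have "positive_functional (r *\<^sub>R \<phi>)"
      using assms(2) by (simp add: positive_functional_def cdual_rep_eq complex_nonneg_Reals_iff)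
    then show "\<exists>\<psi>. positive_functional \<psi> \<and> cdual_apply (r *\<^sub>R x) \<phi> = cdual_apply x \<psi> \<and>
        (\<forall>a. cdual_apply \<phi> (r *\<^sub>R a) = cdual_apply \<psi> a)"
      by (intro exI[of _ "r *\<^sub>R \<phi>"]) (simp add: cdual_rep_eq cdual_scaleR scaleR_conv_of_real)
  qed (use assms(2) in \<open>auto simp: selfadjoint_def star_scaleR intro: cpos_scaleR\<close>)
  with S(1) assms(2) show ?thesis
    unfolding positive_limits_def by (blast intro: cpos_scaleR)
qed

text \<open>Conjugation by an element of A maps the net into A again. The product estimate for
  \<open>lusin\<close> relies on this.\<close>

lemma positive_limits_conj:
  assumes "x \<in> positive_limits"
  shows "bidual_star (bidual_emb b) \<odot> x \<odot> bidual_emb b \<in> positive_limits"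
proof -
  obtain S where S: "\<forall>a\<in>S. cpos a" "increases_to S x" using assms by (auto simp: positive_limits_def)
  have "increases_to ((\<lambda>a. star b * a * b) ` S) (bidual_star (bidual_emb b) \<odot> x \<odot> bidual_emb b)"
  proof (rule increases_to_image[OF S(2)])
    show "bounded_linear (\<lambda>a. star b * a * b)"
      by (intro bounded_linear_mult_const bounded_linear_const_mult bounded_linear_ident)
    show "bidual_sa (bidual_star (bidual_emb b) \<odot> x \<odot> bidual_emb b)"
      using increases_toD(2)[OF S(2)] by (simp add: bidual_sa_def bidual_star_simps arens_assoc)
    fix \<phi> :: "'a cdual" assume "positive_functional \<phi>"
    then obtain \<psi> where \<psi>: "positive_functional \<psi>"
      "\<And>y. cdual_apply y \<psi> = cdual_apply (bidual_star (bidual_emb b) \<odot> y \<odot> bidual_emb b) \<phi>"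
      using conj_functional by blast
    have "cdual_apply \<phi> (star b * a * b) = cdual_apply \<psi> a" for a
      using \<psi>(2)[of "bidual_emb a"]
      by (simp add: bidual_emb.rep_eq flip: bidual_emb_star bidual_emb_mult)
    with \<psi> show "\<exists>\<psi>. positive_functional \<psi> \<and>
        cdual_apply (bidual_star (bidual_emb b) \<odot> x \<odot> bidual_emb b) \<phi> = cdual_apply x \<psi> \<and>
        (\<forall>a. cdual_apply \<phi> (star b * a * b) = cdual_apply \<psi> a)"
      by metis
  qed (simp_all add: selfadjoint_def star_mult star_star mult.assoc cpos_conj[unfolded mult.assoc])
  moreover have "\<forall>c\<in>(\<lambda>a. star b * a * b) ` S. cpos c" using S(1) by (auto intro: cpos_conj)
  ultimately show ?thesis unfolding positive_limits_def by blast
qed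

text \<open>The part of the net above \<open>a\<close>, translated by \<open>- a\<close>, consists
  of positive elements.\<close>

lemma positive_limits_diff:
  assumes S: "increases_to S x" and a: "a \<in> S"
  shows "x - bidual_emb a \<in> positive_limits"
proof -
  note dS = increases_toD(1)[OF S, unfolded cstar_directed_def]
  let ?T = "{b \<in> S. cstar_le a b}"
  have "increases_to ?T x"
    unfolding increases_to_def
  proof (intro conjI allI impI ballI)
    show "cstar_directed ?T"
      unfolding cstar_directed_def
    proof (intro conjI ballI)
      show "?T \<noteq> {}" using a cstar_le_refl by blast
      show "bounded ?T" using dS by (auto intro: bounded_subset)
      fix c d assume "c \<in> ?T" "d \<in> ?T"
      moreover from this obtain e where "e \<in> S" "cstar_le c e" "cstar_le d e" using dS by blast
      ultimately show "\<exists>e\<in>?T. cstar_le c e \<and> cstar_le d e" using cstar_le_trans by blast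
    qed (use dS in auto)
    fix \<phi> :: "'a cdual" and e :: real assume \<phi>: "positive_functional \<phi>" and "e > 0"
    then obtain b where b: "b \<in> S" "Re (cdual_apply x \<phi>) < Re (cdual_apply \<phi> b) + e"
      using increases_toD(4)[OF S] by blast
    obtain c where c: "c \<in> S" "cstar_le a c" "cstar_le b c" using dS a b(1) by blast
    have "Re (cdual_apply \<phi> b) \<le> Re (cdual_apply \<phi> c)" using \<phi> c(3) by (rule positive_functional_mono)
    then show "\<exists>c\<in>?T. Re (cdual_apply x \<phi>) < Re (cdual_apply \<phi> c) + e"
      using b(2) c by (intro bexI[of _ c]) auto
  qed (use increases_toD[OF S] in auto)
  moreover have "selfadjoint (- a)" using dS a by (simp add: selfadjoint_def star_minus)
  ultimately have "increases_to {b + c |b c. b \<in> ?T \<and> c \<in> {- a}} (x + bidual_emb (- a))"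
    by (intro increases_to_add increases_to_singleton)
  moreover have "cpos c" if "c \<in> {b + c |b c. b \<in> ?T \<and> c \<in> {- a}}" for c
    using that by (auto simp: cstar_le_iff)
  ultimately have "x + bidual_emb (- a) \<in> positive_limits" unfolding positive_limits_def by blast
  then show ?thesis by (simp add: bidual_emb_simps)
qed

lemma sa_monotone_limitsI: "increases_to S x \<Longrightarrow> x \<in> sa_monotone_limits"
  using increases_to_tendsto[of S x] bounded_increasing_sa_net_order_on[OF increases_toD(1)]
  unfolding sa_monotone_limits_def sigma_weak_tendsto_def bidual_emb.rep_eq by blast

lemma sa_monotone_limitsE:
  assumes "x \<in> sa_monotone_limits"
  obtains S where "increases_to S x"
  using assms increases_to_image_net unfolding sa_monotone_limits_def sigma_weak_tendsto_def bidual_emb.rep_eq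
  by blast

section \<open>Truncation of unbounded sums\<close>

text \<open>The difference is (1/s) w^* y w with w = s u - v. It is used with s = M and with s =
  1.\<close>

lemma bpos_conj_add:
  assumes y: "bpos y" and s: "s > 0"
  shows "bpos ((1 + s) *\<^sub>R (bidual_star u \<odot> y \<odot> u) + (1 + 1/s) *\<^sub>R (bidual_star v \<odot> y \<odot> v)
    - bidual_star (u + v) \<odot> y \<odot> (u + v))"
proof -
  let ?w = "s *\<^sub>R u - v"
  have "bpos ((1/s) *\<^sub>R (bidual_star ?w \<odot> y \<odot> ?w))" using s by (intro bpos_scaleR bpos_conj y) simp
  moreover have "(1/s) *\<^sub>R (bidual_star ?w \<odot> y \<odot> ?w) =
      s *\<^sub>R (bidual_star u \<odot> y \<odot> u) + (1/s) *\<^sub>R (bidual_star v \<odot> y \<odot> v)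
      - bidual_star u \<odot> y \<odot> v - bidual_star v \<odot> y \<odot> u"
    using s by (simp add: bidual_star_simps arens_simps scaleR_right_diff_distrib)
  ultimately show ?thesis
    by (simp add: bidual_star_simps arens_simps scaleR_add_left algebra_simps)
qed

text \<open>
  With \<open>f = b (1 + b)\<^sup>-\<^sup>1\<close> and \<open>r = 1 - f\<close> one has \<open>r b r = f - f\<^sup>2\<close>, and therefore
  \<open>y = (r + f) y (r + f) \<le> (1 + M) r y r + (1 + 1/M) f y f \<le> (1 + M) (f + r e r)\<close>.
\<close>

lemma cutoff_dominates:
  assumes b: "cpos b" and y: "bpos y" "norm y \<le> M" and M: "M > 0"
    and e: "bpos (bidual_emb b + e - y)"
  shows "bpos ((1 + M) *\<^sub>R (bidual_emb (cutoff b)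
    + (\<one> - bidual_emb (cutoff b)) \<odot> e \<odot> (\<one> - bidual_emb (cutoff b))) - y)"
proof -
  define f B r where "f = bidual_emb (cutoff b)" and "B = bidual_emb b" and "r = \<one> - f"
  have f: "bidual_star f = f" unfolding f_def by (intro bpos_sa bpos_emb cpos_cutoff b)
  have r: "bidual_star r = r" by (simp add: r_def bidual_star_simps f bidual_sa_one)
  have "f + f \<odot> B = B" using arg_cong[OF cutoff_plus(2)[OF b], of bidual_emb]
    by (simp add: f_def B_def bidual_emb_simps bidual_emb_mult)
  then have "r \<odot> B = f" by (simp add: r_def arens_simps diff_eq_eq)
  then have rBr: "r \<odot> B \<odot> r = f - f \<odot> f" by (simp add: r_def arens_simps)
  have "bpos ((1 + M) *\<^sub>R (bidual_star r \<odot> y \<odot> r) + (1 + 1/M) *\<^sub>R (bidual_star f \<odot> y \<odot> f)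
    - bidual_star (r + f) \<odot> y \<odot> (r + f))"
    by (rule bpos_conj_add[OF y(1) M])
  then have 1: "bpos ((1 + M) *\<^sub>R (r \<odot> y \<odot> r) + (1 + 1/M) *\<^sub>R (f \<odot> y \<odot> f) - y)"
    by (simp add: f r) (simp add: r_def bidual_sa_one)
  have "bpos (bidual_star r \<odot> (B + e - y) \<odot> r)" unfolding B_def by (intro bpos_conj e)
  then have "bpos (f - f \<odot> f + r \<odot> e \<odot> r - r \<odot> y \<odot> r)"
    by (simp add: r arens.add_left arens.add_right arens.diff_left arens.diff_right rBr)
  then have 2: "bpos ((1 + M) *\<^sub>R (f - f \<odot> f + r \<odot> e \<odot> r - r \<odot> y \<odot> r))"
    using M by (intro bpos_scaleR) simp_all
  have "bpos (bidual_star f \<odot> (M *\<^sub>R \<one> - y) \<odot> f)"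
    by (intro bpos_conj bpos_norm_minus bpos_sa y)
  then have "bpos (M *\<^sub>R (f \<odot> f) - f \<odot> y \<odot> f)" by (simp add: f arens_simps)
  then have "bpos ((1 + 1/M) *\<^sub>R (M *\<^sub>R (f \<odot> f) - f \<odot> y \<odot> f))" using M by (intro bpos_scaleR) simp_all
  moreover have "(1 + 1/M) *\<^sub>R (M *\<^sub>R (f \<odot> f)) = (1 + M) *\<^sub>R (f \<odot> f)" using M by (simp add: distrib_right)
  ultimately have 3: "bpos ((1 + M) *\<^sub>R (f \<odot> f) - (1 + 1/M) *\<^sub>R (f \<odot> y \<odot> f))"
    by (simp only: scaleR_right_diff_distrib)
  have "(1 + M) *\<^sub>R (f + r \<odot> e \<odot> r) - y =
     ((1 + M) *\<^sub>R (r \<odot> y \<odot> r) + (1 + 1/M) *\<^sub>R (f \<odot> y \<odot> f) - y)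
     + (1 + M) *\<^sub>R (f - f \<odot> f + r \<odot> e \<odot> r - r \<odot> y \<odot> r)
     + ((1 + M) *\<^sub>R (f \<odot> f) - (1 + 1/M) *\<^sub>R (f \<odot> y \<odot> f))"
    by (simp only: scaleR_right_diff_distrib scaleR_add_right) simp
  then have "bpos ((1 + M) *\<^sub>R (f + r \<odot> e \<odot> r) - y)" using bpos_add[OF bpos_add[OF 1 2] 3] by (simp only:)
  then show ?thesis by (simp only: r_def f_def)
qed

text \<open>\<open>cutoff_dominates\<close> applies at every b in S with e = h - b, but the factor
  \<one> - cutoff b varies with b. It is split into the fixed \<rho> = \<one> - g and k = g - cutoff
  b: the first part is small under the functional \<psi> (\<rho> . \<rho>), the second because k^2
  <= 2 k.\<close>

lemma cutoff_limit_dominates: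
  assumes S: "\<And>b. b \<in> S \<Longrightarrow> cpos b" "increases_to S h" and g: "increases_to (cutoff ` S) g"
    and y: "bpos y" "norm y \<le> M" and M: "M > 0" and hy: "bpos (h - y)"
  shows "bpos ((1 + M) *\<^sub>R g - y)"
proof (rule bposI)
  have sg: "bidual_star g = g" and sh: "bidual_star h = h"
    using increases_toD(2)[OF g] increases_toD(2)[OF S(2)] by (auto simp: bidual_sa_def)
  show "bidual_sa ((1 + M) *\<^sub>R g - y)" by (simp add: bidual_sa_def bidual_star_simps sg bpos_sa[OF y(1)])
  fix \<psi> :: "'a cdual" assume \<psi>: "positive_functional \<psi>"
  define \<rho> where "\<rho> = \<one> - g"
  have s\<rho>: "bidual_star \<rho> = \<rho>" by (simp add: \<rho>_def bidual_star_simps sg bidual_sa_one)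
  obtain \<psi>' where \<psi>': "positive_functional \<psi>'" "\<And>z. cdual_apply z \<psi>' = cdual_apply (\<rho> \<odot> z \<odot> \<rho>) \<psi>"
    using conj_functional[OF \<psi>, of \<rho>] s\<rho> by metis
  define K where "K = norm h"
  have "Re (cdual_apply y \<psi>) \<le> Re (cdual_apply ((1 + M) *\<^sub>R g) \<psi>) + e" if "e > 0" for e
  proof -
    \<comment> \<open>The error is 1 + M times the sum of 2 d, from the term with \<rho>, and 4 K d,
      from the term with \<open>k\<close>.\<close>
    define d where "d = e / ((1 + M) * (2 + 4 * K))"
    have pos: "(1 + M) * (2 + 4 * K) > 0" using M by (intro mult_pos_pos) (simp_all add: K_def add_pos_nonneg)
    have d: "d > 0" using that pos by (simp add: d_def)
    obtain b1 where b1: "b1 \<in> S" "Re (cdual_apply h \<psi>') < Re (cdual_apply \<psi>' b1) + d"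
      using increases_toD(4)[OF S(2) \<psi>'(1) d] by blast
    obtain b2 where b2: "b2 \<in> S" "Re (cdual_apply g \<psi>) < Re (cdual_apply \<psi> (cutoff b2)) + d"
      using increases_toD(4)[OF g \<psi> d] by blast
    obtain b where b: "b \<in> S" "cstar_le b1 b" "cstar_le b2 b"
      using increases_toD(1)[OF S(2)] b1(1) b2(1) unfolding cstar_directed_def by blast
    define f E k where "f = bidual_emb (cutoff b)" and "E = h - bidual_emb b" and "k = g - f"
    have E: "bpos E" unfolding E_def by (rule bpos_increases_to[OF S(2) b(1)])
    have k: "bpos k" unfolding k_def f_def by (rule bpos_increases_to[OF g]) (use b(1) in simp)
    have "Re (cdual_apply \<psi>' b1) \<le> Re (cdual_apply \<psi>' b)"
      using \<psi>'(1) b(2) by (rule positive_functional_mono)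
    then have 1: "Re (cdual_apply (\<rho> \<odot> E \<odot> \<rho>) \<psi>) \<le> d"
      using b1(2) by (simp add: E_def cdual_rep_eq bidual_emb.rep_eq flip: \<psi>'(2))
    have "cstar_le (cutoff b2) (cutoff b)"
      using b(3) S(1)[OF b2(1)] by (simp add: cstar_le_iff cutoff_mono)
    then have "Re (cdual_apply \<psi> (cutoff b2)) \<le> Re (cdual_apply \<psi> (cutoff b))"
      using \<psi> by (intro positive_functional_mono)
    then have 2: "Re (cdual_apply k \<psi>) \<le> d"
      using b2(2) by (simp add: k_def f_def cdual_rep_eq bidual_emb.rep_eq)
    have "bpos ((1 + M) *\<^sub>R (f + (\<one> - f) \<odot> E \<odot> (\<one> - f)) - y)"
      unfolding f_def by (rule cutoff_dominates[OF S(1)[OF b(1)] y M]) (simp add: E_def hy)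
    from bposD[OF this \<psi>] have 3: "Re (cdual_apply y \<psi>) \<le>
        (1 + M) * (Re (cdual_apply f \<psi>) + Re (cdual_apply ((\<one> - f) \<odot> E \<odot> (\<one> - f)) \<psi>))"
      by (simp add: cdual_rep_eq)
    have sk: "bidual_star k = k" by (rule bpos_sa[OF k])
    have "bpos ((1 + 1) *\<^sub>R (bidual_star \<rho> \<odot> E \<odot> \<rho>) + (1 + 1/1) *\<^sub>R (bidual_star k \<odot> E \<odot> k)
        - bidual_star (\<rho> + k) \<odot> E \<odot> (\<rho> + k))" by (rule bpos_conj_add[OF E]) simp
    moreover have "\<rho> + k = \<one> - f" by (simp add: \<rho>_def k_def)
    moreover have "bidual_star (\<one> - f) = \<one> - f" by (metis \<open>\<rho> + k = \<one> - f\<close> bidual_star_add s\<rho> sk)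
    ultimately have "bpos (2 *\<^sub>R (\<rho> \<odot> E \<odot> \<rho>) + 2 *\<^sub>R (k \<odot> E \<odot> k) - (\<one> - f) \<odot> E \<odot> (\<one> - f))"
      by (simp add: s\<rho> sk)
    from bposD[OF this \<psi>] have 4: "Re (cdual_apply ((\<one> - f) \<odot> E \<odot> (\<one> - f)) \<psi>) \<le>
        2 * Re (cdual_apply (\<rho> \<odot> E \<odot> \<rho>) \<psi>) + 2 * Re (cdual_apply (k \<odot> E \<odot> k) \<psi>)"
      by (simp add: cdual_rep_eq)
    have "norm E \<le> K"
      unfolding K_def using E by (rule norm_bpos_mono) (simp add: E_def bpos_emb S(1) b(1))
    then have "bpos (bidual_star k \<odot> (K *\<^sub>R \<one> - E) \<odot> k)"
      by (intro bpos_conj bpos_norm_minus bpos_sa E)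
    then have "bpos (K *\<^sub>R (k \<odot> k) - k \<odot> E \<odot> k)" by (simp add: sk arens_simps)
    from bposD[OF this \<psi>] have 5: "Re (cdual_apply (k \<odot> E \<odot> k) \<psi>) \<le> K * Re (cdual_apply (k \<odot> k) \<psi>)"
      by (simp add: cdual_rep_eq)
    have "norm k \<le> 2"
    proof -
      have "norm g \<le> 1" by (rule norm_increases_to[OF g]) (use S(1) norm_cutoff in auto)
      moreover have "norm f \<le> 1"
        unfolding f_def using norm_bidual_emb norm_cutoff[OF S(1)[OF b(1)]] by (rule order_trans)
      ultimately show ?thesis unfolding k_def by norm
    qed
    from bposD[OF bpos_square_le_norm[OF k this] \<psi>]
    have 6: "Re (cdual_apply (k \<odot> k) \<psi>) \<le> 2 * Re (cdual_apply k \<psi>)" by (simp add: cdual_rep_eq)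
    have "K * Re (cdual_apply (k \<odot> k) \<psi>) \<le> K * (2 * d)"
      using 6 2 by (intro mult_left_mono) (simp_all add: K_def)
    with 1 4 5 have "Re (cdual_apply ((\<one> - f) \<odot> E \<odot> (\<one> - f)) \<psi>) \<le> (2 + 4 * K) * d"
      by (simp add: algebra_simps)
    moreover have "Re (cdual_apply f \<psi>) \<le> Re (cdual_apply g \<psi>)"
      using bposD[OF k \<psi>] by (simp add: k_def cdual_rep_eq)
    ultimately have "(1 + M) * (Re (cdual_apply f \<psi>) + Re (cdual_apply ((\<one> - f) \<odot> E \<odot> (\<one> - f)) \<psi>))
        \<le> (1 + M) * (Re (cdual_apply g \<psi>) + (2 + 4 * K) * d)"
      using M by (intro mult_left_mono add_mono) auto
    also have "\<dots> = (1 + M) * Re (cdual_apply g \<psi>) + (1 + M) * (2 + 4 * K) * d" by (simp add: distrib_left)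
    also have "(1 + M) * (2 + 4 * K) * d = e"
      unfolding d_def times_divide_eq_right
      by (rule nonzero_mult_div_cancel_left) (use pos in linarith)
    finally show ?thesis using 3 by (simp add: cdual_rep_eq)
  qed
  then have "Re (cdual_apply y \<psi>) \<le> Re (cdual_apply ((1 + M) *\<^sub>R g) \<psi>)" by (rule field_le_epsilon)
  then show "0 \<le> Re (cdual_apply ((1 + M) *\<^sub>R g - y) \<psi>)" by (simp add: cdual_rep_eq)
qed

text \<open>The sets of finite sums have an upward directed, possibly unbounded union, and g is the
  limit of its cut-offs. The N-th partial sum dominates x N, so (1 + M) g does too, with a constant
  independent of N, whereas cutoff a <= a keeps \<phi> g below c.\<close>

lemma truncated_series:
  fixes h x :: "nat \<Rightarrow> 'a :: cstar_algebra bidual"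
  assumes h: "\<And>k. h k \<in> positive_limits"
    and x: "\<And>N. bpos (x N)" "\<And>N. norm (x N) \<le> M" "\<And>N. bpos ((\<Sum>k<N. h k) - x N)" and M: "M > 0"
    and y: "bidual_sa y" "sigma_weak_tendsto x y sequentially"
  obtains g where "g \<in> positive_limits" "bpos ((1 + M) *\<^sub>R g - y)"
    "\<And>\<phi> c. positive_functional \<phi> \<Longrightarrow> (\<And>N. Re (cdual_apply (\<Sum>k<N. h k) \<phi>) \<le> c) \<Longrightarrow> Re (cdual_apply g \<phi>) \<le> c"
proof -
  obtain S where S: "\<And>k a. a \<in> S k \<Longrightarrow> cpos a" "\<And>k. increases_to (S k) (h k)"
    using h unfolding positive_limits_def by simp metis
  define T where "T = rec_nat {0} (\<lambda>N T. {a + b |a b. a \<in> T \<and> b \<in> S N})"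
  have T0: "T 0 = {0}" and TS: "T (Suc N) = {a + b |a b. a \<in> T N \<and> b \<in> S N}" for N
    by (simp_all add: T_def)
  have T: "increases_to (T N) (\<Sum>k<N. h k)" for N
  proof (induction N)
    case 0
    then show ?case using increases_to_singleton[of "0 :: 'a"]
      by (simp add: T0 bidual_emb_simps selfadjoint_def)
  next
    case (Suc N)
    show ?case unfolding TS sum.lessThan_Suc by (rule increases_to_add[OF Suc S(2)])
  qed
  have Tpos: "cpos a" if "a \<in> T N" for N a
    using that by (induction N arbitrary: a) (auto simp: T0 TS intro: cpos_add S(1))
  \<comment> \<open>\<open>T N\<close> need not be contained in \<open>T (Suc N)\<close>; adding any
    member of \<open>S N\<close> moves upwards because it is positive.\<close>
  have step: "\<exists>b\<in>T (Suc N). cstar_le a b" if "a \<in> T N" for N a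
  proof -
    obtain c where "c \<in> S N" using increases_toD(1)[OF S(2)[of N]] by (auto simp: cstar_directed_def)
    then have "a + c \<in> T (Suc N)" "cstar_le a (a + c)" using that S(1) by (auto simp: TS cstar_le_iff)
    then show ?thesis by blast
  qed
  have lift: "\<exists>b\<in>T (N + k). cstar_le a b" if "a \<in> T N" for N k a
  proof (induction k)
    case 0
    then show ?case using that cstar_le_refl by auto
  next
    case (Suc k)
    then show ?case using step[of _ "N + k"] cstar_le_trans by (metis add_Suc_right)
  qed
  define U where "U = (\<Union>N. T N)"
  have dirU: "cstar_directed (cutoff ` U)"
  proof (rule cstar_directed_cutoff)
    show "U \<noteq> {}" using T0 by (auto simp: U_def)
    show "cpos a" if "a \<in> U" for a using that Tpos by (auto simp: U_def)
    fix a b assume "a \<in> U" "b \<in> U"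
    then obtain m n where mn: "a \<in> T m" "b \<in> T n" by (auto simp: U_def)
    obtain a' where a': "a' \<in> T (m + n)" "cstar_le a a'" using lift[OF mn(1)] by blast
    obtain b' where b': "b' \<in> T (m + n)" "cstar_le b b'" using lift[OF mn(2), of m] by (auto simp: add.commute)
    obtain c where "c \<in> T (m + n)" "cstar_le a' c" "cstar_le b' c"
      using increases_toD(1)[OF T] a'(1) b'(1) unfolding cstar_directed_def by blast
    then show "\<exists>c\<in>U. cstar_le a c \<and> cstar_le b c" using a' b' cstar_le_trans unfolding U_def by blast
  qed
  obtain g where g: "increases_to (cutoff ` U) g" using increases_to_exists[OF dirU] by blast
  have "\<forall>a\<in>cutoff ` U. cpos a" by (auto simp: U_def intro: cpos_cutoff Tpos)
  with g have gpos: "g \<in> positive_limits" unfolding positive_limits_def by blast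
  have dom: "bpos ((1 + M) *\<^sub>R g - x N)" for N
  proof -
    have "cstar_directed (cutoff ` T N)"
      using increases_toD(1)[OF T] Tpos by (intro cstar_directed_cutoff) (auto simp: cstar_directed_def)
    then obtain gN where gN: "increases_to (cutoff ` T N) gN" using increases_to_exists by blast
    have "bpos (g - gN)"
    proof (rule bposI)
      show "bidual_sa (g - gN)"
        using increases_toD(2)[OF g] increases_toD(2)[OF gN] by (simp add: bidual_sa_def bidual_star_diff)
      fix \<phi> :: "'a cdual" assume \<phi>: "positive_functional \<phi>"
      have "Re (cdual_apply gN \<phi>) \<le> Re (cdual_apply g \<phi>) + e" if e: "e > 0" for e
      proof -
        obtain a where "a \<in> T N" "Re (cdual_apply gN \<phi>) < Re (cdual_apply \<phi> (cutoff a)) + e"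
          using increases_toD(4)[OF gN \<phi> e] by blast
        moreover from this have "Re (cdual_apply \<phi> (cutoff a)) \<le> Re (cdual_apply g \<phi>)"
          by (intro increases_toD(3)[OF g \<phi>]) (auto simp: U_def)
        ultimately show ?thesis by linarith
      qed
      then have "Re (cdual_apply gN \<phi>) \<le> Re (cdual_apply g \<phi>)" by (rule field_le_epsilon)
      then show "0 \<le> Re (cdual_apply (g - gN) \<phi>)" by (simp add: cdual_rep_eq)
    qed
    then have "bpos ((1 + M) *\<^sub>R (g - gN))" using M by (intro bpos_scaleR) simp_all
    moreover have "bpos ((1 + M) *\<^sub>R gN - x N)"
      by (rule cutoff_limit_dominates[OF Tpos T gN x(1,2) M x(3)])
    ultimately have "bpos ((1 + M) *\<^sub>R (g - gN) + ((1 + M) *\<^sub>R gN - x N))" by (rule bpos_add)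
    then show ?thesis by (simp add: scaleR_right_diff_distrib)
  qed
  have gy: "bpos ((1 + M) *\<^sub>R g - y)"
  proof (rule bposI)
    show "bidual_sa ((1 + M) *\<^sub>R g - y)"
      using increases_toD(2)[OF g] y(1) by (simp add: bidual_sa_def bidual_star_simps)
    fix \<phi> :: "'a cdual" assume \<phi>: "positive_functional \<phi>"
    have "(\<lambda>N. Re (cdual_apply (x N) \<phi>)) \<longlonglongrightarrow> Re (cdual_apply y \<phi>)"
      using y(2) by (intro tendsto_Re) (simp add: sigma_weak_tendsto_def)
    moreover have "Re (cdual_apply (x N) \<phi>) \<le> Re (cdual_apply ((1 + M) *\<^sub>R g) \<phi>)" for N
      using bposD[OF dom \<phi>] by (simp add: cdual_rep_eq)
    ultimately have "Re (cdual_apply y \<phi>) \<le> Re (cdual_apply ((1 + M) *\<^sub>R g) \<phi>)"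
      by (intro LIMSEQ_le_const2) auto
    then show "0 \<le> Re (cdual_apply ((1 + M) *\<^sub>R g - y) \<phi>)" by (simp add: cdual_rep_eq)
  qed
  have "Re (cdual_apply g \<phi>) \<le> c"
    if \<phi>: "positive_functional \<phi>" and c: "\<And>N. Re (cdual_apply (\<Sum>k<N. h k) \<phi>) \<le> c" for \<phi> c
  proof (rule field_le_epsilon)
    fix e :: real assume "e > 0"
    then obtain N a where a: "a \<in> T N" "Re (cdual_apply g \<phi>) < Re (cdual_apply \<phi> (cutoff a)) + e"
      using increases_toD(4)[OF g \<phi>] by (fastforce simp: U_def)
    have "Re (cdual_apply \<phi> (cutoff a)) \<le> Re (cdual_apply \<phi> a)"
      by (rule positive_functional_mono[OF \<phi>]) (simp add: cstar_le_iff cpos_diff_cutoff Tpos[OF a(1)])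
    also have "\<dots> \<le> Re (cdual_apply (\<Sum>k<N. h k) \<phi>)" by (rule increases_toD(3)[OF T \<phi> a(1)])
    also have "\<dots> \<le> c" by (rule c)
    finally show "Re (cdual_apply g \<phi>) \<le> c + e" using a(2) by simp
  qed
  with gpos gy show ?thesis by (rule that)
qed

section \<open>A noncommutative Lusin condition\<close>

abbreviation bidual_sq :: "'a :: cstar_algebra bidual \<Rightarrow> 'a bidual"
  where "bidual_sq x \<equiv> bidual_star x \<odot> x"

text \<open>For commutative A this says that |x - a|^2 lies below a limit of increasing nonnegative
  continuous functions with small integral, as in Lusin's theorem.\<close>

definition lusin :: "'a :: cstar_algebra bidual set"
  where "lusin = {x. \<forall>\<phi>. positive_functional \<phi> \<longrightarrow> (\<forall>e>0. \<exists>a. \<exists>h\<in>positive_limits.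
    bpos (h - bidual_sq (x - bidual_emb a)) \<and> Re (cdual_apply h \<phi>) < e)}"

lemma lusinI:
  assumes "\<And>\<phi> e. positive_functional \<phi> \<Longrightarrow> e > 0 \<Longrightarrow> \<exists>a h. h \<in> positive_limits \<and>
    bpos (h - bidual_sq (x - bidual_emb a)) \<and> Re (cdual_apply h \<phi>) < e"
  shows "x \<in> lusin"
  using assms unfolding lusin_def by blast

lemma lusinD:
  assumes "x \<in> lusin" "positive_functional \<phi>" "e > 0"
  obtains a h where "h \<in> positive_limits" "bpos (h - bidual_sq (x - bidual_emb a))" "Re (cdual_apply h \<phi>) < e"
  using assms unfolding lusin_def by blast

lemma cdual_sel_simps:
  "cdual_apply (x + y) f = cdual_apply x f + cdual_apply y f"
  "cdual_apply (x - y) f = cdual_apply x f - cdual_apply y f"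
  "cdual_apply (- x) f = - cdual_apply x f"
  "cdual_apply (r *\<^sub>R x) f = complex_of_real r * cdual_apply x f"
  by (simp_all add: cdual_rep_eq scaleR_conv_of_real)

lemma bpos_sq_add:
  assumes "bpos (h - bidual_sq u)" "bpos (k - bidual_sq v)"
  shows "bpos (2 *\<^sub>R h + 2 *\<^sub>R k - bidual_sq (u + v))"
proof -
  have "bpos (2 *\<^sub>R (h - bidual_sq u) + 2 *\<^sub>R (k - bidual_sq v))"
    using assms by (intro bpos_add bpos_scaleR) simp_all
  from bpos_add[OF this bpos_square_le[of u v]] show ?thesis
    by (simp add: scaleR_right_diff_distrib algebra_simps)
qed

lemma lusin_add:
  assumes "x \<in> lusin" "y \<in> lusin"
  shows "x + y \<in> lusin"
proof (rule lusinI, goal_cases)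
  case (1 \<phi> e)
  then have \<phi>: "positive_functional \<phi>" and e: "e > 0" by auto
  then have e: "e / 4 > 0" by simp
  obtain a h where a: "h \<in> positive_limits" "bpos (h - bidual_sq (x - bidual_emb a))" "Re (cdual_apply h \<phi>) < e / 4"
    using lusinD[OF assms(1) \<phi> e] .
  obtain b k where b: "k \<in> positive_limits" "bpos (k - bidual_sq (y - bidual_emb b))" "Re (cdual_apply k \<phi>) < e / 4"
    using lusinD[OF assms(2) \<phi> e] .
  have "bpos (2 *\<^sub>R h + 2 *\<^sub>R k - bidual_sq (x + y - bidual_emb (a + b)))"
    using bpos_sq_add[OF a(2) b(2)] by (simp only: bidual_emb_simps add_diff_add)
  moreover have "2 *\<^sub>R h + 2 *\<^sub>R k \<in> positive_limits"
    using a(1) b(1) by (intro positive_limits_add positive_limits_scaleR) simp_all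
  moreover have "Re (cdual_apply (2 *\<^sub>R h + 2 *\<^sub>R k) \<phi>) < e" using a(3) b(3) by (simp add: cdual_sel_simps)
  ultimately show ?case
    by blast
qed

lemma lusin_scaleC:
  assumes "x \<in> lusin"
  shows "c *\<^sub>C x \<in> lusin"
proof (rule lusinI, goal_cases)
  case (1 \<phi> e)
  then have \<phi>: "positive_functional \<phi>" and e: "e > 0" by auto
  define m where "m = (cmod c)\<^sup>2"
  have m: "m \<ge> 0" by (simp add: m_def)
  then have "e / (m + 1) > 0" using e by simp
  then obtain a h where a: "h \<in> positive_limits" "bpos (h - bidual_sq (x - bidual_emb a))" "Re (cdual_apply h \<phi>) < e / (m + 1)"
    by (rule lusinD[OF assms \<phi>])
  have cc: "cnj c * c = complex_of_real m"
    by (simp add: m_def complex_norm_square mult.commute del: of_real_power)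
  have "bidual_sq (c *\<^sub>C z) = m *\<^sub>R bidual_sq z" for z :: "'a bidual"
    by (simp add: bidual_star_scaleC arens_scaleC scaleC_scaleC cc mult.commute[of c] scaleC_of_real)
  moreover have "c *\<^sub>C x - bidual_emb (c *\<^sub>C a) = c *\<^sub>C (x - bidual_emb a)"
    by (simp add: bidual_emb_simps scaleC_diff_right)
  ultimately have "m *\<^sub>R h - bidual_sq (c *\<^sub>C x - bidual_emb (c *\<^sub>C a)) = m *\<^sub>R (h - bidual_sq (x - bidual_emb a))"
    by (simp only: scaleR_right_diff_distrib)
  then have "bpos (m *\<^sub>R h - bidual_sq (c *\<^sub>C x - bidual_emb (c *\<^sub>C a)))"
    using bpos_scaleR[OF m a(2)] by simp
  moreover have "m *\<^sub>R h \<in> positive_limits" by (rule positive_limits_scaleR[OF a(1) m])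
  moreover have "Re (cdual_apply (m *\<^sub>R h) \<phi>) < e"
  proof -
    have "0 \<le> Re (cdual_apply h \<phi>)" by (rule bposD[OF bpos_positive_limits[OF a(1)] \<phi>])
    then have "m * Re (cdual_apply h \<phi>) \<le> (m + 1) * Re (cdual_apply h \<phi>)" by (simp add: distrib_right)
    also have "\<dots> < (m + 1) * (e / (m + 1))" using a(3) m by (intro mult_strict_left_mono) simp_all
    also have "\<dots> = e" using m by simp
    finally show ?thesis by (simp add: cdual_sel_simps)
  qed
  ultimately show ?case
    by blast
qed

lemma lusin_scaleR: "x \<in> lusin \<Longrightarrow> r *\<^sub>R x \<in> lusin"
  using lusin_scaleC[of x "complex_of_real r"] by (simp add: scaleC_of_real)

lemma lusin_minus: "x \<in> lusin \<Longrightarrow> - x \<in> lusin"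
  using lusin_scaleR[of x "-1"] by simp

lemma lusin_diff: "x \<in> lusin \<Longrightarrow> y \<in> lusin \<Longrightarrow> x - y \<in> lusin"
  using lusin_add[OF _ lusin_minus, of x y] by simp

lemma lusin_emb: "bidual_emb a \<in> lusin"
proof (rule lusinI, goal_cases)
  case (1 \<phi> e)
  then have \<phi>: "positive_functional \<phi>" and e: "e > 0" by auto
  then show ?case
    by (intro exI[of _ a] exI[of _ 0]) (simp add: positive_limits_zero arens.zero_right zero_cdual.rep_eq)
qed

lemma lusin_zero: "0 \<in> lusin"
  using lusin_emb[of 0] by (simp add: bidual_emb_simps)

lemma bpos_norm_sq_one: "norm z \<le> r \<Longrightarrow> bpos (r\<^sup>2 *\<^sub>R \<one> - bidual_sq z)"
proof -
  assume "norm z \<le> r"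
  then have "norm (bidual_sq z) \<le> r\<^sup>2"
    using norm_arens[of "bidual_star z" z] power_mono[of "norm z" r 2]
    by (simp add: norm_bidual_star power2_eq_square)
  then show ?thesis by (intro bpos_norm_minus) (simp_all add: bidual_star_simps)
qed

text \<open>A norm error d costs 2 d^2 times \<one>, which is itself in
  \<open>positive_limits\<close> and has \<phi>-value at most the norm of \<phi>.\<close>

lemma closed_lusin: "closed lusin"
proof -
  have "closure lusin \<subseteq> (lusin :: 'a bidual set)"
  proof
    fix x :: "'a bidual" assume x: "x \<in> closure lusin"
    show "x \<in> lusin"
    proof (rule lusinI, goal_cases)
      case (1 \<phi> e)
      then have \<phi>: "positive_functional \<phi>" and e: "e > 0" by auto
      define u where "u = norm \<phi> + 1"
      \<comment> \<open>As d <= 1, this gives 2 d^2 norm \<phi> <= 2 d u <= e/2; the summand 1 in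
        \<open>u\<close> covers \<phi> = 0.\<close>
      define d where "d = min 1 (e / (4 * u))"
      have n1: "u > 0" "norm \<phi> \<le> u" using norm_ge_zero[of \<phi>] unfolding u_def by linarith+
      have d: "d > 0" "d \<le> 1" using e n1 by (simp_all add: d_def)
      obtain y where y: "y \<in> lusin" "dist y x < d" using x d(1) by (auto simp: closure_approachable)
      have "e / 4 > 0" using e by simp
      then obtain a h where a: "h \<in> positive_limits" "bpos (h - bidual_sq (y - bidual_emb a))" "Re (cdual_apply h \<phi>) < e / 4"
        by (rule lusinD[OF y(1) \<phi>])
      have "norm (x - y) \<le> d" using y(2) by (simp add: dist_norm norm_minus_commute)
      then have "bpos (d\<^sup>2 *\<^sub>R \<one> - bidual_sq (x - y))" by (rule bpos_norm_sq_one)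
      from bpos_sq_add[OF this a(2)]
      have "bpos (2 *\<^sub>R d\<^sup>2 *\<^sub>R \<one> + 2 *\<^sub>R h - bidual_sq (x - bidual_emb a))" by simp
      moreover have "2 *\<^sub>R d\<^sup>2 *\<^sub>R \<one> + 2 *\<^sub>R h \<in> positive_limits"
        using a(1) by (intro positive_limits_add positive_limits_scaleR positive_limits_one) simp_all
      moreover have "Re (cdual_apply (2 *\<^sub>R d\<^sup>2 *\<^sub>R \<one> + 2 *\<^sub>R h) \<phi>) < e"
      proof -
        have "d\<^sup>2 * Re (cdual_apply \<one> \<phi>) \<le> d\<^sup>2 * norm \<phi>" by (intro mult_left_mono Re_one_le) simp
        also have "\<dots> \<le> d * u"
          using d n1 by (intro mult_mono) (simp_all add: power2_eq_square mult_left_le_one_le)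
        also have "\<dots> \<le> e / (4 * u) * u"
          using n1 by (intro mult_right_mono) (simp_all add: d_def)
        also have "\<dots> = e / 4" using n1 by simp
        finally show ?thesis using a(3) by (simp add: cdual_sel_simps)
      qed
      ultimately show ?case
        by blast
    qed
  qed
  then have "closure lusin = (lusin :: 'a bidual set)" using closure_subset by (rule antisym)
  then show ?thesis by (metis closed_closure)
qed

text \<open>
  The product is approximated by \<open>x y - a b = (x - a) b + x (y - b)\<close>. Here \<open>b\<close> is chosen first and
  then \<open>a\<close>, for the functional \<open>\<phi> (b\<^sup>* \<cdot> b)\<close>; this is why only left squares
  \<open>(x - a)\<^sup>* (x - a)\<close> occur in the definition of \<open>lusin\<close>.
\<close>

lemma lusin_arens:
  assumes "x \<in> lusin" "y \<in> lusin"
  shows "x \<odot> y \<in> lusin"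
proof (rule lusinI, goal_cases)
  case (1 \<phi> e)
  then have \<phi>: "positive_functional \<phi>" and e: "e > 0" by auto
  define m where "m = (norm x)\<^sup>2"
  have m: "m \<ge> 0" by (simp add: m_def)
  \<comment> \<open>The term 2 m k has to contribute at most e/2; m + 1 avoids division by
    0.\<close>
  then have "e / (4 * (m + 1)) > 0" using e by simp
  then obtain b k where b: "k \<in> positive_limits" "bpos (k - bidual_sq (y - bidual_emb b))"
      "Re (cdual_apply k \<phi>) < e / (4 * (m + 1))"
    by (rule lusinD[OF assms(2) \<phi>])
  let ?b = "bidual_emb b"
  obtain \<psi> where \<psi>: "positive_functional \<psi>" "\<And>z. cdual_apply z \<psi> = cdual_apply (bidual_star ?b \<odot> z \<odot> ?b) \<phi>"
    using conj_functional[OF \<phi>] by metis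
  have "e / 4 > 0" using e by simp
  then obtain a h where a: "h \<in> positive_limits" "bpos (h - bidual_sq (x - bidual_emb a))" "Re (cdual_apply h \<psi>) < e / 4"
    by (rule lusinD[OF assms(1) \<psi>(1)])
  let ?u = "(x - bidual_emb a) \<odot> ?b" and ?v = "x \<odot> (y - ?b)"
  let ?h = "bidual_star ?b \<odot> h \<odot> ?b"
  have "bidual_star ?b \<odot> (h - bidual_sq z) \<odot> ?b = ?h - bidual_sq (z \<odot> ?b)" for z
    by (simp add: arens.diff_left arens.diff_right bidual_star_arens arens_assoc)
  then have 1: "bpos (?h - bidual_sq ?u)" using bpos_conj[OF a(2), of ?b] by (simp only:)
  have 2: "bpos (m *\<^sub>R k - bidual_sq ?v)"
  proof (rule bpos_trans)
    show "bpos (m *\<^sub>R bidual_sq (y - ?b) - bidual_sq ?v)" unfolding m_def by (rule bpos_norm_sq)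
    show "bpos (m *\<^sub>R k - m *\<^sub>R bidual_sq (y - ?b))"
      using bpos_scaleR[OF m b(2)] by (simp only: scaleR_right_diff_distrib)
  qed
  have "?u + ?v = x \<odot> y - bidual_emb (a * b)"
    by (simp add: bidual_emb_mult arens.diff_left arens.diff_right)
  with bpos_sq_add[OF 1 2] have "bpos (2 *\<^sub>R ?h + 2 *\<^sub>R m *\<^sub>R k - bidual_sq (x \<odot> y - bidual_emb (a * b)))"
    by (simp only:)
  moreover have "2 *\<^sub>R ?h + 2 *\<^sub>R m *\<^sub>R k \<in> positive_limits"
    using a(1) b(1) m by (intro positive_limits_add positive_limits_scaleR positive_limits_conj) simp_all
  moreover have "Re (cdual_apply (2 *\<^sub>R ?h + 2 *\<^sub>R m *\<^sub>R k) \<phi>) < e"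
  proof -
    have "0 \<le> Re (cdual_apply k \<phi>)" by (rule bposD[OF bpos_positive_limits[OF b(1)] \<phi>])
    then have "m * Re (cdual_apply k \<phi>) \<le> (m + 1) * Re (cdual_apply k \<phi>)" by (simp add: distrib_right)
    also have "\<dots> \<le> (m + 1) * (e / (4 * (m + 1)))" using b(3) m by (intro mult_left_mono) simp_all
    also have "\<dots> = e / 4"
    proof -
      have "u * (e / (4 * u)) = e / 4" if "u > 0" for u :: real using that by simp
      then show ?thesis using m by (metis add_nonneg_pos zero_less_one)
    qed
    finally have "m * Re (cdual_apply k \<phi>) \<le> e / 4" .
    moreover have "Re (cdual_apply ?h \<phi>) < e / 4" using a(3) by (simp add: \<psi>(2))
    ultimately show ?thesis by (simp add: cdual_sel_simps)
  qed
  ultimately show ?case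
    by blast
qed

lemma lusin_increases_to:
  assumes S: "increases_to S x"
  shows "x \<in> lusin"
proof (rule lusinI, goal_cases)
  case (1 \<phi> e)
  then have \<phi>: "positive_functional \<phi>" and e: "e > 0" by auto
  obtain K where K: "\<And>a. a \<in> S \<Longrightarrow> norm a \<le> K"
    using increases_toD(1)[OF S] by (auto simp: cstar_directed_def bounded_iff)
  obtain a0 where "a0 \<in> S" using increases_toD(1)[OF S] by (auto simp: cstar_directed_def)
  then have "K \<ge> 0" using K norm_ge_zero order_trans by blast
  \<comment> \<open>Bounds the norm of x - a for every a in S.\<close>
  define C where "C = norm x + K + 1"
  have C: "C > 0" using \<open>K \<ge> 0\<close> norm_ge_zero[of x] unfolding C_def by linarith
  then have "e / C > 0" using e by simp
  then obtain a where a: "a \<in> S" "Re (cdual_apply x \<phi>) < Re (cdual_apply \<phi> a) + e / C"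
    using increases_toD(4)[OF S \<phi>] by blast
  let ?d = "x - bidual_emb a"
  have d: "bpos ?d" by (rule bpos_increases_to[OF S a(1)])
  have "norm ?d \<le> C"
    using norm_triangle_ineq4[of x "bidual_emb a"] norm_bidual_emb[of a] K[OF a(1)] unfolding C_def by linarith
  then have "bpos (C *\<^sub>R ?d - bidual_sq ?d)" using bpos_square_le_norm[OF d] by (simp only: bpos_sa[OF d])
  moreover have "C *\<^sub>R ?d \<in> positive_limits"
    using C positive_limits_diff[OF S a(1)] by (intro positive_limits_scaleR) simp_all
  moreover have "Re (cdual_apply (C *\<^sub>R ?d) \<phi>) < e"
  proof -
    have "Re (cdual_apply x \<phi>) - Re (cdual_apply \<phi> a) < e / C" using a(2) by simp
    then have "C * (Re (cdual_apply x \<phi>) - Re (cdual_apply \<phi> a)) < C * (e / C)"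
      using C by (rule mult_strict_left_mono)
    then show ?thesis using C by (simp add: cdual_sel_simps bidual_emb.rep_eq)
  qed
  ultimately show ?case
    by blast
qed

lemma lusin_one: "\<one> \<in> lusin"
  by (rule lusin_increases_to[OF increases_to_one])

text \<open>The root comes from a limit of polynomials in x and \<one>, and \<open>lusin\<close> is
  a norm closed algebra containing both.\<close>

lemma lusin_sqrt:
  assumes x: "x \<in> lusin" "bpos x"
  obtains z where "z \<in> lusin" "x = bidual_sq z"
proof (cases "x = 0")
  case True
  then show ?thesis using that[of 0] by (simp add: lusin_zero arens.zero_right)
next
  case False
  obtain w where w: "bidual_star (\<one> - w) = \<one> - w" "x = norm x *\<^sub>R ((\<one> - w) \<odot> (\<one> - w))"
    "\<And>S. closed S \<Longrightarrow> 0 \<in> S \<Longrightarrow>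
      (\<And>v. v \<in> S \<Longrightarrow> (1/2) *\<^sub>R ((\<one> - (1 / norm x) *\<^sub>R x) + v \<odot> v) \<in> S) \<Longrightarrow> w \<in> S"
    using bpos_sqrt[OF x(2) False] by metis
  have "w \<in> lusin"
    by (rule w(3)[OF closed_lusin lusin_zero])
      (intro lusin_scaleR lusin_add lusin_diff lusin_one lusin_arens x(1); assumption)
  then have "sqrt (norm x) *\<^sub>R (\<one> - w) \<in> lusin" by (intro lusin_scaleR lusin_diff lusin_one)
  moreover have "bidual_sq (sqrt (norm x) *\<^sub>R (\<one> - w)) = (sqrt (norm x) * sqrt (norm x)) *\<^sub>R ((\<one> - w) \<odot> (\<one> - w))"
    by (simp only: bidual_star_scaleR w(1) arens.scaleR_left arens.scaleR_right scaleR_scaleR)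
  then have "x = bidual_sq (sqrt (norm x) *\<^sub>R (\<one> - w))" using w(2) by simp
  ultimately show ?thesis by (rule that)
qed

text \<open>If \<open>d = z\<^sup>* z\<close> and \<open>(z - b)\<^sup>* (z - b) \<le> h\<close>, then \<open>d \<le> 2 b\<^sup>* b + 2 h\<close> and \<open>b\<^sup>* b \<le> 2 d + 2 h\<close>.\<close>

lemma lusin_dominated:
  assumes d: "d \<in> lusin" "bpos d" and \<phi>: "positive_functional \<phi>" and e: "e > 0"
  shows "\<exists>h\<in>positive_limits. bpos (h - d) \<and> Re (cdual_apply h \<phi>) \<le> 4 * Re (cdual_apply d \<phi>) + e"
proof -
  obtain z where z: "z \<in> lusin" "d = bidual_sq z" using lusin_sqrt[OF d] by blast
  \<comment> \<open>6 = 2 + 4: the 2 is from 2 h itself, the 4 from 2 b^* b <= 4 d + 4 h.\<close>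
  have "e / 6 > 0" using e by simp
  then obtain b h where b: "h \<in> positive_limits" "bpos (h - bidual_sq (z - bidual_emb b))" "Re (cdual_apply h \<phi>) < e / 6"
    by (rule lusinD[OF z(1) \<phi>])
  let ?q = "bidual_sq (bidual_emb b)"
  have q: "?q = bidual_emb (star b * b)" by (simp add: bidual_emb_mult bidual_emb_star)
  have 0: "bpos (u - u)" for u :: "'a bidual" by simp
  have "bpos (2 *\<^sub>R h + 2 *\<^sub>R ?q - bidual_sq (z - bidual_emb b + bidual_emb b))"
    by (rule bpos_sq_add[OF b(2) 0])
  then have 1: "bpos (2 *\<^sub>R h + 2 *\<^sub>R ?q - d)" by (simp add: z(2))
  have "bidual_sq (bidual_emb b - z) = bidual_sq (z - bidual_emb b)"
    by (simp only: minus_diff_eq[of z, symmetric] bidual_star_minus arens.minus_left arens.minus_right minus_minus)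
  then have "bpos (h - bidual_sq (bidual_emb b - z))" using b(2) by simp
  from bpos_sq_add[OF 0 this, of z] have "bpos (2 *\<^sub>R d + 2 *\<^sub>R h - ?q)" by (simp add: z(2))
  from bposD[OF this \<phi>] have "Re (cdual_apply ?q \<phi>) \<le> 2 * Re (cdual_apply d \<phi>) + 2 * Re (cdual_apply h \<phi>)"
    by (simp add: cdual_sel_simps)
  then have "Re (cdual_apply (2 *\<^sub>R h + 2 *\<^sub>R ?q) \<phi>) \<le> 4 * Re (cdual_apply d \<phi>) + e"
    using b(3) by (simp add: cdual_sel_simps)
  moreover have "2 *\<^sub>R h + 2 *\<^sub>R ?q \<in> positive_limits"
    unfolding q using b(1)
    by (intro positive_limits_add positive_limits_scaleR positive_limits_emb cpos_star_mult_self) simp_all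
  ultimately show ?thesis using 1 by blast
qed

text \<open>The approximant of x is that of s n for a large n. The remainder satisfies (x - s n)^2
  <= M (x - s n), and \<open>truncated_series\<close> bounds x - s n, through its increments, by (1
  + M) g with \<phi> g <= c.\<close>

lemma lusin_increasing_limit:
  fixes s :: "nat \<Rightarrow> 'a :: cstar_algebra bidual"
  assumes s: "\<And>n. s n \<in> lusin" "\<And>n. bidual_sa (s n)" "bounded (range s)"
      "\<And>n. bpos (s (Suc n) - s n)" and lim: "sigma_weak_tendsto s x sequentially"
  shows "x \<in> lusin"
proof -
  have sx: "bidual_sa x" by (rule bidual_sa_limit[OF s(2) lim])
  have mono: "bpos (s (n + k) - s n)" for n k
  proof (induction k)
    case (Suc k)
    from bpos_trans[OF this s(4)[of "n + k"]] show ?case by simp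
  qed simp
  have limRe: "(\<lambda>n. Re (cdual_apply (s n) \<phi>)) \<longlonglongrightarrow> Re (cdual_apply x \<phi>)" for \<phi>
    using lim by (intro tendsto_Re) (simp add: sigma_weak_tendsto_def)
  have le: "bpos (x - s n)" for n
  proof (rule bposI)
    show "bidual_sa (x - s n)" using sx s(2) by (simp add: bidual_sa_def bidual_star_diff)
    fix \<phi> :: "'a cdual" assume \<phi>: "positive_functional \<phi>"
    have "Re (cdual_apply (s n) \<phi>) \<le> Re (cdual_apply x \<phi>)"
    proof (rule LIMSEQ_le_const[OF limRe])
      have "Re (cdual_apply (s n) \<phi>) \<le> Re (cdual_apply (s m) \<phi>)" if "n \<le> m" for m
        using bposD[OF mono[of n "m - n"] \<phi>] that by (simp add: cdual_sel_simps)
      then show "\<exists>N. \<forall>m\<ge>N. Re (cdual_apply (s n) \<phi>) \<le> Re (cdual_apply (s m) \<phi>)" by blast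
    qed
    then show "0 \<le> Re (cdual_apply (x - s n) \<phi>)" by (simp add: cdual_sel_simps)
  qed
  obtain K where K: "\<And>n. norm (s n) \<le> K" using s(3) by (auto simp: bounded_iff)
  define M where "M = norm x + K + 1"
  have M: "M > 0" using norm_ge_zero[of x] norm_ge_zero[of "s 0"] K[of 0] unfolding M_def by linarith
  have nM: "norm (x - s n) \<le> M" for n
    using norm_triangle_ineq4[of x "s n"] K[of n] unfolding M_def by linarith
  have nM': "norm (s (n + k) - s n) \<le> M" for n k
    by (rule order_trans[OF norm_bpos_mono[OF mono, of "x - s n"] nM]) (simp add: le)
  show ?thesis
  proof (rule lusinI, goal_cases)
    case (1 \<phi> e)
    then have \<phi>: "positive_functional \<phi>" and e: "e > 0" by auto
    \<comment> \<open>The coefficient of g in the final dominating element; \<open>c\<close> makes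
      its share e/2.\<close>
    define A where "A = 2 * (M * (1 + M))"
    have A: "A > 0" using M by (simp add: A_def)
    define c where "c = e / (2 * A)"
    have c: "c > 0" using e A by (simp add: c_def)
    \<comment> \<open>The factor 4 of \<open>lusin_dominated\<close> turns c/8 into c/2; the other
      c/2 is spread geometrically over the increments.\<close>
    then have "c / 8 > 0" by simp
    from LIMSEQ_D[OF limRe[of \<phi>] this] obtain n where n: "\<bar>Re (cdual_apply (s n) \<phi>) - Re (cdual_apply x \<phi>)\<bar> < c / 8"
      by auto
    define D where "D k = s (Suc (n + k)) - s (n + k)" for k
    have "\<exists>h\<in>positive_limits. bpos (h - D k) \<and>
        Re (cdual_apply h \<phi>) \<le> 4 * Re (cdual_apply (D k) \<phi>) + c / 2 * (1/2) ^ Suc k" for k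
      unfolding D_def using c by (intro lusin_dominated lusin_diff s \<phi>) simp
    then obtain h where h: "\<And>k. h k \<in> positive_limits" "\<And>k. bpos (h k - D k)"
        "\<And>k. Re (cdual_apply (h k) \<phi>) \<le> 4 * Re (cdual_apply (D k) \<phi>) + c / 2 * (1/2) ^ Suc k"
      by metis
    have sum_pos: "bpos ((\<Sum>k<N. h k) - (s (n + N) - s n))" for N
    proof (induction N)
      case (Suc N)
      from bpos_add[OF this h(2)[of N]] show ?case by (simp add: D_def algebra_simps)
    qed simp
    have sum_le: "Re (cdual_apply (\<Sum>k<N. h k) \<phi>)
        \<le> 4 * (Re (cdual_apply (s (n + N)) \<phi>) - Re (cdual_apply (s n) \<phi>)) + c / 2 * (1 - (1/2) ^ N)" for N
    proof (induction N)
      case (Suc N)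
      then show ?case using h(3)[of N] by (simp add: D_def cdual_sel_simps algebra_simps)
    qed (simp add: zero_cdual.rep_eq)
    have sum_c: "Re (cdual_apply (\<Sum>k<N. h k) \<phi>) \<le> c" for N
    proof -
      have "Re (cdual_apply (s (n + N)) \<phi>) \<le> Re (cdual_apply x \<phi>)"
        using bposD[OF le \<phi>] by (simp add: cdual_sel_simps)
      moreover have "c / 2 * (1 - (1/2) ^ N) \<le> c / 2 * 1" using c by (intro mult_left_mono) simp_all
      moreover have "Re (cdual_apply x \<phi>) - Re (cdual_apply (s n) \<phi>) < c / 8" using n by linarith
      ultimately show ?thesis using sum_le[of N] by argo
    qed
    have "bidual_sa (x - s n)" using sx s(2) by (simp add: bidual_sa_def bidual_star_diff)
    moreover have "sigma_weak_tendsto (\<lambda>N. s (n + N) - s n) (x - s n) sequentially"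
      unfolding sigma_weak_tendsto_def cdual_sel_simps
    proof (intro allI tendsto_diff tendsto_const)
      show "(\<lambda>N. cdual_apply (s (n + N)) f) \<longlonglongrightarrow> cdual_apply x f" for f
        using lim LIMSEQ_ignore_initial_segment[of "\<lambda>N. cdual_apply (s N) f" _ n]
        by (simp add: sigma_weak_tendsto_def add.commute)
    qed
    ultimately obtain g where g: "g \<in> positive_limits" "bpos ((1 + M) *\<^sub>R g - (x - s n))"
      "\<And>\<phi> c. positive_functional \<phi> \<Longrightarrow> (\<And>N. Re (cdual_apply (\<Sum>k<N. h k) \<phi>) \<le> c) \<Longrightarrow> Re (cdual_apply g \<phi>) \<le> c"
      using truncated_series[OF h(1) mono nM' sum_pos M] by blast
    have gc: "Re (cdual_apply g \<phi>) \<le> c" by (rule g(3)[OF \<phi> sum_c])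
    have "e / 4 > 0" using e by simp
    then obtain a k where a: "k \<in> positive_limits" "bpos (k - bidual_sq (s n - bidual_emb a))" "Re (cdual_apply k \<phi>) < e / 4"
      by (rule lusinD[OF s(1) \<phi>])
    have "bpos (M *\<^sub>R (x - s n) - bidual_sq (x - s n))"
      using bpos_square_le_norm[OF le nM] by (simp only: bpos_sa[OF le])
    moreover have "bpos (M *\<^sub>R ((1 + M) *\<^sub>R g) - M *\<^sub>R (x - s n))"
      using bpos_scaleR[OF _ g(2), of M] M by (simp only: scaleR_right_diff_distrib less_imp_le)
    ultimately have "bpos (M *\<^sub>R (1 + M) *\<^sub>R g - bidual_sq (x - s n))" by (rule bpos_trans)
    from bpos_sq_add[OF this a(2)] have "bpos (2 *\<^sub>R M *\<^sub>R (1 + M) *\<^sub>R g + 2 *\<^sub>R k - bidual_sq (x - bidual_emb a))"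
      by simp
    moreover have "2 *\<^sub>R M *\<^sub>R (1 + M) *\<^sub>R g + 2 *\<^sub>R k \<in> positive_limits"
      using g(1) a(1) M by (intro positive_limits_add positive_limits_scaleR) simp_all
    moreover have "Re (cdual_apply (2 *\<^sub>R M *\<^sub>R (1 + M) *\<^sub>R g + 2 *\<^sub>R k) \<phi>) < e"
    proof -
      have "A * Re (cdual_apply g \<phi>) \<le> A * c" using gc A by (intro mult_left_mono) simp_all
      also have "\<dots> = e / 2" using A by (simp add: c_def)
      finally show ?thesis using a(3) by (simp add: cdual_sel_simps A_def mult.assoc)
    qed
    ultimately show ?case
      by blast
  qed
qed

text \<open>The Lusin condition controls left squares only, so closure under the involution is
  obtained by imposing it on both x and its adjoint.\<close>

lemma cstar_subalgebra_lusin: "cstar_subalgebra {x. x \<in> lusin \<and> bidual_star x \<in> lusin}"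
  unfolding cstar_subalgebra_def
proof (intro conjI ballI allI)
  have "closed (lusin \<inter> bidual_star -` (lusin :: 'a bidual set))"
    by (intro closed_Int closed_lusin continuous_closed_vimage linear_continuous_at bounded_linear_bidual_star)
  moreover have "lusin \<inter> bidual_star -` lusin = {x :: 'a bidual. x \<in> lusin \<and> bidual_star x \<in> lusin}" by auto
  ultimately show "closed {x :: 'a bidual. x \<in> lusin \<and> bidual_star x \<in> lusin}" by simp
  have "bidual_star 0 = (0 :: 'a bidual)" using bidual_star_diff[of 0 "0 :: 'a bidual"] by simp
  then show "(0 :: 'a bidual) \<in> {x. x \<in> lusin \<and> bidual_star x \<in> lusin}" by (simp add: lusin_zero)
qed (auto simp: bidual_star_simps bidual_star_scaleC intro: lusin_add lusin_scaleC lusin_arens)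

lemma monotone_seq_closed_lusin: "monotone_seq_closed {x. x \<in> lusin \<and> bidual_star x \<in> lusin}"
  unfolding monotone_seq_closed_def
proof (intro allI impI)
  fix s :: "nat \<Rightarrow> 'a bidual" and x
  assume *: "(\<forall>n. s n \<in> {x. x \<in> lusin \<and> bidual_star x \<in> lusin} \<and> bidual_sa (s n)) \<and> bounded (range s) \<and>
    ((\<forall>n. s n \<sqsubseteq> s (Suc n)) \<or> (\<forall>n. s (Suc n) \<sqsubseteq> s n)) \<and> sigma_weak_tendsto s x sequentially"
  have s: "\<And>n. s n \<in> lusin" "\<And>n. bidual_sa (s n)" "bounded (range s)" and lim: "sigma_weak_tendsto s x sequentially"
    using * by auto
  have sx: "bidual_sa x" by (rule bidual_sa_limit[OF s(2) lim])
  have "x \<in> lusin"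
  proof (cases "\<forall>n. s n \<sqsubseteq> s (Suc n)")
    case True
    then show ?thesis using lusin_increasing_limit[OF s _ lim] by (simp add: bidual_le_iff)
  next
    case False
    then have dec: "s (Suc n) \<sqsubseteq> s n" for n using * by blast
    have "- x \<in> lusin"
    proof (rule lusin_increasing_limit)
      show "- s n \<in> lusin" "bidual_sa (- s n)" for n
        using s by (simp_all add: lusin_minus bidual_sa_def bidual_star_minus)
      show "bounded (range (\<lambda>n. - s n))" using s(3) by (auto simp: bounded_iff)
      show "bpos (- s (Suc n) - - s n)" for n using dec[of n] by (simp add: bidual_le_iff)
      show "sigma_weak_tendsto (\<lambda>n. - s n) (- x) sequentially"
        using lim by (auto simp: sigma_weak_tendsto_def cdual_sel_simps intro: tendsto_minus)
    qed
    then show ?thesis using lusin_minus[of "- x"] by simp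
  qed
  with sx show "x \<in> {x. x \<in> lusin \<and> bidual_star x \<in> lusin} \<and> bidual_sa x" by (simp add: bidual_sa_def)
qed

section \<open>From semicontinuous to Lusin to universally measurable elements\<close>

lemma bidual_sa_strongly_lsc: "x \<in> strongly_lsc \<Longrightarrow> bidual_star x = x"
proof -
  have "closed {x :: 'a bidual. bidual_star x = x}"
    by (intro closed_Collect_eq continuous_on_id bounded_linear.continuous_on[OF bounded_linear_bidual_star])
  moreover have "sa_monotone_limits \<subseteq> {x :: 'a bidual. bidual_star x = x}"
    by (auto elim!: sa_monotone_limitsE dest: increases_toD(2) simp: bidual_sa_def)
  ultimately have "strongly_lsc \<subseteq> {x :: 'a bidual. bidual_star x = x}"
    unfolding strongly_lsc_def by (rule closure_minimal[rotated])
  then show "x \<in> strongly_lsc \<Longrightarrow> bidual_star x = x" by auto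
qed

lemma strongly_lsc_subset_lusin: "strongly_lsc \<subseteq> lusin"
  unfolding strongly_lsc_def
  by (rule closure_minimal[OF _ closed_lusin]) (auto elim: sa_monotone_limitsE intro: lusin_increases_to)

lemma strongly_lscI:
  assumes a: "selfadjoint a" and h: "h \<in> positive_limits"
  shows "bidual_emb a + h \<in> strongly_lsc"
proof -
  obtain S where "increases_to S h" using h by (auto simp: positive_limits_def)
  from increases_to_add[OF increases_to_singleton[OF a] this] have "bidual_emb a + h \<in> sa_monotone_limits"
    by (rule sa_monotone_limitsI)
  then show ?thesis unfolding strongly_lsc_def using closure_subset by blast
qed

text \<open>
  For \<open>y = x - a\<close> with \<open>y\<^sup>* y \<le> h\<close> one has \<open>\<plusminus> (y + y\<^sup>*) \<le> t y\<^sup>* y + 1/t \<le> t h + 1/t\<close>.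
\<close>

lemma lusin_universally_measurable:
  assumes x: "x \<in> lusin" "bidual_star x = x"
  shows "x \<in> universally_measurable"
  unfolding universally_measurable_def
proof (intro CollectI conjI allI impI)
  show "bidual_sa x" using x(2) by (simp add: bidual_sa_def)
  fix e :: real and \<phi> :: "'a cdual" assume e: "e > 0" and "state \<phi>"
  then have \<phi>: "positive_functional \<phi>" "norm \<phi> = 1" by (auto simp: state_def positive_functional_def)
  \<comment> \<open>Splits e evenly: t \<phi> h < e/2, and 1/t = e/2 times the value of \<one>,
    which is at most 1 on a state.\<close>
  define t where "t = 2 / e"
  have t: "t > 0" using e by (simp add: t_def)
  have "e / (2 * t) > 0" using e t by simp
  then obtain a h where a: "h \<in> positive_limits" "bpos (h - bidual_sq (x - bidual_emb a))" "Re (cdual_apply h \<phi>) < e / (2 * t)"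
    by (rule lusinD[OF x(1) \<phi>(1)])
  define y where "y = x - bidual_emb a"
  \<comment> \<open>\<open>a\<close> need not be self-adjoint; as \<open>x\<close> is, y + y^*
    involves only the real part \<open>c\<close> of \<open>a\<close>.\<close>
  define c where "c = (1/2) *\<^sub>R (a + star a)"
  have c: "selfadjoint c" by (simp add: c_def selfadjoint_def star_simps add.commute)
  have yy: "y + bidual_star y = 2 *\<^sub>R (x - bidual_emb c)"
    by (simp add: y_def c_def bidual_star_simps x(2) bidual_emb_simps flip: bidual_emb_star)
      (simp add: scaleR_2 scaleR_right_diff_distrib)
  define g where "g = (1/2) *\<^sub>R (t *\<^sub>R h + (1/t) *\<^sub>R \<one>)"
  have g: "g \<in> positive_limits"
    unfolding g_def using a(1) t by (intro positive_limits_scaleR positive_limits_add positive_limits_one) simp_all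
  \<comment> \<open>r = 1 gives the upper bound for \<open>x\<close>, r = -1 the lower one.\<close>
  have bound: "bpos (g - r *\<^sub>R (x - bidual_emb c))" if "r = 1 \<or> r = -1" for r :: real
  proof -
    have rr: "r * r = 1" using that by auto
    let ?w = "t *\<^sub>R y - r *\<^sub>R \<one>"
    have "bidual_sq ?w = (t * t) *\<^sub>R bidual_sq y - (t * r) *\<^sub>R (y + bidual_star y) + \<one>"
      by (simp add: bidual_star_simps bidual_sa_one arens_simps rr scaleR_right_diff_distrib scaleR_add_right algebra_simps)
    then have "(1/t) *\<^sub>R bidual_sq ?w = t *\<^sub>R bidual_sq y - r *\<^sub>R (y + bidual_star y) + (1/t) *\<^sub>R \<one>"
      using t by (simp add: scaleR_right_diff_distrib scaleR_add_right)
    moreover have "bpos ((1/t) *\<^sub>R bidual_sq ?w)" using t by (intro bpos_scaleR bpos_star_arens) simp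
    moreover have "bpos (t *\<^sub>R (h - bidual_sq y))" using t a(2) unfolding y_def by (intro bpos_scaleR) simp_all
    ultimately have "bpos (t *\<^sub>R (h - bidual_sq y) + (t *\<^sub>R bidual_sq y - r *\<^sub>R (y + bidual_star y) + (1/t) *\<^sub>R \<one>))"
      by (metis bpos_add)
    moreover have "t *\<^sub>R (h - bidual_sq y) + (t *\<^sub>R bidual_sq y - r *\<^sub>R (y + bidual_star y) + (1/t) *\<^sub>R \<one>)
        = t *\<^sub>R h + (1/t) *\<^sub>R \<one> - r *\<^sub>R (y + bidual_star y)"
      by (simp add: scaleR_right_diff_distrib)
    ultimately have "bpos (t *\<^sub>R h + (1/t) *\<^sub>R \<one> - r *\<^sub>R (2 *\<^sub>R (x - bidual_emb c)))"
      by (simp only: yy)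
    then have "bpos ((1/2) *\<^sub>R (t *\<^sub>R h + (1/t) *\<^sub>R \<one> - r *\<^sub>R (2 *\<^sub>R (x - bidual_emb c))))"
      by (intro bpos_scaleR) simp_all
    then show ?thesis by (simp add: g_def scaleR_right_diff_distrib)
  qed
  show "\<exists>h\<in>strongly_lsc. \<exists>k\<in>strongly_usc. k \<sqsubseteq> x \<and> x \<sqsubseteq> h \<and> Re (cdual_apply (h - k) \<phi>) < e"
  proof (intro bexI conjI)
    show "bidual_emb c + g \<in> strongly_lsc" by (rule strongly_lscI[OF c g])
    have "selfadjoint (- c)" using c by (simp add: selfadjoint_def star_minus)
    from strongly_lscI[OF this g] show "bidual_emb c - g \<in> strongly_usc"
      by (simp add: strongly_usc_def bidual_emb_simps)
    show "x \<sqsubseteq> bidual_emb c + g" using bound[of 1] by (simp add: bidual_le_iff algebra_simps)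
    show "bidual_emb c - g \<sqsubseteq> x" using bound[of "-1"] by (simp add: bidual_le_iff algebra_simps)
    have "Re (cdual_apply (bidual_emb c + g - (bidual_emb c - g)) \<phi>)
        = t * Re (cdual_apply h \<phi>) + (1/t) * Re (cdual_apply \<one> \<phi>)"
      by (simp add: g_def cdual_sel_simps)
    also have "\<dots> < t * (e / (2 * t)) + (1/t) * 1"
    proof (rule add_less_le_mono)
      show "t * Re (cdual_apply h \<phi>) < t * (e / (2 * t))" using a(3) t by (rule mult_strict_left_mono)
      show "1 / t * Re (cdual_apply \<one> \<phi>) \<le> 1 / t * 1"
        using t Re_one_le[of \<phi>] \<phi>(2) by (intro mult_left_mono) simp_all
    qed
    also have "\<dots> = e" using t e by (simp add: t_def)
    finally show "Re (cdual_apply (bidual_emb c + g - (bidual_emb c - g)) \<phi>) < e" .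
  qed
qed

theorem corollary5:
  shows "(borel_envelope :: 'a :: cstar_algebra bidual set) \<subseteq> universally_measurable_C"
proof
  fix x :: "'a bidual"
  assume "x \<in> borel_envelope"
  moreover have "borel_envelope \<subseteq> {x :: 'a bidual. x \<in> lusin \<and> bidual_star x \<in> lusin}"
    using strongly_lsc_subset_lusin
    by (intro borel_envelope_least cstar_subalgebra_lusin monotone_seq_closed_lusin)
      (auto simp: bidual_sa_strongly_lsc)
  ultimately have x: "x \<in> lusin" "bidual_star x \<in> lusin" by auto
  \<comment> \<open>Real and imaginary part of x; both are Lusin because x and its adjoint
    are.\<close>
  let ?a = "(1/2) *\<^sub>C (x + bidual_star x)" and ?b = "(- \<i> / 2) *\<^sub>C (x - bidual_star x)"
  have "?a \<in> universally_measurable"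
    by (intro lusin_universally_measurable lusin_scaleC lusin_add x)
      (simp add: bidual_star_scaleC bidual_star_simps add.commute)
  moreover have "?b \<in> universally_measurable"
    by (intro lusin_universally_measurable lusin_scaleC lusin_diff x)
      (simp add: bidual_star_scaleC bidual_star_simps scaleC_diff_right scaleC_minus_left)
  moreover have "x = ?a + \<i> *\<^sub>C ?b" by (rule cdual_eqI) (simp add: cdual_rep_eq field_simps)
  ultimately show "x \<in> universally_measurable_C" unfolding universally_measurable_C_def by blast
qed

end
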